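(* For every bridgeless cubic graph $G$, $\nu_2(G) \geq \frac{44}{45}\cdot \frac{|V(G)| + 2\cdot \nu_3(G)}{4}$.
   Context: Graphs are finite, without loops, possibly with multiple edges; a graph is cubic if every vertex has degree $3$, and bridgeless if it has no edge whose removal increases the number of connected components. For $k\geq 1$, $\nu_k(G)$ is the maximum number of edges of a $k$-edge-colorable subgraph of $G$. *)

theory Defs
  imports Complex_Main
begin

text \<open>A finite multigraph without loops: vertex set V, edge set E (edges are
  abstract objects, so parallel edges are allowed), and an endpoint map
  assigning to each edge a set of exactly two distinct vertices.\<close>

definition multigraph :: "'v set \<Rightarrow> 'e set \<Rightarrow> ('e \<Rightarrow> 'v set) \<Rightarrow> bool" where
  "multigraph V E ends \<longleftrightarrow> finite V \<and> finite E \<and>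
     (\<forall>e\<in>E. ends e \<subseteq> V \<and> card (ends e) = 2)"

definition degree :: "'e set \<Rightarrow> ('e \<Rightarrow> 'v set) \<Rightarrow> 'v \<Rightarrow> nat" where
  "degree E ends v = card {e\<in>E. v \<in> ends e}"

definition cubic :: "'v set \<Rightarrow> 'e set \<Rightarrow> ('e \<Rightarrow> 'v set) \<Rightarrow> bool" where
  "cubic V E ends \<longleftrightarrow> multigraph V E ends \<and> (\<forall>v\<in>V. degree E ends v = 3)"

definition adj :: "'e set \<Rightarrow> ('e \<Rightarrow> 'v set) \<Rightarrow> 'v \<Rightarrow> 'v \<Rightarrow> bool" where
  "adj F ends u v \<longleftrightarrow> (\<exists>e\<in>F. ends e = {u, v})"

definition num_components :: "'v set \<Rightarrow> 'e set \<Rightarrow> ('e \<Rightarrow> 'v set) \<Rightarrow> nat" where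
  "num_components V F ends =
     card (V // {(u, v). u \<in> V \<and> v \<in> V \<and> (adj F ends)\<^sup>*\<^sup>* u v})"

definition is_bridge :: "'v set \<Rightarrow> 'e set \<Rightarrow> ('e \<Rightarrow> 'v set) \<Rightarrow> 'e \<Rightarrow> bool" where
  "is_bridge V E ends e \<longleftrightarrow> e \<in> E \<and>
     num_components V (E - {e}) ends > num_components V E ends"

definition bridgeless :: "'v set \<Rightarrow> 'e set \<Rightarrow> ('e \<Rightarrow> 'v set) \<Rightarrow> bool" where
  "bridgeless V E ends \<longleftrightarrow> (\<forall>e\<in>E. \<not> is_bridge V E ends e)"

definition k_edge_colorable :: "nat \<Rightarrow> 'e set \<Rightarrow> ('e \<Rightarrow> 'v set) \<Rightarrow> bool" where
  "k_edge_colorable k F ends \<longleftrightarrow> (\<exists>c :: 'e \<Rightarrow> nat.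
     (\<forall>e\<in>F. c e < k) \<and>
     (\<forall>e\<in>F. \<forall>f\<in>F. e \<noteq> f \<and> ends e \<inter> ends f \<noteq> {} \<longrightarrow> c e \<noteq> c f))"

definition nu :: "nat \<Rightarrow> 'e set \<Rightarrow> ('e \<Rightarrow> 'v set) \<Rightarrow> nat" where
  "nu k E ends = Max {card F | F. F \<subseteq> E \<and> k_edge_colorable k F ends}"

end

theory Submission
  imports Defs "HOL-Combinatorics.Transposition"
begin

text \<open>Let \<open>n\<close> be the number of vertices and \<open>r\<close> the number of edges left uncoloured by an optimal
  partial 3-edge-colouring.  Each uncoloured edge closes a two-coloured path to an odd cycle; the
  remaining edges at its vertices all have the third colour, and these cycles are disjoint.  Call a coloured edge
  joining if both of its ends miss a common colour.  Dropping one colour and recolouring its joining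
  edges with the colour missing at both ends gives a 2-edge-colourable subgraph; averaging over the
  three colours reduces the claim to \<open>8 * r \<le> n + 15 * j\<close>, where \<open>j\<close> is the number of joining edges
  and the colouring is chosen to maximise \<open>j\<close> among the optimal ones.

  This inequality is proved by discharging: only cycles of length 5 and 7 that meet no joining edge
  need help, which they get from the vertices outside such cycles to which their spokes lead.
  Swapping the Kempe chain of length two through such a vertex yields another optimal colouring;
  disjointness of its cycles and maximality of \<open>j\<close> then limit how far these vertices are shared.
  Bridgelessness gives at least three outgoing spokes.  Triangles and double edges, which would
  allow short cycles and chords, are contracted beforehand.\<close>

text \<open>Origin of the constants: the graph has \<open>3 * n / 2\<close> edges, so
  \<open>nu_3\<close> is \<open>3 * n / 2 - r\<close>, and averaging gives a 2-edge-colourable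
  subgraph with at least \<open>(3 * n - 2 * r + j) / 3\<close> edges. The claim asks for
  \<open>(11 * n + 22 * nu_3) / 45 = (44 * n - 22 * r) / 45\<close>; what remains is exactly
  \<open>8 * r <= n + 15 * j\<close>. So an uncoloured edge should own eight vertices on average. A
  cycle of length 9 or more has them; lengths 5 and 7 lack three and one. Uncoloured edges that
  touch a joining edge are charged to it, at most two for each.

  The obstacle is a 5-cycle all of whose outer neighbours are shared. Swapping shows that
  neighbouring spokes can share only with the same cycle, so the worst case is a pair of 5-cycles
  with five common neighbours: 15 vertices where 16 are wanted. But 15 is odd, so at least three
  edges leave this block, and the vertices they lead to supply the missing unit.

  Disjointness of the cycles holds in every optimal colouring. That is why it can be applied again
  after a swap, and why each swap has to leave all cycles but two intact.\<close>

section \<open>Partial edge colourings and Kempe chains\<close>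

text \<open>Bridgelessness enters as a condition on cuts: this form passes to a contracted graph by
  taking preimages, and with the parity from \<open>card_cut\<close> it gives three edges out of
  every odd vertex set.\<close>

locale cubic_multigraph =
  fixes V :: "'v set" and E :: "'e set" and ends :: "'e \<Rightarrow> 'v set"
  assumes finite_V: "finite V"
    and finite_E: "finite E"
    and ends_subset: "e \<in> E \<Longrightarrow> ends e \<subseteq> V"
    and card_ends: "e \<in> E \<Longrightarrow> card (ends e) = 2"
    and degree_3: "v \<in> V \<Longrightarrow> card {e\<in>E. v \<in> ends e} = 3"
    and no_single_cut:
      "S \<subseteq> V \<Longrightarrow> card {e\<in>E. ends e \<inter> S \<noteq> {} \<and> \<not> ends e \<subseteq> S} \<noteq> 1"
begin

definition inc :: "'v \<Rightarrow> 'e set" where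
  "inc v = {e\<in>E. v \<in> ends e}"

definition nb :: "('e \<Rightarrow> nat) \<Rightarrow> nat \<Rightarrow> 'v \<Rightarrow> 'v \<Rightarrow> bool" where
  "nb c a u v \<longleftrightarrow> (\<exists>e\<in>E. ends e = {u, v} \<and> c e = a)"

definition miss :: "('e \<Rightarrow> nat) \<Rightarrow> 'v \<Rightarrow> nat \<Rightarrow> bool" where
  "miss c v a \<longleftrightarrow> (\<forall>e\<in>inc v. c e \<noteq> a)"

text \<open>A partial 3-edge-colouring uses the colours 1, 2, 3; colour 0 marks the uncoloured edges.\<close>

definition proper :: "('e \<Rightarrow> nat) \<Rightarrow> bool" where
  "proper c \<longleftrightarrow> (\<forall>e\<in>E. c e \<le> 3) \<and>
     (\<forall>e\<in>E. \<forall>f\<in>E. e \<noteq> f \<and> ends e \<inter> ends f \<noteq> {} \<and> c e = c f \<longrightarrow> c e = 0)"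

definition unc :: "('e \<Rightarrow> nat) \<Rightarrow> 'e set" where
  "unc c = {e\<in>E. c e = 0}"

definition opt :: "('e \<Rightarrow> nat) \<Rightarrow> bool" where
  "opt c \<longleftrightarrow> proper c \<and> (\<forall>c'. proper c' \<longrightarrow> card (unc c) \<le> card (unc c'))"

definition step :: "('e \<Rightarrow> nat) \<Rightarrow> nat set \<Rightarrow> 'v \<Rightarrow> 'v \<Rightarrow> bool" where
  "step c A p q \<longleftrightarrow> (\<exists>e\<in>E. ends e = {p, q} \<and> c e \<in> A)"

text \<open>For a set of two colours this is a Kempe chain. It is also used with
  \<open>A = -{k}\<close>, where uncoloured edges count as well, so that a chain and the uncoloured
  edge closing it belong to one component.\<close>

definition kcomp :: "('e \<Rightarrow> nat) \<Rightarrow> nat set \<Rightarrow> 'v \<Rightarrow> 'v set" where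
  "kcomp c A u = {v. (step c A)\<^sup>*\<^sup>* u v}"

definition stable :: "('e \<Rightarrow> nat) \<Rightarrow> nat set \<Rightarrow> 'v set \<Rightarrow> bool" where
  "stable c A X \<longleftrightarrow> (\<forall>e\<in>E. c e \<in> A \<and> ends e \<inter> X \<noteq> {} \<longrightarrow> ends e \<subseteq> X)"

section \<open>Elementary facts about ends, neighbours and missing colours\<close>

lemma ends_pair: "e \<in> E \<Longrightarrow> \<exists>u v. ends e = {u, v} \<and> u \<noteq> v"
  using card_ends[of e] by (auto simp: card_2_iff)

lemma ends_pair_at: "e \<in> E \<Longrightarrow> u \<in> ends e \<Longrightarrow> \<exists>v. ends e = {u, v} \<and> u \<noteq> v"
  using ends_pair[of e] by auto

lemma ends_neq: "e \<in> E \<Longrightarrow> ends e = {u, v} \<Longrightarrow> u \<noteq> v"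
  using card_ends[of e] by auto

lemma ends_in_V: "e \<in> E \<Longrightarrow> v \<in> ends e \<Longrightarrow> v \<in> V"
  using ends_subset by blast

lemma finite_inc: "finite (inc v)"
  unfolding inc_def using finite_E by auto

lemma card_inc: "v \<in> V \<Longrightarrow> card (inc v) = 3"
  unfolding inc_def by (rule degree_3)

lemma nb_sym: "nb c a u v \<Longrightarrow> nb c a v u"
  unfolding nb_def by (auto simp: insert_commute)

lemma nb_in_V: "nb c a u v \<Longrightarrow> u \<in> V \<and> v \<in> V"
  unfolding nb_def using ends_subset by fastforce

lemma properD: "proper c \<Longrightarrow> e \<in> E \<Longrightarrow> f \<in> E \<Longrightarrow> v \<in> ends e \<Longrightarrow> v \<in> ends f \<Longrightarrow>
    c e = c f \<Longrightarrow> c e \<noteq> 0 \<Longrightarrow> e = f"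
  unfolding proper_def by (metis disjoint_iff)

lemma proper_le: "proper c \<Longrightarrow> e \<in> E \<Longrightarrow> c e \<le> 3"
  unfolding proper_def by blast

lemma opt_proper: "opt c \<Longrightarrow> proper c"
  unfolding opt_def by blast

lemma optD: "opt c \<Longrightarrow> proper c' \<Longrightarrow> card (unc c) \<le> card (unc c')"
  unfolding opt_def by blast

lemma opt_transfer: "opt c \<Longrightarrow> proper c' \<Longrightarrow> card (unc c') \<le> card (unc c) \<Longrightarrow> opt c'"
  unfolding opt_def using le_trans by blast

lemma finite_unc: "finite (unc c)"
  unfolding unc_def using finite_E by auto

lemma nb_unique:
  assumes "proper c" "a \<noteq> 0" "nb c a u v" "nb c a u w"
  shows "v = w"
proof -
  obtain e f where "e \<in> E" "ends e = {u, v}" "c e = a" "f \<in> E" "ends f = {u, w}" "c f = a"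
    using assms unfolding nb_def by blast
  moreover from this have "e = f"
    using properD[OF assms(1), of e f u] assms(2) by auto
  ultimately show ?thesis by (auto simp: doubleton_eq_iff)
qed

lemma not_miss_nb: "\<not> miss c v a \<Longrightarrow> \<exists>w. nb c a v w"
  unfolding miss_def nb_def inc_def using ends_pair_at by blast

lemma nb_not_miss: "nb c a v w \<Longrightarrow> \<not> miss c v a"
  unfolding miss_def nb_def inc_def by auto

text \<open>There are as many colours as edges at a vertex, and the coloured ones among these edges
  have different colours.\<close>

lemma card_miss:
  assumes "proper c" "v \<in> V"
  shows "card {a\<in>{1..3}. miss c v a} = card (inc v \<inter> unc c)"
proof -
  let ?C = "inc v - unc c"
  have inj: "inj_on c ?C"
  proof (rule inj_onI)
    fix e f assume "e \<in> ?C" "f \<in> ?C" "c e = c f"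
    then show "e = f" using properD[OF assms(1), of e f v] unfolding inc_def unc_def by simp
  qed
  have im: "c ` ?C = {a\<in>{1..3}. \<not> miss c v a}"
  proof (intro subset_antisym subsetI)
    fix a assume "a \<in> c ` ?C"
    then obtain e where e: "e \<in> inc v" "e \<in> E" "c e = a" "c e \<noteq> 0"
      unfolding inc_def unc_def by auto
    then have "\<not> miss c v a" unfolding miss_def by blast
    moreover have "a \<in> {1..3}" using proper_le[OF assms(1) e(2)] e(3,4) by simp
    ultimately show "a \<in> {a\<in>{1..3}. \<not> miss c v a}" by blast
  next
    fix a assume "a \<in> {a\<in>{1..3}. \<not> miss c v a}"
    then obtain e where "e \<in> inc v" "c e = a" "a \<noteq> 0" unfolding miss_def by auto
    then show "a \<in> c ` ?C" unfolding unc_def by (intro image_eqI[of _ _ e]) auto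
  qed
  have "card ?C = 3 - card (inc v \<inter> unc c)"
    using card_inc[OF assms(2)] finite_inc by (simp add: card_Diff_subset_Int)
  moreover have "card ?C = card {a\<in>{1..3}. \<not> miss c v a}"
    using im card_image[OF inj] by simp
  moreover have "card {a\<in>{1..3}. \<not> miss c v a} = 3 - card {a\<in>{1..3::nat}. miss c v a}"
  proof -
    have "{a\<in>{1..3}. \<not> miss c v a} = {1..3} - {a\<in>{1..3::nat}. miss c v a}" by blast
    moreover have "card ({1..3} - {a\<in>{1..3::nat}. miss c v a}) = card {1..3::nat} - card {a\<in>{1..3::nat}. miss c v a}"
      by (rule card_Diff_subset) auto
    ultimately show ?thesis by simp
  qed
  moreover have "card {a\<in>{1..3::nat}. miss c v a} \<le> 3"
  proof -
    have "card {a\<in>{1..3::nat}. miss c v a} \<le> card {1..3::nat}" by (rule card_mono) auto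
    then show ?thesis by simp
  qed
  moreover have "card (inc v \<inter> unc c) \<le> 3"
    using card_mono[OF finite_inc, of "inc v \<inter> unc c" v] card_inc[OF assms(2)] by auto
  ultimately show ?thesis by linarith
qed

lemma double_count:
  assumes "F \<subseteq> E" "finite X" "\<And>e. e \<in> F \<Longrightarrow> ends e \<subseteq> X"
  shows "(\<Sum>v\<in>X. card {e\<in>F. v \<in> ends e}) = 2 * card F"
proof -
  have fF: "finite F" using assms(1) finite_E finite_subset by blast
  have "(\<Sum>v\<in>X. card {e\<in>F. v \<in> ends e}) = (\<Sum>e\<in>F. card {v\<in>X. v \<in> ends e})"
    using sum_multicount_gen[OF assms(2) fF, of "\<lambda>v e. v \<in> ends e" "\<lambda>e. card {v\<in>X. v \<in> ends e}"]
    by auto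
  also have "\<dots> = (\<Sum>e\<in>F. 2)"
  proof (rule sum.cong)
    fix e assume e: "e \<in> F"
    have "{v\<in>X. v \<in> ends e} = ends e" using assms(3)[OF e] by auto
    then show "card {v\<in>X. v \<in> ends e} = 2" using card_ends e assms(1) by auto
  qed simp
  finally show ?thesis by simp
qed

text \<open>Sum the degrees over \<open>S\<close>. What is mostly wanted is the parity: the cut of
  an odd set is odd.\<close>

lemma card_cut:
  assumes "S \<subseteq> V"
  shows "card {e\<in>E. ends e \<inter> S \<noteq> {} \<and> \<not> ends e \<subseteq> S} + 2 * card {e\<in>E. ends e \<subseteq> S} = 3 * card S"
proof -
  let ?I = "{e\<in>E. ends e \<subseteq> S}" and ?C = "{e\<in>E. ends e \<inter> S \<noteq> {} \<and> \<not> ends e \<subseteq> S}"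
  have fS: "finite S" using assms finite_V finite_subset by blast
  have fI: "finite ?I" "finite ?C" using finite_E by auto
  have "3 * card S = (\<Sum>v\<in>S. card {e\<in>E. v \<in> ends e})"
  proof -
    have "(\<Sum>v\<in>S. card {e\<in>E. v \<in> ends e}) = (\<Sum>v\<in>S. 3)"
      by (rule sum.cong[OF refl], rule degree_3) (use assms in blast)
    then show ?thesis by simp
  qed
  also have "\<dots> = (\<Sum>v\<in>S. card {e\<in>?I. v \<in> ends e} + card {e\<in>?C. v \<in> ends e})"
  proof (rule sum.cong[OF refl])
    fix v assume v: "v \<in> S"
    have "{e\<in>E. v \<in> ends e} = {e\<in>?I. v \<in> ends e} \<union> {e\<in>?C. v \<in> ends e}"
      using v by auto
    moreover have "card ({e\<in>?I. v \<in> ends e} \<union> {e\<in>?C. v \<in> ends e}) =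
        card {e\<in>?I. v \<in> ends e} + card {e\<in>?C. v \<in> ends e}"
      by (rule card_Un_disjoint) (use finite_E in auto)
    ultimately show "card {e\<in>E. v \<in> ends e} = card {e\<in>?I. v \<in> ends e} + card {e\<in>?C. v \<in> ends e}"
      by metis
  qed
  also have "\<dots> = 2 * card ?I + (\<Sum>v\<in>S. card {e\<in>?C. v \<in> ends e})"
  proof -
    have "(\<Sum>v\<in>S. card {e\<in>?I. v \<in> ends e}) = 2 * card ?I"
      by (rule double_count) (use fS in auto)
    then show ?thesis by (simp only: sum.distrib)
  qed
  also have "(\<Sum>v\<in>S. card {e\<in>?C. v \<in> ends e}) = (\<Sum>e\<in>?C. card {v\<in>S. v \<in> ends e})"
    using sum_multicount_gen[OF fS fI(2), of "\<lambda>v e. v \<in> ends e" "\<lambda>e. card {v\<in>S. v \<in> ends e}"]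
    by blast
  also have "\<dots> = (\<Sum>e\<in>?C. 1)"
  proof (rule sum.cong[OF refl])
    fix e assume e: "e \<in> ?C"
    then obtain u where u: "u \<in> ends e" "u \<in> S" by auto
    then obtain w where w: "ends e = {u, w}" "u \<noteq> w" using ends_pair_at e by blast
    have "w \<notin> S"
    proof
      assume "w \<in> S"
      then have "ends e \<subseteq> S" using w u by simp
      then show False using e by simp
    qed
    have "{v\<in>S. v \<in> ends e} = {u}"
      unfolding w using u(2) \<open>w \<notin> S\<close> by blast
    then show "card {v\<in>S. v \<in> ends e} = 1" by simp
  qed
  finally show ?thesis by simp
qed

section \<open>Components of edges with given colours\<close>

lemma step_sym: "step c A p q \<Longrightarrow> step c A q p"
  unfolding step_def by (auto simp: insert_commute)

lemma step_rtrancl_sym: "(step c A)\<^sup>*\<^sup>* p q \<Longrightarrow> (step c A)\<^sup>*\<^sup>* q p"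
  by (induction rule: rtranclp_induct) (auto intro: step_sym converse_rtranclp_into_rtranclp)

lemma kcomp_self: "u \<in> kcomp c A u"
  unfolding kcomp_def by simp

lemma kcomp_stable: "stable c A (kcomp c A u)"
  unfolding stable_def
proof (intro ballI impI)
  fix e assume e: "e \<in> E" and h: "c e \<in> A \<and> ends e \<inter> kcomp c A u \<noteq> {}"
  then obtain p where p: "p \<in> ends e" "p \<in> kcomp c A u" by blast
  obtain q where q: "ends e = {p, q}" using ends_pair_at e p by blast
  have "step c A p q" unfolding step_def using e h q by blast
  then have "q \<in> kcomp c A u" using p unfolding kcomp_def by auto
  then show "ends e \<subseteq> kcomp c A u" using p q by simp
qed

lemma stableD: "stable c A X \<Longrightarrow> e \<in> E \<Longrightarrow> c e \<in> A \<Longrightarrow> p \<in> ends e \<Longrightarrow> p \<in> X \<Longrightarrow> ends e \<subseteq> X"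
  unfolding stable_def by blast

lemma stable_step:
  assumes "stable c A X" "p \<in> X" "step c A p q"
  shows "q \<in> X"
proof -
  obtain e where "e \<in> E" "ends e = {p, q}" "c e \<in> A" using assms(3) unfolding step_def by blast
  then show ?thesis using stableD[OF assms(1), of e p] assms(2) by simp
qed

lemma kcomp_subset: "stable c A X \<Longrightarrow> u \<in> X \<Longrightarrow> kcomp c A u \<subseteq> X"
proof
  fix v assume cl: "stable c A X" "u \<in> X" and "v \<in> kcomp c A u"
  then have "(step c A)\<^sup>*\<^sup>* u v" unfolding kcomp_def by simp
  then show "v \<in> X" using cl by (induction rule: rtranclp_induct) (auto intro: stable_step)
qed

lemma stable_V: "stable c A V"
  unfolding stable_def using ends_subset by blast

lemma kcomp_in_V: "u \<in> V \<Longrightarrow> kcomp c A u \<subseteq> V"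
  by (rule kcomp_subset[OF stable_V])

lemma kcomp_finite: "u \<in> V \<Longrightarrow> finite (kcomp c A u)"
  by (rule finite_subset[OF kcomp_in_V finite_V])

lemma kcomp_sym: "v \<in> kcomp c A u \<Longrightarrow> u \<in> kcomp c A v"
  unfolding kcomp_def using step_rtrancl_sym by simp

lemma kcomp_trans: "v \<in> kcomp c A u \<Longrightarrow> w \<in> kcomp c A v \<Longrightarrow> w \<in> kcomp c A u"
  unfolding kcomp_def using rtranclp_trans by simp

lemma kcomp_eq: "v \<in> kcomp c A u \<Longrightarrow> kcomp c A v = kcomp c A u"
  using kcomp_trans kcomp_sym by (intro subset_antisym subsetI) fast+

text \<open>A smaller set containing \<open>u\<close> is not stable, so some edge leads out of it
  and adds one vertex and one edge. Growing from \<open>{u}\<close> in this way gives the usual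
  bound for connected graphs.\<close>

lemma kcomp_edges:
  assumes u: "u \<in> V"
  shows "card (kcomp c A u) \<le> Suc (card {e\<in>E. c e \<in> A \<and> ends e \<subseteq> kcomp c A u})"
proof -
  let ?X = "kcomp c A u"
  let ?EE = "\<lambda>Y. {e\<in>E. c e \<in> A \<and> ends e \<subseteq> Y}"
  have fX: "finite ?X" using kcomp_finite[OF u] .
  have "\<exists>Y. Y \<subseteq> ?X \<and> u \<in> Y \<and> card Y = Suc n \<and> card Y \<le> Suc (card (?EE Y))"
    if "n < card ?X" for n
    using that
  proof (induction n)
    case 0
    have "{u} \<subseteq> ?X" using kcomp_self by blast
    then show ?case by (intro exI[of _ "{u}"] conjI) simp_all
  next
    case (Suc n)
    obtain Y where Y: "Y \<subseteq> ?X" "u \<in> Y" "card Y = Suc n" "card Y \<le> Suc (card (?EE Y))"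
      using Suc.IH[OF Suc_lessD[OF Suc.prems]] by blast
    have "\<not> stable c A Y"
    proof
      assume "stable c A Y"
      then have "?X \<subseteq> Y" using kcomp_subset Y by blast
      then have "?X = Y" using Y by blast
      then show False using Y(3) Suc.prems by simp
    qed
    then obtain e where e: "e \<in> E" "c e \<in> A" "ends e \<inter> Y \<noteq> {}" "\<not> ends e \<subseteq> Y"
      unfolding stable_def by blast
    then obtain p where p: "p \<in> ends e" "p \<in> Y" by blast
    obtain q where q: "ends e = {p, q}" using ends_pair_at e p by blast
    then have qY: "q \<notin> Y" using e p by auto
    have "step c A p q" unfolding step_def using e q by blast
    then have qX: "q \<in> ?X" using stable_step[OF kcomp_stable] p Y by blast
    have fY: "finite Y" using Y fX finite_subset by blast
    have "ends e \<subseteq> insert q Y" unfolding q using p by blast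
    then have "insert e (?EE Y) \<subseteq> ?EE (insert q Y)" using e(1,2) by blast
    then have "card (insert e (?EE Y)) \<le> card (?EE (insert q Y))"
      by (rule card_mono[rotated]) (simp add: finite_E)
    moreover have "card (insert e (?EE Y)) = Suc (card (?EE Y))"
      by (rule card_insert_disjoint) (use finite_E e(4) in simp_all)
    moreover have "card (insert q Y) = Suc (card Y)"
      using fY qY by simp
    moreover have "insert q Y \<subseteq> ?X" using qX Y(1) by blast
    ultimately show ?case
      using Y(2,3,4) by (intro exI[of _ "insert q Y"] conjI) simp_all
  qed
  note ex = this
  have "card ?X > 0" using kcomp_self fX by (auto simp: card_gt_0_iff)
  then obtain n where n: "card ?X = Suc n" using gr0_implies_Suc by blast
  then have "\<exists>Y. Y \<subseteq> ?X \<and> u \<in> Y \<and> card Y = Suc n \<and> card Y \<le> Suc (card (?EE Y))"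
    by (intro ex) simp
  then obtain Y where Y: "Y \<subseteq> ?X" "card Y = card ?X" "card Y \<le> Suc (card (?EE Y))"
    using n by auto
  then have "Y = ?X" using fX card_subset_eq by blast
  then show ?thesis using Y by simp
qed

lemma proper_color_unique:
  assumes "proper c" "a \<noteq> 0"
  shows "card {e\<in>E. c e = a \<and> v \<in> ends e} \<le> 1"
proof -
  have "x = y" if "x \<in> {e\<in>E. c e = a \<and> v \<in> ends e}" "y \<in> {e\<in>E. c e = a \<and> v \<in> ends e}" for x y
    using that properD[OF assms(1), of x y v] assms(2) by simp
  then show ?thesis using finite_E by (simp add: card_le_Suc0_iff_eq)
qed

text \<open>A path has only two ends.\<close>

lemma kcomp_three_ends:
  assumes pr: "proper c" and a: "a \<noteq> 0" and b: "b \<noteq> 0" and ab: "a \<noteq> b"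
    and u: "u \<in> V" and P: "P \<subseteq> kcomp c {a, b} u" "\<And>p. p \<in> P \<Longrightarrow> miss c p a \<or> miss c p b"
  shows "card P \<le> 2"
proof -
  let ?X = "kcomp c {a, b} u"
  let ?F = "{e\<in>E. c e \<in> {a, b} \<and> ends e \<subseteq> ?X}"
  have fX: "finite ?X" using kcomp_finite[OF u] .
  have sub: "{e\<in>?F. v \<in> ends e} \<subseteq> {e\<in>E. c e = a \<and> v \<in> ends e} \<union> {e\<in>E. c e = b \<and> v \<in> ends e}" for v
    by auto
  have le: "card {e\<in>?F. v \<in> ends e} \<le> card {e\<in>E. c e = a \<and> v \<in> ends e} + card {e\<in>E. c e = b \<and> v \<in> ends e}" for v
    by (rule order_trans[OF card_mono[OF _ sub] card_Un_le]) (use finite_E in auto)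
  have le2: "card {e\<in>?F. v \<in> ends e} \<le> 2" for v
    using le[of v] proper_color_unique[OF pr a, of v] proper_color_unique[OF pr b, of v] by linarith
  have le1: "card {e\<in>?F. v \<in> ends e} \<le> 1" if "v \<in> P" for v
  proof -
    have "card {e\<in>E. c e = a \<and> v \<in> ends e} = 0 \<or> card {e\<in>E. c e = b \<and> v \<in> ends e} = 0"
      using P(2)[OF that]
    proof
      assume "miss c v a"
      then have "{e\<in>E. c e = a \<and> v \<in> ends e} = {}" unfolding miss_def inc_def by blast
      then show ?thesis by (simp only: card.empty simp_thms)
    next
      assume "miss c v b"
      then have "{e\<in>E. c e = b \<and> v \<in> ends e} = {}" unfolding miss_def inc_def by blast
      then show ?thesis by (simp only: card.empty simp_thms)
    qed
    then show ?thesis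
      using le[of v] proper_color_unique[OF pr a, of v] proper_color_unique[OF pr b, of v] by linarith
  qed
  \<comment> \<open>Vertices in \<open>P\<close> have degree at most 1 and the others at most 2, so
    \<open>2 * card ?F \<le> 2 * card ?X - card P\<close>, while connectedness gives
    \<open>card ?X \<le> card ?F + 1\<close>.\<close>
  have "2 * card ?F = (\<Sum>v\<in>?X. card {e\<in>?F. v \<in> ends e})"
    by (rule double_count[symmetric]) (use fX in auto)
  also have "\<dots> \<le> (\<Sum>v\<in>?X. if v \<in> P then 1 else 2)"
    by (rule sum_mono) (use le1 le2 in auto)
  also have "\<dots> = card P + 2 * card (?X - P)"
  proof -
    have "?X = P \<union> (?X - P)" using P(1) by blast
    then have "(\<Sum>v\<in>?X. if v \<in> P then 1 else 2::nat) =
        (\<Sum>v\<in>P. if v \<in> P then 1 else 2) + (\<Sum>v\<in>?X - P. if v \<in> P then 1 else 2)"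
      using sum.union_disjoint[of P "?X - P" "\<lambda>v. if v \<in> P then 1 else 2::nat"] fX
        finite_subset[OF P(1) fX] by auto
    then show ?thesis by simp
  qed
  finally have "2 * card ?F \<le> card P + 2 * card (?X - P)" .
  moreover have "card (?X - P) = card ?X - card P" "card P \<le> card ?X"
    using P(1) fX by (auto simp: card_Diff_subset finite_subset card_mono)
  moreover have "card ?X \<le> Suc (card ?F)" using kcomp_edges[OF u] .
  ultimately show ?thesis by linarith
qed

lemma kcomp_three_endsE:
  assumes "proper c" "a \<noteq> 0" "b \<noteq> 0" "a \<noteq> b" "p \<in> kcomp c {a, b} u" "q \<in> kcomp c {a, b} u"
    "r \<in> kcomp c {a, b} u" "u \<in> V" "miss c p a \<or> miss c p b" "miss c q a \<or> miss c q b"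
    "miss c r a \<or> miss c r b" "p \<noteq> q" "q \<noteq> r" "p \<noteq> r"
  shows False
  using kcomp_three_ends[OF assms(1-4,8), of "{p, q, r}"] assms by auto

section \<open>Kempe swaps\<close>

definition swap :: "('e \<Rightarrow> nat) \<Rightarrow> nat \<Rightarrow> nat \<Rightarrow> 'v set \<Rightarrow> 'e \<Rightarrow> nat" where
  "swap c a b X e = (if ends e \<inter> X \<noteq> {} then transpose a b (c e) else c e)"

lemma swap_eq_0: "a \<noteq> 0 \<Longrightarrow> b \<noteq> 0 \<Longrightarrow> swap c a b X e = 0 \<longleftrightarrow> c e = 0"
  unfolding swap_def transpose_def by auto

lemma unc_swap: "a \<noteq> 0 \<Longrightarrow> b \<noteq> 0 \<Longrightarrow> unc (swap c a b X) = unc c"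
  unfolding unc_def by (simp add: swap_eq_0)

lemma swap_proper:
  assumes "proper c" "a \<in> {1..3}" "b \<in> {1..3}" "stable c {a, b} X"
  shows "proper (swap c a b X)"
  unfolding proper_def
proof (intro conjI ballI impI)
  fix e assume "e \<in> E"
  then show "swap c a b X e \<le> 3"
    using proper_le[OF assms(1), of e] assms(2,3) unfolding swap_def transpose_def by auto
next
  fix e f assume e: "e \<in> E" and f: "f \<in> E"
    and h: "e \<noteq> f \<and> ends e \<inter> ends f \<noteq> {} \<and> swap c a b X e = swap c a b X f"
  then obtain v where v: "v \<in> ends e" "v \<in> ends f" by blast
  have "c e = 0" if "c e = c f"
    using properD[OF assms(1) e f v that] h by blast
  moreover have "c e = c f"
  proof (cases "ends e \<inter> X \<noteq> {} \<longleftrightarrow> ends f \<inter> X \<noteq> {}")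
    case True
    then show ?thesis using h unfolding swap_def by (auto dest: injD[OF inj_transpose] split: if_splits)
  next
    case False
    have *: "c g \<notin> {a, b}" if "g \<in> E" "v \<in> ends g" "ends g \<inter> X \<noteq> {}" "v \<notin> X" for g
      using assms(4) that unfolding stable_def by blast
    have "v \<notin> X" using False v by blast
    then show ?thesis
      using False h *[OF e v(1)] *[OF f v(2)] unfolding swap_def transpose_def by (auto split: if_splits)
  qed
  ultimately show "swap c a b X e = 0" using assms(2,3) by (simp add: swap_eq_0)
qed

lemma swap_opt:
  assumes "opt c" "a \<in> {1..3}" "b \<in> {1..3}" "stable c {a, b} X"
  shows "opt (swap c a b X)"
proof (rule opt_transfer[OF assms(1)])
  show "proper (swap c a b X)" using swap_proper[OF opt_proper] assms by blast
  show "card (unc (swap c a b X)) \<le> card (unc c)" using unc_swap assms by auto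
qed

lemma swap_in: "e \<in> E \<Longrightarrow> v \<in> ends e \<Longrightarrow> v \<in> X \<Longrightarrow> swap c a b X e = transpose a b (c e)"
  unfolding swap_def by auto

lemma swap_out:
  "e \<in> E \<Longrightarrow> v \<in> ends e \<Longrightarrow> v \<notin> X \<Longrightarrow> stable c {a, b} X \<Longrightarrow> swap c a b X e = c e"
  unfolding swap_def stable_def transpose_def by auto

lemma miss_swap_in: "v \<in> X \<Longrightarrow> miss (swap c a b X) v k \<longleftrightarrow> miss c v (transpose a b k)"
  unfolding miss_def inc_def using swap_in[of _ v X c a b]
  by (simp add: transpose_def) (metis (full_types))

lemma miss_swap_out: "v \<notin> X \<Longrightarrow> stable c {a, b} X \<Longrightarrow> miss (swap c a b X) v k \<longleftrightarrow> miss c v k"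
  unfolding miss_def inc_def using swap_out[of _ v X c a b] by auto

lemma inc_iff: "e \<in> inc v \<longleftrightarrow> e \<in> E \<and> v \<in> ends e"
  unfolding inc_def by blast

lemma missD: "miss c v a \<Longrightarrow> e \<in> E \<Longrightarrow> v \<in> ends e \<Longrightarrow> c e \<noteq> a"
  unfolding miss_def inc_def by blast

lemma missI: "(\<And>e. e \<in> E \<Longrightarrow> v \<in> ends e \<Longrightarrow> c e \<noteq> a) \<Longrightarrow> miss c v a"
  unfolding miss_def inc_def by blast

lemma not_missE:
  assumes "\<not> miss c v a" obtains e where "e \<in> E" "v \<in> ends e" "c e = a"
  using assms unfolding miss_def inc_def by blast

section \<open>What optimality forbids\<close>

lemma color_edge:
  assumes pr: "proper c" and e: "e \<in> E" "c e = 0" "ends e = {u, v}"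
    and m: "miss c u a" "miss c v a" and a: "a \<in> {1..3}"
  shows "proper (c(e := a))" "card (unc (c(e := a))) < card (unc c)"
proof -
  show "proper (c(e := a))"
    unfolding proper_def
  proof (intro conjI ballI impI)
    fix f assume "f \<in> E" then show "(c(e := a)) f \<le> 3"
      using proper_le[OF pr] a by simp
  next
    fix f g assume f: "f \<in> E" and g: "g \<in> E"
      and h: "f \<noteq> g \<and> ends f \<inter> ends g \<noteq> {} \<and> (c(e := a)) f = (c(e := a)) g"
    then obtain w where w: "w \<in> ends f" "w \<in> ends g" by blast
    have *: "c x \<noteq> a" if "x \<in> E" "w \<in> ends x" "w \<in> ends e" for x
      using missD[OF m(1) that(1)] missD[OF m(2) that(1)] that(2,3) unfolding e(3) by blast
    show "(c(e := a)) f = 0"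
    proof (cases "f = e \<or> g = e")
      case True
      then show ?thesis using h *[OF f w(1)] *[OF g w(2)] w by auto
    next
      case False
      then show ?thesis using properD[OF pr f g w] h by auto
    qed
  qed
  have "unc (c(e := a)) \<subseteq> unc c - {e}" using a unfolding unc_def by auto
  moreover have "e \<in> unc c" using e unfolding unc_def by blast
  ultimately show "card (unc (c(e := a))) < card (unc c)"
    using finite_unc by (metis card_Diff1_less card_mono finite_Diff le_less_trans)
qed

lemma opt_no_common_miss:
  assumes "opt c" "e \<in> E" "c e = 0" "ends e = {u, v}" "a \<in> {1..3}"
  shows "\<not> (miss c u a \<and> miss c v a)"
  using color_edge[OF opt_proper[OF assms(1)] assms(2-4) _ _ assms(5)] optD[OF assms(1)]
  by (meson not_less)

text \<open>If the chain of \<open>u\<close> avoided \<open>v\<close>, swapping it would make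
  \<open>b\<close> missing at both ends of \<open>e\<close>, which could then be coloured. So the
  chain and \<open>e\<close> close up to a cycle.\<close>

lemma opt_link:
  assumes o: "opt c" and e: "e \<in> E" "c e = 0" "ends e = {u, v}"
    and m: "miss c u a" "miss c v b" and a: "a \<in> {1..3}" and b: "b \<in> {1..3}"
  shows "a \<noteq> b" "v \<in> kcomp c {a, b} u"
proof -
  show "a \<noteq> b" using opt_no_common_miss[OF o e] m a by blast
  show "v \<in> kcomp c {a, b} u"
  proof (rule ccontr)
    assume nv: "v \<notin> kcomp c {a, b} u"
    let ?X = "kcomp c {a, b} u" and ?c = "swap c a b (kcomp c {a, b} u)"
    have st: "stable c {a, b} ?X" by (rule kcomp_stable)
    have o': "opt ?c" by (rule swap_opt[OF o a b st])
    have "miss ?c u b" using miss_swap_in[OF kcomp_self, of c a b] m(1) by simp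
    moreover have "miss ?c v b" using miss_swap_out[OF nv st] m(2) by simp
    moreover have "?c e = 0" using e(2) a b by (simp add: swap_eq_0)
    ultimately show False using opt_no_common_miss[OF o' e(1) _ e(3) b] by blast
  qed
qed

lemma ex_miss:
  assumes "proper c" "e \<in> E" "c e = 0" "v \<in> ends e"
  shows "\<exists>a\<in>{1..3}. miss c v a"
proof -
  have "e \<in> inc v \<inter> unc c" using assms unfolding inc_def unc_def by simp
  then have "card (inc v \<inter> unc c) \<noteq> 0" using finite_inc by auto
  then have "card {a\<in>{1..3}. miss c v a} \<noteq> 0"
    using card_miss[OF assms(1) ends_in_V[OF assms(2,4)]] by metis
  then have "{a\<in>{1..3}. miss c v a} \<noteq> {}" by (metis card.empty)
  then show ?thesis by blast
qed

lemma miss_unc: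
  assumes "proper c" "v \<in> V" "miss c v a" "a \<in> {1..3}"
  obtains e where "e \<in> E" "c e = 0" "v \<in> ends e"
proof -
  have "finite {a\<in>{1..3}. miss c v a}" by simp
  moreover have "a \<in> {a\<in>{1..3}. miss c v a}" using assms by blast
  ultimately have "card {a\<in>{1..3}. miss c v a} \<noteq> 0" by (metis card_eq_0_iff empty_iff)
  then have "card (inc v \<inter> unc c) \<noteq> 0" using card_miss[OF assms(1,2)] by metis
  then have "inc v \<inter> unc c \<noteq> {}" by (metis card.empty)
  then show ?thesis using that unfolding inc_def unc_def by blast
qed

lemma two_unc_two_miss:
  assumes pr: "proper c" and e: "e \<in> E" "c e = 0" "v \<in> ends e"
    and f: "f \<in> E" "c f = 0" "v \<in> ends f" and ef: "e \<noteq> f"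
  obtains a b where "a \<in> {1..3}" "b \<in> {1..3}" "a \<noteq> b" "miss c v a" "miss c v b"
proof -
  have "{e, f} \<subseteq> inc v \<inter> unc c" using e f unfolding inc_def unc_def by blast
  then have "card {e, f} \<le> card (inc v \<inter> unc c)"
    using finite_inc by (intro card_mono) auto
  then have "2 \<le> card {a\<in>{1..3}. miss c v a}"
    using card_miss[OF pr] ends_in_V[OF e(1,3)] ef by simp
  then obtain a b where "a \<in> {a\<in>{1..3}. miss c v a}" "b \<in> {a\<in>{1..3}. miss c v a}" "a \<noteq> b"
    using card_le_Suc0_iff_eq[of "{a\<in>{1..3::nat}. miss c v a}"]
    by (metis (no_types, lifting) Suc_n_not_le_n card.infinite le_trans not_numeral_le_zero numeral_2_eq_2)
  then show ?thesis using that by blast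
qed

text \<open>Two uncoloured edges at \<open>v\<close>, leading to \<open>x\<close> and
  \<open>y\<close>, would leave two colours \<open>a\<close> and \<open>b\<close> missing at
  \<open>v\<close>. Then \<open>x\<close> and \<open>y\<close> both miss the third colour
  \<open>k\<close>, and the chain of colours \<open>a\<close> and \<open>k\<close> through
  \<open>v\<close> has the three ends \<open>v\<close>, \<open>x\<close> and \<open>y\<close>. So
  the uncoloured edges form a matching.\<close>

lemma opt_unc_unique:
  assumes o: "opt c" and e: "e \<in> E" "c e = 0" "v \<in> ends e" and f: "f \<in> E" "c f = 0" "v \<in> ends f"
  shows "e = f"
proof (rule ccontr)
  assume ef: "e \<noteq> f"
  note pr = opt_proper[OF o]
  obtain a b where ab: "a \<in> {1..3}" "b \<in> {1..3}" "a \<noteq> b" "miss c v a" "miss c v b"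
    using two_unc_two_miss[OF pr e f ef] by blast
  obtain x where x: "ends e = {v, x}" "v \<noteq> x" using ends_pair_at e by blast
  obtain y where y: "ends f = {v, y}" "v \<noteq> y" using ends_pair_at f by blast
  have third: "m = k" if "m \<in> {1..3}" "k \<in> {1..3}" "m \<notin> {a, b}" "k \<notin> {a, b}" for m k :: nat
    using that ab(1-3) by auto
  obtain k where k: "k \<in> {1..3}" "miss c x k" using ex_miss[OF pr e(1,2), of x] x by blast
  have nab: "m \<notin> {a, b}" if "m \<in> {1..3}" "miss c x m" for m
    using opt_no_common_miss[OF o e(1,2) x(1) that(1)] that ab by blast
  have nab': "m \<notin> {a, b}" if "m \<in> {1..3}" "miss c y m" for m
    using opt_no_common_miss[OF o f(1,2) y(1) that(1)] that ab by blast
  obtain k' where k': "k' \<in> {1..3}" "miss c y k'" using ex_miss[OF pr f(1,2), of y] y by blast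
  have kk: "k' = k" using third nab nab' k k' by blast
  have xy: "x \<noteq> y"
  proof
    assume "x = y"
    then have "x \<in> ends e" "x \<in> ends f" using x y by auto
    then obtain p q where "p \<in> {1..3}" "q \<in> {1..3}" "p \<noteq> q" "miss c x p" "miss c x q"
      using two_unc_two_miss[OF pr e(1,2) _ f(1,2) _ ef] by blast
    then show False using third nab by blast
  qed
  have "x \<in> kcomp c {a, k} v" by (rule opt_link(2)[OF o e(1,2) x(1) ab(4) k(2) ab(1) k(1)])
  moreover have "y \<in> kcomp c {a, k} v" 
    by (rule opt_link(2)[OF o f(1,2) y(1) ab(4) k'(2)[unfolded kk] ab(1) k(1)])
  moreover have "a \<noteq> k" using nab[OF k] by blast
  ultimately show False
    using kcomp_three_endsE[OF pr, of a k v v x y] kcomp_self ab(1) k k'(2) kk ab(4)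
      ends_in_V[OF e(1,3)] x(2) y(2) xy by auto
qed

lemma opt_miss_unique:
  assumes o: "opt c" and v: "v \<in> V" and a: "a \<in> {1..3}" "miss c v a" and b: "b \<in> {1..3}" "miss c v b"
  shows "a = b"
proof (rule ccontr)
  assume ab: "a \<noteq> b"
  have "card {a, b} \<le> card {a\<in>{1..3}. miss c v a}"
    by (rule card_mono) (use a b in auto)
  then have "2 \<le> card (inc v \<inter> unc c)" using card_miss[OF opt_proper[OF o] v] ab by simp
  moreover have "card (inc v \<inter> unc c) \<le> 1"
  proof -
    have "x = y" if "x \<in> inc v \<inter> unc c" "y \<in> inc v \<inter> unc c" for x y
      using that opt_unc_unique[OF o, of x v y] unfolding inc_def unc_def by simp
    then show ?thesis using finite_inc by (simp add: card_le_Suc0_iff_eq)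
  qed
  ultimately show False by linarith
qed

text \<open>The hole, that is the uncoloured edge, moves one step along its cycle: \<open>e\<close>
  takes the colour of its neighbour \<open>g\<close>, and \<open>g\<close> loses it. The ends of the
  new hole again miss \<open>a\<close> and \<open>b\<close>, so the step can be repeated.\<close>

lemma rotate_step:
  assumes o: "opt c" and e: "e \<in> E" "c e = 0" "ends e = {u, v}"
    and m: "miss c u a" "miss c v b" and a: "a \<in> {1..3}" and b: "b \<in> {1..3}"
    and g: "g \<in> E" "ends g = {u, w}" "c g = b"
  shows "opt (c(e := b, g := 0))" "miss (c(e := b, g := 0)) u a" "miss (c(e := b, g := 0)) w b"
proof -
  let ?c = "c(e := b, g := 0)"
  note pr = opt_proper[OF o]
  have b0: "b \<noteq> 0" using b by simp
  have ab: "a \<noteq> b" using opt_link(1)[OF o e m a b] .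
  have ge: "g \<noteq> e" using g e b0 by auto
  have wv: "w \<noteq> v" using missD[OF m(2) g(1)] g by auto
  have wu: "w \<noteq> u" using ends_neq[OF g(1,2)] by simp
  have uv: "u \<noteq> v" using ends_neq[OF e(1,3)] by simp
  have gu: "f = g" if "f \<in> E" "u \<in> ends f" "c f = b" for f
    using properD[OF pr that(1) g(1) that(2)] g that b0 by simp
  have gw: "f = g" if "f \<in> E" "w \<in> ends f" "c f = b" for f
    using properD[OF pr that(1) g(1) that(2)] g that b0 by simp
  have p: "proper ?c"
    unfolding proper_def
  proof (intro conjI ballI impI)
    fix f assume "f \<in> E" then show "?c f \<le> 3"
      using proper_le[OF pr] b by simp
  next
    fix f h assume f: "f \<in> E" and h: "h \<in> E"
      and H: "f \<noteq> h \<and> ends f \<inter> ends h \<noteq> {} \<and> ?c f = ?c h"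
    then obtain z where z: "z \<in> ends f" "z \<in> ends h" by blast
    have *: "c x \<noteq> b" if "x \<in> E" "z \<in> ends x" "z \<in> ends e" "x \<noteq> g" for x
      using missD[OF m(2) that(1)] gu[OF that(1)] that(2-4) unfolding e(3) by blast
    show "?c f = 0"
    proof (cases "f = g \<or> h = g")
      case True
      then show ?thesis using H by auto
    next
      case False
      then show ?thesis using H *[OF f z(1)] *[OF h z(2)] z properD[OF pr f h z] b0
        by (auto split: if_splits)
    qed
  qed
  have "unc ?c = insert g (unc c - {e})"
    using e g b0 ge unfolding unc_def by auto
  moreover have "g \<notin> unc c - {e}" using g b0 unfolding unc_def by simp
  moreover have "e \<in> unc c" using e unfolding unc_def by blast
  ultimately have "card (unc ?c) = card (unc c)"
    using finite_unc[of c] by (metis card_Suc_Diff1 card_insert_disjoint finite_Diff)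
  then show "opt ?c" using opt_transfer[OF o p] by simp
  show "miss ?c u a"
    by (rule missI) (use missD[OF m(1)] ab a in auto)
  show "miss ?c w b"
  proof (rule missI)
    fix f assume f: "f \<in> E" "w \<in> ends f"
    then have "f \<noteq> e" using e wv wu by auto
    then show "?c f \<noteq> b" using gw[OF f] b0 by auto
  qed
qed

section \<open>The odd cycles of an optimal colouring\<close>

lemma ends_nonempty: "e \<in> E \<Longrightarrow> \<exists>v. v \<in> ends e"
  using ends_pair[of e] by auto

lemma no_miss_no_unc:
  assumes "proper c" "v \<in> V" "\<And>a. a \<in> {1..3} \<Longrightarrow> \<not> miss c v a" "e \<in> E" "v \<in> ends e"
  shows "c e \<noteq> 0"
proof
  assume "c e = 0"
  then obtain a where "a \<in> {1..3}" "miss c v a" using ex_miss[OF assms(1,4) _ assms(5)] by blast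
  then show False using assms(3) by blast
qed

text \<open>The invariant of repeated rotation. \<open>D\<close> will be the edge set of the cycle
  and \<open>c0\<close> the original colouring; the hole has arrived at \<open>g\<close>, and
  nothing outside \<open>D\<close> has changed.\<close>

definition rstate :: "('e \<Rightarrow> nat) \<Rightarrow> 'e set \<Rightarrow> nat \<Rightarrow> nat \<Rightarrow> ('e \<Rightarrow> nat) \<Rightarrow> 'e \<Rightarrow> bool" where
  "rstate c0 D a b c g \<longleftrightarrow> opt c \<and> g \<in> D \<and> c g = 0 \<and> (\<forall>h\<in>E - D. c h = c0 h) \<and>
     (\<forall>h\<in>D - {g}. c h \<in> {a, b}) \<and> (\<exists>u v. ends g = {u, v} \<and> miss c u a \<and> miss c v b)"

text \<open>At the common vertex \<open>p\<close> one of \<open>a\<close> and \<open>b\<close> is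
  missing, so \<open>g'\<close> has the other one, which is missing at the other end of
  \<open>g\<close>. This is the situation of \<open>rotate_step\<close>.\<close>

lemma rstate_step:
  assumes r: "rstate c0 D a b c g" and D: "D \<subseteq> E" and a: "a \<in> {1..3}" and b: "b \<in> {1..3}"
    and p: "p \<in> ends g" "p \<in> ends g'" and g': "g' \<in> D" "g' \<noteq> g"
  shows "\<exists>c'. rstate c0 D a b c' g'"
proof -
  obtain u v where uv: "ends g = {u, v}" "miss c u a" "miss c v b"
    and r': "opt c" "g \<in> D" "c g = 0" "\<forall>h\<in>E - D. c h = c0 h" "\<forall>h\<in>D - {g}. c h \<in> {a, b}"
    using r unfolding rstate_def by blast
  have gE: "g \<in> E" "g' \<in> E" using r' g' D by auto
  obtain w where w: "ends g' = {p, w}" using ends_pair_at[OF gE(2) p(2)] by blast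
  have cg': "c g' \<in> {a, b}" using r' g' by blast
  consider "p = u" | "p = v" using p uv by blast
  then show ?thesis
  proof cases
    case 1
    have cb: "c g' = b" using missD[OF uv(2) gE(2)] w 1 cg' by auto
    note R = rotate_step[OF r'(1) gE(1) r'(3) uv(1-3) a b gE(2) _ cb, of w]
    have w': "ends g' = {u, w}" using w 1 by simp
    have "rstate c0 D a b (c(g := b, g' := 0)) g'"
      unfolding rstate_def using R[OF w'] w' r' g' by auto
    then show ?thesis by blast
  next
    case 2
    have cb: "c g' = a" using missD[OF uv(3) gE(2)] w 2 cg' by auto
    have uv': "ends g = {v, u}" using uv by blast
    note R = rotate_step[OF r'(1) gE(1) r'(3) uv' uv(3,2) b a gE(2) _ cb, of w]
    have w': "ends g' = {v, w}" "ends g' = {w, v}" using w 2 by auto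
    have "rstate c0 D a b (c(g := a, g' := 0)) g'"
      unfolding rstate_def
      by (intro conjI exI[of _ w] exI[of _ v]) (use R[OF w'(1)] w'(2) r' g' in auto)
    then show ?thesis by blast
  qed
qed

lemma kcomp_mono:
  assumes "A \<subseteq> B" shows "kcomp c A u \<subseteq> kcomp c B u"
proof (rule kcomp_subset[OF _ kcomp_self])
  show "stable c A (kcomp c B u)"
    using kcomp_stable[of c B u] assms unfolding stable_def by blast
qed

text \<open>Rotation carries the hole to every edge of the cycle, so each vertex \<open>p\<close> of
  \<open>X\<close> misses \<open>a\<close> or \<open>b\<close> in some optimal colouring that
  differs from \<open>c\<close> only on the cycle. A vertex misses at most one colour, so
  \<open>p\<close> has an edge of colour \<open>k\<close> there, and this edge has colour
  \<open>k\<close> in \<open>c\<close> too. Hence only edges of colour \<open>k\<close> can leave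
  \<open>X\<close>.\<close>

lemma cycle_facts:
  assumes o: "opt c" and e: "e \<in> E" "c e = 0" "ends e = {u, v}"
    and m: "miss c u a" "miss c v b" and a: "a \<in> {1..3}" and b: "b \<in> {1..3}"
    and k: "k \<in> {1..3}" "k \<noteq> a" "k \<noteq> b" and X: "X = kcomp c {a, b} u"
  shows "v \<in> X"
    and "\<And>p. p \<in> X \<Longrightarrow> \<not> miss c p k"
    and "\<And>h. h \<in> E \<Longrightarrow> c h \<noteq> k \<Longrightarrow> ends h \<inter> X \<noteq> {} \<Longrightarrow> ends h \<subseteq> X \<and> (h = e \<or> c h \<in> {a, b})"
    and "\<And>g. g \<in> E \<Longrightarrow> c g \<noteq> k \<Longrightarrow> ends g \<inter> X \<noteq> {} \<Longrightarrow>
      \<exists>c'. rstate c {h\<in>E. c h \<noteq> k \<and> ends h \<inter> X \<noteq> {}} a b c' g"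
    and "X = kcomp c (-{k}) u"
    and "odd (card X)"
    and "a \<noteq> b"
proof -
  note pr = opt_proper[OF o]
  show ab: "a \<noteq> b" by (rule opt_link(1)[OF o e m a b])
  show vX: "v \<in> X" unfolding X by (rule opt_link(2)[OF o e m a b])
  have uX: "u \<in> X" unfolding X by (rule kcomp_self)
  have uV: "u \<in> V" "v \<in> V" using ends_in_V[OF e(1)] e(3) by auto
  have uv: "u \<noteq> v" using ends_neq[OF e(1,3)] .
  have XV: "X \<subseteq> V" unfolding X by (rule kcomp_in_V[OF uV(1)])
  have a0: "a \<noteq> 0" "b \<noteq> 0" using a b by auto
  have col: "x \<in> {1..3} \<longleftrightarrow> x = a \<or> x = b \<or> x = k" for x :: nat
    using a b k ab by auto
  have stX: "stable c {a, b} X" unfolding X by (rule kcomp_stable)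
  have inner: "\<not> miss c p a \<and> \<not> miss c p b" if "p \<in> X" "p \<noteq> u" "p \<noteq> v" for p
    using kcomp_three_endsE[OF pr a0 ab, of u u v p] that uX vX uV m uv unfolding X by blast
  define D where "D = insert e {h\<in>E. c h \<in> {a, b} \<and> ends h \<inter> X \<noteq> {}}"
  have DE: "D \<subseteq> E" unfolding D_def using e by blast
  have DX: "ends h \<subseteq> X" if "h \<in> D" for h
  proof (cases "h = e")
    case True
    then show ?thesis using e(3) uX vX by simp
  next
    case False
    then show ?thesis using that stX unfolding D_def stable_def by blast
  qed
  have e0: "rstate c D a b c e"
    unfolding rstate_def D_def using o e m by blast
  \<comment> \<open>The vertices all of whose cycle edges can become the hole. They include
    \<open>u\<close> and form a stable set, so they are all of \<open>X\<close>.\<close>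
  define T where "T = {p\<in>X. \<forall>h\<in>D. p \<in> ends h \<longrightarrow> (\<exists>c'. rstate c D a b c' h)}"
  have uT: "u \<in> T"
    unfolding T_def using uX e0 rstate_step[OF e0 DE a b, of u] e(3) by blast
  have stT: "stable c {a, b} T"
    unfolding stable_def
  proof (intro ballI impI)
    fix h assume h: "h \<in> E" and H: "c h \<in> {a, b} \<and> ends h \<inter> T \<noteq> {}"
    then obtain p where p: "p \<in> ends h" "p \<in> T" by blast
    have hD: "h \<in> D" unfolding D_def using h H p unfolding T_def by blast
    then obtain c' where c': "rstate c D a b c' h" using p unfolding T_def by blast
    show "ends h \<subseteq> T"
      unfolding T_def using DX[OF hD] rstate_step[OF c' DE a b] c' by blast
  qed
  have XT: "X \<subseteq> T" unfolding X by (rule kcomp_subset[OF stT uT])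
  have good: "\<exists>c'. rstate c D a b c' g" if "g \<in> D" for g
  proof -
    have "g \<in> E" using that DE by blast
    then obtain p where "p \<in> ends g" using ends_nonempty by blast
    then show ?thesis using XT DX[OF that] that unfolding T_def by blast
  qed
  have hasD: "\<exists>g\<in>D. p \<in> ends g" if pX: "p \<in> X" for p
  proof (cases "p = u \<or> p = v")
    case True
    then show ?thesis unfolding D_def using e by blast
  next
    case False
    then obtain g where "g \<in> E" "p \<in> ends g" "c g = a"
      using inner[OF pX] not_missE[of c p a] by blast
    then show ?thesis unfolding D_def using pX by blast
  qed
  show hask: "\<not> miss c p k" if p: "p \<in> X" for p
  proof -
    obtain g where g: "g \<in> D" "p \<in> ends g" using hasD[OF p] by blast
    obtain c' where c': "rstate c D a b c' g" using good[OF g(1)] by blast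
    then have o': "opt c'" and "miss c' p a \<or> miss c' p b"
      using g(2) unfolding rstate_def by auto
    then have "\<not> miss c' p k"
      using opt_miss_unique[OF o', of p] a b k p XV by blast
    then obtain h where h: "h \<in> E" "p \<in> ends h" "c' h = k" by (rule not_missE)
    then have "h \<notin> D" using c' k unfolding rstate_def by auto
    then have "c h = k" using c' h unfolding rstate_def by auto
    then show ?thesis using h missD by blast
  qed
  have cl: "h \<in> D" if hh: "h \<in> E" "c h \<noteq> k" "ends h \<inter> X \<noteq> {}" for h
  proof (cases "c h = 0")
    case True
    obtain p where p: "p \<in> ends h" "p \<in> X" using hh by blast
    show ?thesis
    proof (cases "p = u \<or> p = v")
      case True
      then have "h = e" using opt_unc_unique[OF o hh(1) \<open>c h = 0\<close> p(1) e(1,2)] e(3) by blast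
      then show ?thesis unfolding D_def by blast
    next
      case False
      then have "\<not> miss c p x" if "x \<in> {1..3}" for x
        using inner[OF p(2)] hask[OF p(2)] col[of x] that by blast
      then show ?thesis using no_miss_no_unc[OF pr _ _ hh(1) p(1)] True p XV by blast
    qed
  next
    case False
    then have "c h \<in> {1..3}" using proper_le[OF pr hh(1)] by simp
    then have "c h \<in> {a, b}" using col hh(2) by blast
    then show ?thesis unfolding D_def using hh by blast
  qed
  have Deq: "{h\<in>E. c h \<noteq> k \<and> ends h \<inter> X \<noteq> {}} = D"
    using cl e uX k unfolding D_def by auto
  show "ends h \<subseteq> X \<and> (h = e \<or> c h \<in> {a, b})" if "h \<in> E" "c h \<noteq> k" "ends h \<inter> X \<noteq> {}" for h
    using cl[OF that] DX unfolding D_def by blast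
  show "\<exists>c'. rstate c {h\<in>E. c h \<noteq> k \<and> ends h \<inter> X \<noteq> {}} a b c' g"
    if "g \<in> E" "c g \<noteq> k" "ends g \<inter> X \<noteq> {}" for g
    unfolding Deq using good cl[OF that] by blast
  show "X = kcomp c (-{k}) u"
  proof
    show "X \<subseteq> kcomp c (-{k}) u" unfolding X by (rule kcomp_mono) (use k in auto)
    have "stable c (-{k}) X" unfolding stable_def using cl DX by blast
    then show "kcomp c (-{k}) u \<subseteq> X" by (rule kcomp_subset[OF _ uX])
  qed
  \<comment> \<open>The edges of colour \<open>a\<close> pair up the vertices of \<open>X\<close>
    other than \<open>u\<close>.\<close>
  show "odd (card X)"
  proof -
    let ?Y = "X - {u}" and ?F = "{h\<in>E. c h = a \<and> ends h \<subseteq> X - {u}}"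
    have fX: "finite X" using XV finite_V finite_subset by blast
    have dc: "(\<Sum>p\<in>?Y. card {h\<in>?F. p \<in> ends h}) = 2 * card ?F"
      by (rule double_count) (use fX in auto)
    have one: "card {h\<in>?F. p \<in> ends h} = 1" if p: "p \<in> ?Y" for p
    proof -
      have "\<not> miss c p a"
      proof (cases "p = v")
        case True
        then show ?thesis using opt_miss_unique[OF o uV(2) a _ b m(2)] ab by blast
      next
        case False
        then show ?thesis using inner p by blast
      qed
      then obtain h where h: "h \<in> E" "p \<in> ends h" "c h = a" by (rule not_missE)
      have "ends h \<subseteq> X" using stableD[OF stX h(1) _ h(2)] h(3) p by blast
      moreover have "u \<notin> ends h" using missD[OF m(1) h(1)] h(3) by blast
      ultimately have "h \<in> {h\<in>?F. p \<in> ends h}" using h by blast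
      moreover have "g = h" if "g \<in> {h\<in>?F. p \<in> ends h}" for g
        using properD[OF pr _ h(1) _ h(2), of g] that h(3) a0 by simp
      ultimately have "{h\<in>?F. p \<in> ends h} = {h}" by blast
      then show ?thesis by simp
    qed
    have "(\<Sum>p\<in>?Y. card {h\<in>?F. p \<in> ends h}) = (\<Sum>p\<in>?Y. 1)"
      by (rule sum.cong[OF refl one])
    then have "card ?Y = 2 * card ?F" using dc by (metis card_eq_sum)
    moreover have "card X = Suc (card ?Y)" using card.remove[OF fX uX] .
    ultimately show ?thesis by presburger
  qed
qed

text \<open>\<open>cyc c e k X\<close>: the uncoloured edge \<open>e\<close> closes an alternating path in the two colours other
  than \<open>k\<close> to an odd cycle with vertex set \<open>X\<close>.  Describing \<open>X\<close> as a component of the graph without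
  colour \<open>k\<close> makes it independent of which edge of the cycle is the uncoloured one.\<close>

definition cyc :: "('e \<Rightarrow> nat) \<Rightarrow> 'e \<Rightarrow> nat \<Rightarrow> 'v set \<Rightarrow> bool" where
  "cyc c e k X \<longleftrightarrow> opt c \<and> e \<in> E \<and> c e = 0 \<and> k \<in> {1..3} \<and> (\<forall>v\<in>ends e. \<not> miss c v k) \<and>
     (\<exists>u\<in>ends e. X = kcomp c (-{k}) u)"

lemma cycD: "cyc c e k X \<Longrightarrow> opt c" "cyc c e k X \<Longrightarrow> proper c" "cyc c e k X \<Longrightarrow> e \<in> E"
  "cyc c e k X \<Longrightarrow> c e = 0" "cyc c e k X \<Longrightarrow> k \<in> {1..3}"
  unfolding cyc_def using opt_proper by auto

lemma cyc_exists:
  assumes o: "opt c" and e: "e \<in> E" "c e = 0"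
  shows "\<exists>k X. cyc c e k X"
proof -
  obtain u v where uv: "ends e = {u, v}" using ends_pair[OF e(1)] by blast
  obtain a where a: "a \<in> {1..3}" "miss c u a" using ex_miss[OF opt_proper[OF o] e, of u] uv by blast
  obtain b where b: "b \<in> {1..3}" "miss c v b" using ex_miss[OF opt_proper[OF o] e, of v] uv by blast
  have "(1 \<noteq> a \<and> 1 \<noteq> b) \<or> (2 \<noteq> a \<and> 2 \<noteq> b) \<or> (3 \<noteq> a \<and> 3 \<noteq> b)" by auto
  moreover have "1 \<in> {1..3::nat}" "2 \<in> {1..3::nat}" "3 \<in> {1..3::nat}" by simp_all
  ultimately have "\<exists>k\<in>{1..3::nat}. k \<noteq> a \<and> k \<noteq> b" by metis
  then obtain k where k: "k \<in> {1..3}" "k \<noteq> a" "k \<noteq> b" by blast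
  have "u \<in> V" "v \<in> V" using ends_in_V[OF e(1)] uv by auto
  then have "\<not> miss c u k" "\<not> miss c v k"
    using opt_miss_unique[OF o] a b k by blast+
  then have "cyc c e k (kcomp c (-{k}) u)" unfolding cyc_def using o e k uv by auto
  then show ?thesis by blast
qed

lemma cyc_unpack:
  assumes "cyc c e k X"
  obtains u v a b where "ends e = {u, v}" "miss c u a" "miss c v b" "a \<in> {1..3}" "b \<in> {1..3}"
    "k \<noteq> a" "k \<noteq> b" "X = kcomp c {a, b} u"
proof -
  note o = cycD(1)[OF assms] and e = cycD(3,4)[OF assms] and k = cycD(5)[OF assms]
  obtain u where u: "u \<in> ends e" "X = kcomp c (-{k}) u" using assms unfolding cyc_def by blast
  obtain v where uv: "ends e = {u, v}" using ends_pair_at[OF e(1) u(1)] by blast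
  obtain a where a: "a \<in> {1..3}" "miss c u a" using ex_miss[OF opt_proper[OF o] e, of u] uv by blast
  obtain b where b: "b \<in> {1..3}" "miss c v b" using ex_miss[OF opt_proper[OF o] e, of v] uv by blast
  have ka: "k \<noteq> a" "k \<noteq> b" using assms a b uv unfolding cyc_def by auto
  have "kcomp c {a, b} u = kcomp c (-{k}) u"
    by (rule cycle_facts(5)[OF o e uv a(2) b(2) a(1) b(1) k ka refl])
  then show ?thesis using that[OF uv a(2) b(2) a(1) b(1) ka] u by simp
qed

lemma cyc_basic:
  assumes C: "cyc c e k X"
  shows cyc_ends: "ends e \<subseteq> X" and cyc_spoke: "p \<in> X \<Longrightarrow> \<not> miss c p k" and cyc_odd: "odd (card X)"
proof -
  obtain u v a b where U: "ends e = {u, v}" "miss c u a" "miss c v b" "a \<in> {1..3}" "b \<in> {1..3}"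
    "k \<noteq> a" "k \<noteq> b" "X = kcomp c {a, b} u" by (rule cyc_unpack[OF C])
  note F = cycle_facts[OF cycD(1,3,4)[OF C] U(1-5) cycD(5)[OF C] U(6-8)]
  show "ends e \<subseteq> X" using F(1) U(1,8) kcomp_self by simp
  show "p \<in> X \<Longrightarrow> \<not> miss c p k" by (rule F(2))
  show "odd (card X)" by (rule F(6))
qed

lemma cyc_in_V:
  assumes "cyc c e k X" shows "X \<subseteq> V"
proof -
  obtain u where u: "u \<in> ends e" "X = kcomp c (-{k}) u" using assms unfolding cyc_def by blast
  have "u \<in> V" by (rule ends_in_V[OF cycD(3)[OF assms] u(1)])
  then show ?thesis unfolding u(2) by (rule kcomp_in_V)
qed

lemma cyc_finite: "cyc c e k X \<Longrightarrow> finite X"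
  by (rule finite_subset[OF cyc_in_V finite_V])

lemma cyc_closed:
  assumes "cyc c e k X" "h \<in> E" "c h \<noteq> k" "p \<in> ends h" "p \<in> X"
  shows "ends h \<subseteq> X"
proof -
  obtain u where u: "X = kcomp c (-{k}) u" using assms(1) unfolding cyc_def by blast
  show ?thesis using assms(3,5) stableD[OF kcomp_stable[of c "-{k}" u] assms(2) _ assms(4)]
    unfolding u by blast
qed

lemma cyc_unc:
  assumes "cyc c e k X" "h \<in> E" "c h = 0" "p \<in> ends h" "p \<in> X"
  shows "h = e"
proof -
  obtain u v a b where U: "ends e = {u, v}" "miss c u a" "miss c v b" "a \<in> {1..3}" "b \<in> {1..3}"
    "k \<noteq> a" "k \<noteq> b" "X = kcomp c {a, b} u" by (rule cyc_unpack[OF assms(1)])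
  have k: "k \<in> {1..3}" by (rule cycD(5)[OF assms(1)])
  have "c h \<noteq> k" using assms(3) k by simp
  then have "h = e \<or> c h \<in> {a, b}"
    using cycle_facts(3)[OF cycD(1,3,4)[OF assms(1)] U(1-5) k U(6-8) assms(2)] assms(4,5)
    by (metis disjoint_iff)
  moreover have "c h \<notin> {a, b}" using U(4,5) assms(3) by auto
  ultimately show ?thesis by blast
qed

lemma cyc_miss:
  assumes "cyc c e k X" "p \<in> X" "miss c p a" "a \<in> {1..3}"
  shows "p \<in> ends e"
proof -
  have "p \<in> V" using assms cyc_in_V by blast
  then obtain h where h: "h \<in> E" "c h = 0" "p \<in> ends h"
    by (rule miss_unc[OF cycD(2)[OF assms(1)] _ assms(3,4)])
  then have "h = e" by (rule cyc_unc[OF assms(1) _ _ _ assms(2)])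
  then show ?thesis using h by simp
qed

lemma cyc_connected:
  assumes "cyc c e k X" "Y \<subseteq> X" "Y \<noteq> {}"
    and "\<And>h p. h \<in> E \<Longrightarrow> c h \<noteq> k \<Longrightarrow> p \<in> ends h \<Longrightarrow> p \<in> Y \<Longrightarrow> ends h \<subseteq> Y"
  shows "Y = X"
proof -
  obtain u where u: "X = kcomp c (-{k}) u" using assms(1) unfolding cyc_def by blast
  obtain y where y: "y \<in> Y" using assms by blast
  have "stable c (-{k}) Y" unfolding stable_def using assms(4) by blast
  then have "kcomp c (-{k}) y \<subseteq> Y" using kcomp_subset y by blast
  moreover have "kcomp c (-{k}) y = X" using kcomp_eq[of y c "-{k}" u] u y assms(2) by blast
  ultimately show ?thesis using assms(2) by blast
qed

lemma kcomp_cong: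
  assumes "\<And>h. h \<in> E \<Longrightarrow> ends h \<inter> kcomp c A u \<noteq> {} \<Longrightarrow> c' h \<in> B \<longleftrightarrow> c h \<in> A"
  shows "kcomp c' B u = kcomp c A u"
proof
  have "stable c' B (kcomp c A u)"
    using kcomp_stable[of c A u] assms unfolding stable_def by blast
  then show sub: "kcomp c' B u \<subseteq> kcomp c A u" by (rule kcomp_subset[OF _ kcomp_self])
  have "stable c A (kcomp c' B u)"
    using kcomp_stable[of c' B u] assms sub unfolding stable_def by blast
  then show "kcomp c A u \<subseteq> kcomp c' B u" by (rule kcomp_subset[OF _ kcomp_self])
qed

lemma cyc_transfer:
  assumes "cyc c e k X" "opt c'" "\<And>h. h \<in> E \<Longrightarrow> ends h \<inter> X \<noteq> {} \<Longrightarrow> c' h = c h"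
  shows "cyc c' e k X"
proof -
  obtain u where u: "u \<in> ends e" "X = kcomp c (-{k}) u" using assms(1) unfolding cyc_def by blast
  have "kcomp c' (-{k}) u = kcomp c (-{k}) u"
    by (rule kcomp_cong) (use assms(3) u in auto)
  moreover have "\<not> miss c' v k" if "v \<in> ends e" for v
  proof -
    have v: "v \<in> X" using cyc_ends[OF assms(1)] that by blast
    then obtain h where "h \<in> E" "v \<in> ends h" "c h = k" using cyc_spoke[OF assms(1)] not_missE by blast
    then show ?thesis using assms(3)[of h] v missD[of c' v k h] by blast
  qed
  moreover have "c' e = 0" using assms(3)[of e] cyc_ends[OF assms(1)] cycD(3,4)[OF assms(1)] u by auto
  ultimately show ?thesis unfolding cyc_def using assms(2) cycD[OF assms(1)] u by blast
qed

text \<open>This makes any chosen vertex of the cycle an end of the hole, missing a prescribed one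
  of the two cycle colours, without touching any edge off the cycle.\<close>

lemma cyc_rotate:
  assumes C: "cyc c e k X" and g: "g \<in> E" "c g \<noteq> k" "p \<in> ends g" and p: "p \<in> X"
    and x: "x \<in> {1..3}" "x \<noteq> k"
  obtains c' where "cyc c' g k X" "miss c' p x"
    "\<And>h. h \<in> E \<Longrightarrow> c' h \<noteq> c h \<Longrightarrow> ends h \<subseteq> X \<and> c h \<noteq> k \<and> c' h \<noteq> k"
    "unc c' = insert g (unc c - {e})"
proof -
  obtain u v a b where U: "ends e = {u, v}" "miss c u a" "miss c v b" "a \<in> {1..3}" "b \<in> {1..3}"
    "k \<noteq> a" "k \<noteq> b" "X = kcomp c {a, b} u" by (rule cyc_unpack[OF C])
  note F = cycle_facts[OF cycD(1,3,4)[OF C] U(1-5) cycD(5)[OF C] U(6-8)]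
  define D where "D = {h\<in>E. c h \<noteq> k \<and> ends h \<inter> X \<noteq> {}}"
  have k: "k \<in> {1..3}" by (rule cycD(5)[OF C])
  have DX: "ends h \<subseteq> X" if "h \<in> D" for h using F(3) that unfolding D_def by blast
  have gD: "g \<in> D" unfolding D_def using g p by blast
  have "\<exists>c'. rstate c D a b c' g" unfolding D_def using F(4)[OF g(1,2)] g p by blast
  then obtain c1 where R: "rstate c D a b c1 g" by blast
  then obtain y z where yz: "ends g = {y, z}" "miss c1 y a" "miss c1 z b"
    unfolding rstate_def by blast
  have c1: "opt c1" "c1 g = 0" "\<And>h. h \<in> E \<Longrightarrow> h \<notin> D \<Longrightarrow> c1 h = c h"
      "\<And>h. h \<in> D \<Longrightarrow> h \<noteq> g \<Longrightarrow> c1 h \<in> {a, b}"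
    using R unfolding rstate_def by blast+
  have "p = y \<or> p = z" using g(3) yz(1) by simp
  then have c1p: "miss c1 p a \<or> miss c1 p b" using yz by blast
  have st1: "stable c1 {a, b} X"
    unfolding stable_def
  proof (intro ballI impI)
    fix h assume h: "h \<in> E" "c1 h \<in> {a, b} \<and> ends h \<inter> X \<noteq> {}"
    show "ends h \<subseteq> X"
    proof (cases "h \<in> D")
      case False
      then have "c h \<in> {a, b}" using c1(3)[OF h(1)] h(2) by metis
      then have "h \<in> D" unfolding D_def using h U(6,7) by auto
      then show ?thesis using False by blast
    qed (rule DX)
  qed
  have xab: "x = a \<or> x = b" using x k U F(7) by auto
  \<comment> \<open>After the rotation \<open>p\<close> misses \<open>a\<close> or \<open>b\<close>.
    If it is the wrong one, the two colours are exchanged on all of \<open>X\<close>, which is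
    stable.\<close>
  have "\<exists>c2. opt c2 \<and> c2 g = 0 \<and> (\<forall>h\<in>E - D. c2 h = c h) \<and> (\<forall>h\<in>D - {g}. c2 h \<in> {a, b}) \<and> miss c2 p x"
  proof (cases "miss c1 p x")
    case True
    then show ?thesis using c1 by blast
  next
    case False
    let ?c2 = "swap c1 a b X"
    have s1: "opt ?c2" by (rule swap_opt[OF c1(1) U(4,5) st1])
    have s2: "?c2 g = 0" using c1(2) U(4,5) by (simp add: swap_eq_0)
    have s3: "?c2 h = c h" if h: "h \<in> E - D" for h
    proof (cases "ends h \<inter> X = {}")
      case True
      then show ?thesis using c1(3) h by (simp add: swap_def)
    next
      case False
      then have "c h = k" using h unfolding D_def by blast
      then have "c1 h = k" using c1(3) h by simp
      then show ?thesis using U(6,7) \<open>c h = k\<close> unfolding swap_def transpose_def by simp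
    qed
    have s4: "?c2 h \<in> {a, b}" if "h \<in> D - {g}" for h
      using c1(4)[of h] that unfolding swap_def transpose_def by auto
    have s5: "miss ?c2 p x"
    proof -
      have "miss c1 p (transpose a b x)" using xab False c1p by auto
      then show ?thesis using miss_swap_in[OF p, of c1 a b x] by simp
    qed
    show ?thesis by (intro exI[of _ ?c2] conjI ballI s1 s2 s3 s4 s5)
  qed
  then obtain c2 where R2: "opt c2 \<and> c2 g = 0 \<and> (\<forall>h\<in>E - D. c2 h = c h) \<and>
      (\<forall>h\<in>D - {g}. c2 h \<in> {a, b}) \<and> miss c2 p x" ..
  have c2: "opt c2" "c2 g = 0" "\<And>h. h \<in> E \<Longrightarrow> h \<notin> D \<Longrightarrow> c2 h = c h"
      "\<And>h. h \<in> D \<Longrightarrow> h \<noteq> g \<Longrightarrow> c2 h \<in> {a, b}" "miss c2 p x" using R2 by blast+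
  have kk: "c2 h = k \<longleftrightarrow> c h = k" if h: "h \<in> E" for h
  proof (cases "h \<in> D")
    case True
    then have "c2 h \<noteq> k" using c2(2) c2(4)[OF True] U(6,7) k by (cases "h = g") auto
    then show ?thesis using True unfolding D_def by blast
  qed (use c2(3) h in simp)
  have "\<not> miss c2 q k" if qX: "q \<in> X" for q
  proof -
    obtain h where "h \<in> E" "q \<in> ends h" "c h = k" using cyc_spoke[OF C qX] by (rule not_missE)
    then show ?thesis using kk missD by blast
  qed
  moreover have "X = kcomp c2 (-{k}) p"
  proof -
    have "kcomp c2 (-{k}) p = kcomp c (-{k}) p" by (rule kcomp_cong) (use kk in auto)
    also have "\<dots> = kcomp c (-{k}) u" by (rule kcomp_eq) (use p F(5) in blast)
    finally show ?thesis using F(5) by simp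
  qed
  ultimately have "cyc c2 g k X"
    unfolding cyc_def using c2(1,2) g k DX[OF gD] by blast
  moreover have "ends h \<subseteq> X \<and> c h \<noteq> k \<and> c2 h \<noteq> k" if "h \<in> E" "c2 h \<noteq> c h" for h
    using c2(3)[OF that(1)] that DX[of h] kk[OF that(1)] unfolding D_def by blast
  moreover have "unc c2 = insert g (unc c - {e})"
  proof (intro set_eqI iffI)
    fix h assume h: "h \<in> unc c2"
    show "h \<in> insert g (unc c - {e})"
    proof (cases "h \<in> D")
      case True
      then show ?thesis using c2(4)[OF True] h U(4,5) unfolding unc_def by auto
    next
      case False
      moreover have "e \<in> D" unfolding D_def using cycD(3,4)[OF C] k cyc_ends[OF C] U(1) by auto
      ultimately show ?thesis using c2(3)[of h] h unfolding unc_def by auto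
    qed
  next
    fix h assume h: "h \<in> insert g (unc c - {e})"
    show "h \<in> unc c2"
    proof (cases "h = g")
      case False
      then have hh: "h \<in> E" "c h = 0" "h \<noteq> e" using h unfolding unc_def by auto
      then have "h \<notin> D" unfolding D_def using cyc_unc[OF C] by blast
      then show ?thesis using c2(3) hh unfolding unc_def by simp
    qed (use g c2(2) in \<open>simp add: unc_def\<close>)
  qed
  ultimately show ?thesis using that c2(5) by blast
qed

lemma miss_cong:
  assumes "\<And>h. h \<in> E \<Longrightarrow> v \<in> ends h \<Longrightarrow> c' h = c h"
  shows "miss c' v a \<longleftrightarrow> miss c v a"
  unfolding miss_def inc_def using assms by auto

lemma cyc_unique:
  assumes C: "cyc c e k X" "cyc c e k' X'"
  shows "k = k'" "X = X'"
proof -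
  obtain u v a b where U: "ends e = {u, v}" "miss c u a" "miss c v b" "a \<in> {1..3}" "b \<in> {1..3}"
    "k \<noteq> a" "k \<noteq> b" "X = kcomp c {a, b} u" by (rule cyc_unpack[OF C(1)])
  have ab: "a \<noteq> b" by (rule opt_link(1)[OF cycD(1,3,4)[OF C(1)] U(1-5)])
  have "\<not> miss c u k'" "\<not> miss c v k'" using C(2) U(1) unfolding cyc_def by auto
  then have "k' \<noteq> a" "k' \<noteq> b" using U by auto
  then show k: "k = k'" using U(4-7) ab cycD(5)[OF C(1)] cycD(5)[OF C(2)] by auto
  obtain x where x: "x \<in> ends e" "X = kcomp c (-{k}) x" using C(1) unfolding cyc_def by blast
  obtain y where y: "y \<in> ends e" "X' = kcomp c (-{k}) y" using C(2) unfolding cyc_def k by blast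
  have "y \<in> kcomp c (-{k}) x" using cyc_ends[OF C(1)] x y(1) by blast
  then show "X = X'" using kcomp_eq x(2) y(2) by simp
qed

lemma cyc_dedge:
  assumes C: "cyc c e k X" and p: "p \<in> X"
  obtains h1 h2 where "h1 \<noteq> h2" "h1 \<in> E" "h2 \<in> E" "p \<in> ends h1" "p \<in> ends h2" "c h1 \<noteq> k" "c h2 \<noteq> k"
    "\<And>h. h \<in> E \<Longrightarrow> p \<in> ends h \<Longrightarrow> c h \<noteq> k \<Longrightarrow> h = h1 \<or> h = h2"
proof -
  have pV: "p \<in> V" using cyc_in_V[OF C] p by blast
  have k0: "k \<noteq> 0" using cycD(5)[OF C] by auto
  obtain g where g: "g \<in> E" "p \<in> ends g" "c g = k" using cyc_spoke[OF C p] by (rule not_missE)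
  have "{h\<in>inc p. c h \<noteq> k} = inc p - {g}"
  proof (intro set_eqI iffI)
    fix h assume "h \<in> inc p - {g}"
    then show "h \<in> {h\<in>inc p. c h \<noteq> k}"
      using properD[OF cycD(2)[OF C] _ g(1) _ g(2)] g(3) k0 unfolding inc_def by auto
  qed (use g in auto)
  then have "card {h\<in>inc p. c h \<noteq> k} = 2"
    using card_inc[OF pV] g finite_inc by (simp add: inc_iff)
  then obtain h1 h2 where "{h\<in>inc p. c h \<noteq> k} = {h1, h2}" "h1 \<noteq> h2"
    unfolding card_2_iff by blast
  note H = this
  have "h1 \<in> {h\<in>inc p. c h \<noteq> k}" "h2 \<in> {h\<in>inc p. c h \<noteq> k}" unfolding H(1) by simp_all
  moreover have "h = h1 \<or> h = h2" if "h \<in> E" "p \<in> ends h" "c h \<noteq> k" for h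
  proof -
    have "h \<in> {h\<in>inc p. c h \<noteq> k}" using that by (simp add: inc_iff)
    then show ?thesis unfolding H(1) by simp
  qed
  ultimately show ?thesis using that[OF H(2)] by (simp add: inc_iff)
qed

lemma cyc_step: "cyc c e k X \<Longrightarrow> p \<in> X \<Longrightarrow> step c (-{k}) p q \<Longrightarrow> q \<in> X"
  unfolding step_def using cyc_closed[of c e k X _ p] by auto

text \<open>Two parallel edges at \<open>p\<close> would make a component with two vertices, but
  \<open>card X\<close> is odd.\<close>

lemma cyc_two_nbrs:
  assumes C: "cyc c e k X" and p: "p \<in> X"
  obtains q1 q2 where "q1 \<noteq> q2" "p \<noteq> q1" "p \<noteq> q2" "q1 \<in> X" "q2 \<in> X"
    "step c (-{k}) p q1" "step c (-{k}) p q2" "\<And>q. step c (-{k}) p q \<Longrightarrow> q = q1 \<or> q = q2"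
proof -
  obtain h1 h2 where H: "h1 \<noteq> h2" "h1 \<in> E" "h2 \<in> E" "p \<in> ends h1" "p \<in> ends h2" "c h1 \<noteq> k" "c h2 \<noteq> k"
    "\<And>h. h \<in> E \<Longrightarrow> p \<in> ends h \<Longrightarrow> c h \<noteq> k \<Longrightarrow> h = h1 \<or> h = h2"
    using cyc_dedge[OF C p] by blast
  obtain q1 where q1: "ends h1 = {p, q1}" "p \<noteq> q1" using ends_pair_at[OF H(2,4)] by blast
  obtain q2 where q2: "ends h2 = {p, q2}" "p \<noteq> q2" using ends_pair_at[OF H(3,5)] by blast
  have s: "step c (-{k}) p q1" "step c (-{k}) p q2"
    unfolding step_def using H q1 q2 by auto
  have qX: "q1 \<in> X" "q2 \<in> X" using cyc_step[OF C p] s by blast+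
  have "q1 \<noteq> q2"
  proof
    assume q: "q1 = q2"
    obtain g1 g2 where G: "\<And>h. h \<in> E \<Longrightarrow> q1 \<in> ends h \<Longrightarrow> c h \<noteq> k \<Longrightarrow> h = g1 \<or> h = g2"
      using cyc_dedge[OF C qX(1)] by metis
    have "h1 = g1 \<or> h1 = g2" "h2 = g1 \<or> h2 = g2" using G[OF H(2)] G[OF H(3)] H(6,7) q q1 q2 by auto
    then have G': "h = h1 \<or> h = h2" if "h \<in> E" "q1 \<in> ends h" "c h \<noteq> k" for h
      using G[OF that] H(1) by auto
    have "{p, q1} = X"
    proof (rule cyc_connected[OF C])
      fix h r assume h: "h \<in> E" "c h \<noteq> k" "r \<in> ends h" "r \<in> {p, q1}"
      then have "h = h1 \<or> h = h2" using H(8)[OF h(1)] G'[OF h(1)] by auto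
      then show "ends h \<subseteq> {p, q1}" using q1 q2 q by auto
    qed (use p qX in auto)
    moreover have "card {p, q1} = 2" using q1 by simp
    ultimately show False using cyc_odd[OF C] by simp
  qed
  moreover have "q = q1 \<or> q = q2" if "step c (-{k}) p q" for q
  proof -
    obtain h where h: "h \<in> E" "ends h = {p, q}" "c h \<noteq> k" using \<open>step c (-{k}) p q\<close> unfolding step_def by auto
    then have "h = h1 \<or> h = h2" using H(8) by auto
    then show ?thesis using h q1 q2 by (auto simp: doubleton_eq_iff)
  qed
  ultimately show ?thesis using that q1(2) q2(2) qX s by blast
qed

lemma rtranclp_first_entry:
  assumes "R\<^sup>*\<^sup>* u p" "u \<notin> X" "p \<in> X"
  shows "\<exists>q' q. (\<lambda>s t. R s t \<and> s \<notin> X \<and> t \<notin> X)\<^sup>*\<^sup>* u q' \<and> R q' q \<and> q' \<notin> X \<and> q \<in> X"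
  using assms
proof (induction rule: converse_rtranclp_induct)
  case base
  then show ?case by blast
next
  case (step y z)
  show ?case
  proof (cases "z \<in> X")
    case True
    then show ?thesis using step.hyps(1) step.prems by blast
  next
    case False
    then obtain q' q where q: "(\<lambda>s t. R s t \<and> s \<notin> X \<and> t \<notin> X)\<^sup>*\<^sup>* z q'" "R q' q" "q' \<notin> X" "q \<in> X"
      using step.IH step.prems by blast
    have "(\<lambda>s t. R s t \<and> s \<notin> X \<and> t \<notin> X)\<^sup>*\<^sup>* y q'"
      by (rule converse_rtranclp_into_rtranclp[OF _ q(1)]) (use step.hyps(1) step.prems(1) False in blast)
    then show ?thesis using q by blast
  qed
qed

text \<open>If the second path meets the first cycle, rotating the first cycle so that the entry point
  becomes an end cuts the second path off from its other end.\<close>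

lemma cyc_disjoint:
  assumes C: "cyc c e k X" and C': "cyc c f l Y" and ef: "e \<noteq> f"
  shows "X \<inter> Y = {}"
proof (rule ccontr)
  assume "X \<inter> Y \<noteq> {}"
  then obtain p where p: "p \<in> X" "p \<in> Y" by blast
  have fX: "z \<notin> X" if "z \<in> ends f" for z
    using cyc_unc[OF C cycD(3,4)[OF C'] that] ef by blast
  show False
  proof (cases "k = l")
    case True
    obtain u where u: "u \<in> ends e" "X = kcomp c (-{k}) u" using C unfolding cyc_def by blast
    obtain v where v: "v \<in> ends f" "Y = kcomp c (-{k}) v" using C' unfolding cyc_def True by blast
    have "X = Y" using kcomp_eq[of p c "-{k}" u] kcomp_eq[of p c "-{k}" v] p u v by simp
    then show False using fX[OF v(1)] cyc_ends[OF C'] v(1) by blast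
  next
    case False
    obtain u v a b where U: "ends f = {u, v}" "miss c u a" "miss c v b" "a \<in> {1..3}" "b \<in> {1..3}"
      "l \<noteq> a" "l \<noteq> b" "Y = kcomp c {a, b} u" by (rule cyc_unpack[OF C'])
    have ab: "a \<noteq> b" by (rule opt_link(1)[OF cycD(1,3,4)[OF C'] U(1-5)])
    have l: "l \<in> {1..3}" and k: "k \<in> {1..3}" using cycD(5) C C' by auto
    have kab: "k = a \<or> k = b" using U(4-7) ab l k False by auto
    have "v \<in> Y" using cyc_ends[OF C'] U(1) by blast
    then have Yv: "Y = kcomp c {a, b} v" using kcomp_eq U(8) by simp
    have "\<exists>s t d. ends f = {s, t} \<and> miss c s k \<and> miss c t d \<and> d \<in> {1..3} \<and> d \<noteq> k \<and> {a, b} = {k, d} \<and>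
        Y = kcomp c {k, d} t"
    proof (cases "k = a")
      case True
      show ?thesis using U Yv ab True by (intro exI[of _ u] exI[of _ v] exI[of _ b]) auto
    next
      case False
      then have "k = b" using kab by blast
      show ?thesis using U ab \<open>k = b\<close> by (intro exI[of _ v] exI[of _ u] exI[of _ a]) (auto simp: insert_commute)
    qed
    then obtain s t d where S: "ends f = {s, t}" "miss c s k" "miss c t d" "d \<in> {1..3}" "d \<noteq> k"
      "Y = kcomp c {k, d} t" by blast
    have sX: "s \<notin> X" "t \<notin> X" using fX S(1) by auto
    have "(step c {k, d})\<^sup>*\<^sup>* t p" using p(2) S(6) unfolding kcomp_def by simp
    then obtain q' q where q: "(\<lambda>s t. step c {k, d} s t \<and> s \<notin> X \<and> t \<notin> X)\<^sup>*\<^sup>* t q'" "step c {k, d} q' q"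
      "q' \<notin> X" "q \<in> X" using rtranclp_first_entry[OF _ sX(2) p(1)] by blast
    obtain g where g: "g \<in> E" "q \<in> ends g" "c g \<noteq> k" using cyc_dedge[OF C q(4)] by metis
    obtain c' where c': "cyc c' g k X" "miss c' q d"
      "\<And>h. h \<in> E \<Longrightarrow> c' h \<noteq> c h \<Longrightarrow> ends h \<subseteq> X \<and> c h \<noteq> k \<and> c' h \<noteq> k"
      "unc c' = insert g (unc c - {e})"
      by (rule cyc_rotate[OF C g(1,3,2) q(4) S(4,5)]) blast
    have same: "c' h = c h" if "h \<in> E" "z \<in> ends h" "z \<notin> X" for h z
      using c'(3)[OF that(1)] that by blast
    have stp: "step c' {k, d} y z" if yz: "step c {k, d} y z" "y \<notin> X" for y z
    proof -
      obtain h where "h \<in> E" "ends h = {y, z}" "c h \<in> {k, d}" using yz unfolding step_def by blast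
      then show ?thesis using same[of h y] yz(2) unfolding step_def by auto
    qed
    \<comment> \<open>The chain before its entry \<open>q\<close> runs outside \<open>X\<close>,
      where nothing has changed. So \<open>q\<close> is still on the chain of \<open>t\<close>, and
      by \<open>opt_link\<close> so is \<open>s\<close>: three ends of one chain.\<close>
    have "(step c' {k, d})\<^sup>*\<^sup>* t q'"
      using q(1) by (rule mono_rtranclp[rule_format, rotated]) (use stp in blast)
    then have qin: "q \<in> kcomp c' {k, d} t"
      unfolding kcomp_def using stp[OF q(2,3)] by simp
    have o': "opt c'" by (rule cycD(1)[OF c'(1)])
    have f': "c' f = 0" using same[OF cycD(3)[OF C'], of t] S(1) sX cycD(4)[OF C'] by simp
    have ms: "miss c' s k" using miss_cong[of s c' c] same sX(1) S(2) by blast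
    have mt: "miss c' t d" using miss_cong[of t c' c] same sX(2) S(3) by blast
    have S1: "ends f = {t, s}" using S(1) by blast
    have sin: "s \<in> kcomp c' {d, k} t"
      by (rule opt_link(2)[OF o' cycD(3)[OF C'] f' S1 mt ms S(4) k])
    have st: "t \<noteq> s" using ends_neq[OF cycD(3)[OF C'] S1] .
    have tV: "t \<in> V" using ends_in_V[OF cycD(3)[OF C']] S(1) by blast
    have eq: "{d, k} = {k, d}" by blast
    have qq: "q \<noteq> t" "q \<noteq> s" using q(4) sX by auto
    have kd: "k \<noteq> 0" "d \<noteq> 0" using k S(4) by auto
    show False
      by (rule kcomp_three_endsE[OF cycD(2)[OF c'(1)] kd S(5)[symmetric] kcomp_self sin[unfolded eq] qin tV])
         (use ms mt c'(2) st qq in blast)+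
  qed
qed

section \<open>Joining edges and maximality\<close>

definition joins :: "('e \<Rightarrow> nat) \<Rightarrow> 'e set" where
  "joins c = {g\<in>E. c g \<noteq> 0 \<and> (\<exists>j\<in>{1..3}. \<forall>v\<in>ends g. miss c v j)}"

definition unmatched :: "('e \<Rightarrow> nat) \<Rightarrow> 'e \<Rightarrow> bool" where
  "unmatched c e \<longleftrightarrow> (\<forall>g\<in>joins c. ends g \<inter> ends e = {})"

definition maxc :: "('e \<Rightarrow> nat) \<Rightarrow> bool" where
  "maxc c \<longleftrightarrow> opt c \<and> (\<forall>c'. opt c' \<longrightarrow> card (joins c') \<le> card (joins c))"

lemma finite_joins: "finite (joins c)"
  unfolding joins_def using finite_E by simp

text \<open>Whether an edge is joining depends only on the colours at its ends. This serves to
  compare a recolouring inside \<open>S\<close> with the maximum in \<open>maxc\<close>.\<close>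

lemma joins_mono:
  assumes "\<And>h. h \<in> E \<Longrightarrow> c' h \<noteq> c h \<Longrightarrow> ends h \<subseteq> S" "\<And>g. g \<in> joins c \<Longrightarrow> ends g \<inter> S = {}"
  shows "joins c \<subseteq> joins c'"
proof
  fix g assume g: "g \<in> joins c"
  then obtain j where j: "j \<in> {1..3}" "\<forall>v\<in>ends g. miss c v j" "g \<in> E" "c g \<noteq> 0"
    unfolding joins_def by blast
  have same: "c' h = c h" if h: "h \<in> E" "v \<in> ends h" "v \<in> ends g" for h v
  proof (rule ccontr)
    assume "c' h \<noteq> c h"
    then have "v \<in> S" using assms(1)[OF h(1)] h(2) by blast
    then show False using assms(2)[OF g] h(3) by blast
  qed
  have "miss c' v j" if "v \<in> ends g" for v
    using miss_cong[of v c' c j] same that j(2) by blast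
  moreover have "c' g \<noteq> 0"
    using ends_nonempty[OF j(3)] same[OF j(3)] j(4) by auto
  ultimately show "g \<in> joins c'" unfolding joins_def using j by blast
qed

lemma join_end_miss:
  assumes "g \<in> joins c" "v \<in> ends g"
  obtains j where "j \<in> {1..3}" "miss c v j"
  using assms unfolding joins_def by blast

text \<open>Each end of a joining edge misses a colour, and on the cycle only the ends of
  \<open>e\<close> do. So \<open>unmatched\<close>, which speaks of the ends of \<open>e\<close>,
  clears the whole cycle.\<close>

lemma unmatched_cyc:
  assumes C: "cyc c e k X" and u: "unmatched c e" and g: "g \<in> joins c"
  shows "ends g \<inter> X = {}"
proof (rule ccontr)
  assume "ends g \<inter> X \<noteq> {}"
  then obtain v where v: "v \<in> ends g" "v \<in> X" by blast
  obtain j where "j \<in> {1..3}" "miss c v j" using join_end_miss[OF g v(1)] .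
  then have "v \<in> ends e" using cyc_miss[OF C v(2)] by blast
  then show False using u g v(1) unfolding unmatched_def by blast
qed

text \<open>Rotating both cycles until \<open>x\<close> and \<open>y\<close> miss the same colour
  would turn the edge between them into a new joining edge. The old ones meet neither cycle and
  survive, so \<open>c\<close> would not have the most.\<close>

lemma unmatched_not_linked:
  assumes mx: "maxc c" and C: "cyc c e k X" and C': "cyc c f k Y" and ef: "e \<noteq> f"
    and u: "unmatched c e" "unmatched c f" and x: "x \<in> X" "y \<in> Y" "nb c k x y"
  shows False
proof -
  note k = cycD(5)[OF C]
  have "\<exists>a\<in>{1..3::nat}. a \<noteq> k" by (cases "k = 1") (auto intro: bexI[of _ 1] bexI[of _ 2])
  then obtain a where a: "a \<in> {1..3}" "a \<noteq> k" by blast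
  have dis: "X \<inter> Y = {}" by (rule cyc_disjoint[OF C C' ef])
  obtain g where g: "g \<in> E" "x \<in> ends g" "c g \<noteq> k" using cyc_dedge[OF C x(1)] by metis
  obtain c1 where c1: "cyc c1 g k X" "miss c1 x a"
    "\<And>h. h \<in> E \<Longrightarrow> c1 h \<noteq> c h \<Longrightarrow> ends h \<subseteq> X \<and> c h \<noteq> k \<and> c1 h \<noteq> k"
    by (rule cyc_rotate[OF C g(1,3,2) x(1) a]) blast
  have "c1 h = c h" if "h \<in> E" "ends h \<inter> Y \<noteq> {}" for h
    using c1(3)[OF that(1)] that(2) dis by blast
  then have C1: "cyc c1 f k Y" using cyc_transfer[OF C' cycD(1)[OF c1(1)]] by blast
  obtain g' where g': "g' \<in> E" "y \<in> ends g'" "c1 g' \<noteq> k" using cyc_dedge[OF C1 x(2)] by metis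
  obtain c2 where c2: "cyc c2 g' k Y" "miss c2 y a"
    "\<And>h. h \<in> E \<Longrightarrow> c2 h \<noteq> c1 h \<Longrightarrow> ends h \<subseteq> Y \<and> c1 h \<noteq> k \<and> c2 h \<noteq> k"
    by (rule cyc_rotate[OF C1 g'(1,3,2) x(2) a]) blast
  have o2: "opt c2" by (rule cycD(1)[OF c2(1)])
  have xY: "x \<notin> Y" using dis x(1) by blast
  have "c2 h = c1 h" if "h \<in> E" "x \<in> ends h" for h
    using c2(3)[OF that(1)] that(2) xY by blast
  then have mx2: "miss c2 x a" using miss_cong[of x c2 c1] c1(2) by blast
  obtain h where h: "h \<in> E" "ends h = {x, y}" "c h = k" using x(3) unfolding nb_def by blast
  have c1h: "c1 h = k" using c1(3)[OF h(1)] h(3) by auto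
  have c2h: "c2 h = k" using c2(3)[OF h(1)] c1h by auto
  have hj: "h \<in> joins c2"
    unfolding joins_def using h c2h k a mx2 c2(2) by auto
  have hn: "h \<notin> joins c"
  proof
    assume "h \<in> joins c"
    then have "ends h \<inter> X = {}" by (rule unmatched_cyc[OF C u(1)])
    then show False using h(2) x(1) by simp
  qed
  have "joins c \<subseteq> joins c2"
  proof (rule joins_mono)
    fix h assume "h \<in> E" "c2 h \<noteq> c h"
    then show "ends h \<subseteq> X \<union> Y" using c1(3)[of h] c2(3)[of h] by fastforce
  next
    fix g assume "g \<in> joins c"
    then show "ends g \<inter> (X \<union> Y) = {}"
      using unmatched_cyc[OF C u(1)] unmatched_cyc[OF C' u(2)] by blast
  qed
  then have "joins c \<subset> joins c2" using hj hn by blast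
  then have "card (joins c) < card (joins c2)" using finite_joins psubset_card_mono by blast
  then show False using mx o2 unfolding maxc_def by (meson not_less)
qed

section \<open>Swapping short Kempe chains\<close>

text \<open>A two-edge Kempe chain from a cycle of type \<open>a\<close> through \<open>w\<close> to a cycle of type \<open>b\<close> is
  swapped; then the first cycle becomes one of type \<open>b\<close> that leaves \<open>X\<close>, while all other cycles
  survive.\<close>

lemma short_swap:
  assumes C: "cyc c e a X" and C': "cyc c f b Y" and ab: "a \<noteq> b"
    and x: "x \<in> X" and y: "y \<in> Y" and xw: "nb c a x w" and wy: "nb c b w y"
    and g: "g \<in> E" "ends g = {x, q}" "c g \<noteq> a"
  obtains c' Z where "cyc c' g b Z"
    "\<And>h. h \<in> E \<Longrightarrow> c' h \<noteq> c h \<Longrightarrow> ends h \<subseteq> X \<or> ends h \<subseteq> Y \<or> ends h = {x, w} \<or> ends h = {w, y}"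
    "\<And>h k W. cyc c h k W \<Longrightarrow> h \<noteq> e \<Longrightarrow> h \<noteq> f \<Longrightarrow> cyc c' h k W \<and> W \<inter> Z = {} \<and> w \<notin> W"
    "\<And>j. j \<in> {1..3} \<Longrightarrow> \<not> miss c w j"
    "unmatched c e \<Longrightarrow> unmatched c f \<Longrightarrow> joins c \<subseteq> joins c'"
    "X \<inter> Y = {}" "w \<notin> X" "w \<notin> Y"
    "\<And>v. nb c a q v \<Longrightarrow> v \<notin> X \<Longrightarrow> v \<in> Z \<and> v \<noteq> w"
proof -
  note o = cycD(1)[OF C] and pr = cycD(2)[OF C]
  have a: "a \<in> {1..3}" and b: "b \<in> {1..3}" using cycD(5) C C' by auto
  have a0: "a \<noteq> 0" "b \<noteq> 0" using a b by auto
  have ef: "e \<noteq> f" using cyc_unique(1)[OF C, of b Y] C' ab by blast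
  have dis: "X \<inter> Y = {}" by (rule cyc_disjoint[OF C C' ef])
  have xY: "x \<notin> Y" and yX: "y \<notin> X" using dis x y by auto
  obtain hx where hx: "hx \<in> E" "ends hx = {x, w}" "c hx = a" using xw unfolding nb_def by blast
  obtain hy where hy: "hy \<in> E" "ends hy = {w, y}" "c hy = b" using wy unfolding nb_def by blast
  have wX: "w \<notin> X"
  proof
    assume "w \<in> X"
    then have "ends hy \<subseteq> X" using cyc_closed[OF C hy(1), of w] hy ab by simp
    then show False using hy(2) yX by simp
  qed
  have wY: "w \<notin> Y"
  proof
    assume "w \<in> Y"
    then have "ends hx \<subseteq> Y" using cyc_closed[OF C' hx(1), of w] hx ab by simp
    then show False using hx(2) xY by simp
  qed
  have xg: "x \<in> ends g" using g(2) by simp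
  have qX: "q \<in> X" using cyc_closed[OF C g(1,3) xg x] g(2) by simp
  \<comment> \<open>The two rotations make \<open>x\<close> miss \<open>b\<close> and
    \<open>y\<close> miss \<open>a\<close>; then the chain of colours \<open>a\<close> and
    \<open>b\<close> through \<open>w\<close> consists of \<open>hx\<close> and \<open>hy\<close>
    alone.\<close>
  obtain c1 where c1: "cyc c1 g a X" "miss c1 x b"
    "\<And>h. h \<in> E \<Longrightarrow> c1 h \<noteq> c h \<Longrightarrow> ends h \<subseteq> X \<and> c h \<noteq> a \<and> c1 h \<noteq> a"
    by (rule cyc_rotate[OF C g(1,3) xg x b ab[symmetric]]) blast
  have "c1 h = c h" if "h \<in> E" "ends h \<inter> Y \<noteq> {}" for h
    using c1(3)[OF that(1)] that(2) dis by blast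
  then have C1: "cyc c1 f b Y" using cyc_transfer[OF C' cycD(1)[OF c1(1)]] by blast
  obtain g' where g': "g' \<in> E" "y \<in> ends g'" "c1 g' \<noteq> b" using cyc_dedge[OF C1 y] by metis
  obtain c2 where c2: "cyc c2 g' b Y" "miss c2 y a"
    "\<And>h. h \<in> E \<Longrightarrow> c2 h \<noteq> c1 h \<Longrightarrow> ends h \<subseteq> Y \<and> c1 h \<noteq> b \<and> c2 h \<noteq> b"
    by (rule cyc_rotate[OF C1 g'(1,3,2) y a ab]) blast
  note o2 = cycD(1)[OF c2(1)] and pr2 = cycD(2)[OF c2(1)]
  have "c2 h = c1 h" if "h \<in> E" "ends h \<inter> X \<noteq> {}" for h
    using c2(3)[OF that(1)] that(2) dis by blast
  then have C2: "cyc c2 g a X" using cyc_transfer[OF c1(1) o2] by blast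
  have "c2 h = c1 h" if "h \<in> E" "x \<in> ends h" for h
    using c2(3)[OF that(1)] that(2) xY by blast
  then have mx: "miss c2 x b" using miss_cong[of x c2 c1] c1(2) by blast
  have "c1 hx = a" using c1(3)[OF hx(1)] hx(3) by auto
  then have c2x: "c2 hx = a" using c2(3)[OF hx(1)] hx(2) xY by auto
  have "c1 hy = b" using c1(3)[OF hy(1)] hy(2,3) yX by auto
  then have c2y: "c2 hy = b" using c2(3)[OF hy(1)] by auto
  let ?S = "{x, w, y}"
  have atS: "h = hx \<or> h = hy" if h: "h \<in> E" "c2 h \<in> {a, b}" "z \<in> ends h" "z \<in> ?S" for h z
  proof -
    consider "z = x" | "z = y" | "z = w" using h(4) by blast
    then show ?thesis
    proof cases
      case 1
      then have "c2 h = a" using missD[OF mx h(1)] h(2,3) by blast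
      then show ?thesis using properD[OF pr2 h(1) hx(1), of x] 1 h(3) hx(2) c2x a0 by simp
    next
      case 2
      then have "c2 h = b" using missD[OF c2(2) h(1)] h(2,3) by blast
      then show ?thesis using properD[OF pr2 h(1) hy(1), of y] 2 h(3) hy(2) c2y a0 by simp
    next
      case 3
      then show ?thesis using properD[OF pr2 h(1) hy(1), of w] properD[OF pr2 h(1) hx(1), of w]
          h(2,3) hx(2) hy(2) c2y c2x a0 by auto
    qed
  qed
  have st: "stable c2 {a, b} ?S"
    unfolding stable_def
  proof (intro ballI impI)
    fix h assume h: "h \<in> E" "c2 h \<in> {a, b} \<and> ends h \<inter> ?S \<noteq> {}"
    then obtain z where "z \<in> ends h" "z \<in> ?S" by blast
    then have "h = hx \<or> h = hy" using atS[OF h(1)] h(2) by blast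
    then show "ends h \<subseteq> ?S" using hx(2) hy(2) by auto
  qed
  let ?c = "swap c2 a b ?S"
  have o3: "opt ?c" by (rule swap_opt[OF o2 a b st])
  have ch2: "h = hx \<or> h = hy" if h: "h \<in> E" "?c h \<noteq> c2 h" for h
  proof -
    have "ends h \<inter> ?S \<noteq> {}" using h(2) unfolding swap_def by metis
    then obtain z where z: "z \<in> ends h" "z \<in> ?S" by blast
    have "c2 h \<in> {a, b}" using h(2) unfolding swap_def transpose_def by (auto split: if_splits)
    then show ?thesis using atS[OF h(1) _ z] by blast
  qed
  have ch: "ends h \<subseteq> X \<or> ends h \<subseteq> Y \<or> ends h = {x, w} \<or> ends h = {w, y}"
    if h: "h \<in> E" "?c h \<noteq> c h" for h
  proof -
    consider "?c h \<noteq> c2 h" | "c2 h \<noteq> c1 h" | "c1 h \<noteq> c h" using h(2) by force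
    then show ?thesis
      using ch2[OF h(1)] c2(3)[OF h(1)] c1(3)[OF h(1)] hx(2) hy(2) by cases auto
  qed
  \<comment> \<open>After the swap \<open>x\<close> has an edge of colour \<open>b\<close>. So has
    \<open>q\<close>: otherwise both ends of the hole \<open>g\<close> would have missed
    \<open>b\<close> in the optimal colouring \<open>c2\<close>. Hence the cycle of \<open>g\<close>
    now has type \<open>b\<close>.\<close>
  define Z where "Z = kcomp ?c (-{b}) x"
  have "\<not> miss ?c x b"
  proof -
    have "?c hx = b" using swap_in[OF hx(1), of x ?S c2 a b] hx(2) c2x by simp
    then show ?thesis using missD[of ?c x b hx] hx by auto
  qed
  moreover have "\<not> miss ?c q b"
  proof -
    have "\<not> miss c2 q b"
      using opt_no_common_miss[OF o2 g(1) cycD(4)[OF C2] g(2) b] mx by blast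
    then obtain hq where hq: "hq \<in> E" "q \<in> ends hq" "c2 hq = b" by (rule not_missE)
    have "hq \<noteq> hx" using hq(3) c2x ab by auto
    moreover have "hq \<noteq> hy" using hq(2) hy(2) qX wX yX by auto
    ultimately have "?c hq = b" using ch2[OF hq(1)] hq(3) by auto
    then show ?thesis using missD hq by blast
  qed
  moreover have "?c g = 0" using cycD(4)[OF C2] a0 by (simp add: swap_eq_0)
  ultimately have CZ: "cyc ?c g b Z"
    unfolding cyc_def Z_def using o3 g b by auto
  have others: "cyc ?c h k W \<and> W \<inter> Z = {} \<and> w \<notin> W" if H: "cyc c h k W" "h \<noteq> e" "h \<noteq> f" for h k W
  proof -
    have dX: "W \<inter> X = {}" by (rule cyc_disjoint[OF H(1) C H(2)])
    have dY: "W \<inter> Y = {}" by (rule cyc_disjoint[OF H(1) C' H(3)])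
    \<comment> \<open>The edges \<open>hx\<close> and \<open>hy\<close> at \<open>w\<close> both
      lead out of \<open>W\<close>, but edges of only one colour may leave a cycle.\<close>
    have wW: "w \<notin> W"
    proof
      assume w: "w \<in> W"
      have "a = k"
      proof (rule ccontr)
        assume "a \<noteq> k"
        then have "ends hx \<subseteq> W" using cyc_closed[OF H(1) hx(1), of w] hx w by simp
        then show False using hx(2) x dX by blast
      qed
      moreover have "b = k"
      proof (rule ccontr)
        assume "b \<noteq> k"
        then have "ends hy \<subseteq> W" using cyc_closed[OF H(1) hy(1), of w] hy w by simp
        then show False using hy(2) y dY by blast
      qed
      ultimately show False using ab by blast
    qed
    have "?c r = c r" if r: "r \<in> E" "ends r \<inter> W \<noteq> {}" for r
    proof (rule ccontr)
      assume "?c r \<noteq> c r"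
      then have "ends r \<subseteq> X \<union> Y \<union> {w}" using ch[OF r(1)] x y by auto
      then show False using r(2) dX dY wW by blast
    qed
    then have "cyc ?c h k W" by (rule cyc_transfer[OF H(1) o3])
    moreover have "h \<noteq> g"
    proof
      assume "h = g"
      then have "x \<in> W" using cyc_ends[OF H(1)] g(2) by simp
      then show False using dX x by blast
    qed
    ultimately show ?thesis using cyc_disjoint[OF _ CZ] wW by blast
  qed
  \<comment> \<open>Otherwise \<open>w\<close> would be an end of a third hole and lie on its
    cycle.\<close>
  have nw: "\<not> miss c w j" if j: "j \<in> {1..3}" for j
  proof
    assume m: "miss c w j"
    have "w \<in> V" using nb_in_V[OF xw] by blast
    then obtain h where h: "h \<in> E" "c h = 0" "w \<in> ends h" by (rule miss_unc[OF pr _ m j])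
    obtain k W where W: "cyc c h k W" using cyc_exists[OF o h(1,2)] by blast
    then have wW: "w \<in> W" using cyc_ends h(3) by blast
    have "h \<noteq> e" "h \<noteq> f" using h(3) cyc_ends[OF C] cyc_ends[OF C'] wX wY by auto
    then show False using others[OF W] wW by blast
  qed
  have jm: "joins c \<subseteq> joins ?c" if u: "unmatched c e" "unmatched c f"
  proof (rule joins_mono)
    fix h assume "h \<in> E" "?c h \<noteq> c h"
    then show "ends h \<subseteq> X \<union> Y \<union> {w}" using ch[of h] x y by auto
  next
    fix r assume r: "r \<in> joins c"
    have "w \<notin> ends r"
    proof
      assume w: "w \<in> ends r"
      obtain j where j: "j \<in> {1..3}" "miss c w j" by (rule join_end_miss[OF r w])
      then show False using nw by blast
    qed
    then show "ends r \<inter> (X \<union> Y \<union> {w}) = {}"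
      using unmatched_cyc[OF C u(1) r] unmatched_cyc[OF C' u(2) r] by blast
  qed
  \<comment> \<open>Only edges of colour \<open>b\<close> may leave the new cycle, so it follows the
    former spoke at \<open>q\<close> out of \<open>X\<close>.\<close>
  have out: "v \<in> Z \<and> v \<noteq> w" if v: "nb c a q v" "v \<notin> X" for v
  proof -
    obtain h where h: "h \<in> E" "ends h = {q, v}" "c h = a" using v(1) unfolding nb_def by blast
    have "q \<noteq> x" using ends_neq[OF g(1,2)] by blast
    moreover have "x \<noteq> q \<Longrightarrow> v \<noteq> w" using properD[OF pr h(1) hx(1), of w] h hx(2,3) a0
      by (auto simp: doubleton_eq_iff)
    moreover have "q \<notin> Y" using qX dis by blast
    ultimately have "\<not> (ends h \<subseteq> X \<or> ends h \<subseteq> Y \<or> ends h = {x, w} \<or> ends h = {w, y})" "v \<noteq> w"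
      using h(2) v(2) qX yX wX by (auto simp: doubleton_eq_iff)
    moreover from this have "?c h = a" using ch[OF h(1)] h(3) by metis
    moreover have "q \<in> Z" using cyc_ends[OF CZ] g(2) by simp
    ultimately show ?thesis using cyc_closed[OF CZ h(1), of q] h(2) ab by simp
  qed
  show ?thesis by (rule that[OF CZ ch others nw jm dis wX wY out])
qed

lemma third_color:
  assumes "a \<in> {1..3}" "b \<in> {1..3}" "a \<noteq> b" "d \<in> {1..3}" "d \<noteq> a" "d \<noteq> b" "k \<in> {1..3}"
  shows "k = a \<or> k = b \<or> k = (d::nat)"
  using assms by auto

text \<open>The new cycle has type \<open>b\<close>, so it follows the edges of colours
  \<open>a\<close> and \<open>d\<close> and contains \<open>q\<close>, \<open>v\<close> and
  \<open>t\<close>. All other cycles survive the swap and are disjoint from it. The conclusions are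
  read back in \<open>c\<close>, where \<open>v\<close> and \<open>t\<close> need not lie on any
  cycle.\<close>

lemma swap_separates:
  assumes C: "cyc c e a X" and C': "cyc c f b Y" and ab: "a \<noteq> b" and d: "d \<in> {1..3}" "d \<noteq> a" "d \<noteq> b"
    and x: "x \<in> X" and y: "y \<in> Y" and xw: "nb c a x w" and wy: "nb c b w y"
    and xq: "step c (-{a}) x q" and qv: "nb c a q v" and vX: "v \<notin> X"
  obtains t where "nb c d v t"
    "\<And>h k W. cyc c h k W \<Longrightarrow> h \<noteq> e \<Longrightarrow> h \<noteq> f \<Longrightarrow> v \<notin> W \<and> t \<notin> W"
    "\<And>h k W u. cyc c h k W \<Longrightarrow> h \<noteq> e \<Longrightarrow> h \<noteq> f \<Longrightarrow> nb c a t u \<Longrightarrow> u \<notin> W"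
    "t \<notin> X" "t \<notin> Y" "v \<notin> Y" "v \<noteq> w"
proof -
  obtain g where g: "g \<in> E" "ends g = {x, q}" "c g \<noteq> a" using xq unfolding step_def by blast
  obtain c' Z where Z: "cyc c' g b Z"
    "\<And>h. h \<in> E \<Longrightarrow> c' h \<noteq> c h \<Longrightarrow> ends h \<subseteq> X \<or> ends h \<subseteq> Y \<or> ends h = {x, w} \<or> ends h = {w, y}"
    "\<And>h k W. cyc c h k W \<Longrightarrow> h \<noteq> e \<Longrightarrow> h \<noteq> f \<Longrightarrow> cyc c' h k W \<and> W \<inter> Z = {} \<and> w \<notin> W"
    "X \<inter> Y = {}" "w \<notin> X" "w \<notin> Y" "\<And>v. nb c a q v \<Longrightarrow> v \<notin> X \<Longrightarrow> v \<in> Z \<and> v \<noteq> w"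
    by (rule short_swap[OF C C' ab x y xw wy g]) blast
  have a: "a \<in> {1..3}" "a \<noteq> 0" and b: "b \<in> {1..3}" using cycD(5)[OF C] cycD(5)[OF C'] by auto
  note pr = cycD(2)[OF C]
  have qX: "q \<in> X" by (rule cyc_step[OF C x xq])
  have qY: "q \<notin> Y" using qX Z(4) by blast
  have vZ: "v \<in> Z" and vw: "v \<noteq> w" using Z(7)[OF qv vX] by auto
  have vY: "v \<notin> Y"
  proof
    assume v: "v \<in> Y"
    have "step c (-{b}) v q" using nb_sym[OF qv] ab unfolding step_def nb_def by auto
    then show False using cyc_step[OF C' v] qY by blast
  qed
  have "v \<notin> ends g" using g(2) x qX vX by auto
  then have "\<not> miss c' v d" using cyc_miss[OF Z(1) vZ _ d(1)] by blast
  then obtain t where "nb c' d v t" using not_miss_nb by blast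
  then obtain h where h: "h \<in> E" "ends h = {v, t}" "c' h = d" unfolding nb_def by blast
  have "\<not> (ends h \<subseteq> X \<or> ends h \<subseteq> Y \<or> ends h = {x, w} \<or> ends h = {w, y})"
    using h(2) vX vY vw x y by (auto simp: doubleton_eq_iff)
  then have ch: "c h = d" using Z(2)[OF h(1)] h(3) by metis
  have vt: "nb c d v t" unfolding nb_def using h ch by blast
  have tZ: "t \<in> Z" using cyc_closed[OF Z(1) h(1), of v] h(2,3) d(3) vZ by simp
  have tX: "t \<notin> X"
  proof
    assume "t \<in> X"
    then have "ends h \<subseteq> X" using cyc_closed[OF C h(1), of t] h(2) ch d(2) by simp
    then show False using h(2) vX by simp
  qed
  have tY: "t \<notin> Y"
  proof
    assume "t \<in> Y"
    then have "ends h \<subseteq> Y" using cyc_closed[OF C' h(1), of t] h(2) ch d(3) by simp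
    then show False using h(2) vY by simp
  qed
  have "u \<notin> W" if H: "cyc c r k W" "r \<noteq> e" "r \<noteq> f" "nb c a t u" for r k W u
  proof -
    have dX: "W \<inter> X = {}" and dY: "W \<inter> Y = {}"
      using cyc_disjoint[OF H(1) C H(2)] cyc_disjoint[OF H(1) C' H(3)] by auto
    obtain i where i: "i \<in> E" "ends i = {t, u}" "c i = a" using H(4) unfolding nb_def by blast
    show ?thesis
    proof (cases "c' i = c i")
      case True
      then have "u \<in> Z" using cyc_closed[OF Z(1) i(1), of t] i(2,3) ab tZ by simp
      then show ?thesis using Z(3)[OF H(1-3)] by blast
    next
      case False
      then have "ends i = {x, w} \<or> ends i = {w, y}"
        using Z(2)[OF i(1)] i(2) tX tY by auto
      then have "u = x \<or> u = y" using i(2) tX tY x y by (auto simp: doubleton_eq_iff)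
      then show ?thesis using dX dY x y by blast
    qed
  qed
  moreover have "v \<notin> W \<and> t \<notin> W" if "cyc c r k W" "r \<noteq> e" "r \<noteq> f" for r k W
    using Z(3)[OF that] vZ tZ by blast
  ultimately show ?thesis using that[OF vt] tX tY vY vw by blast
qed

text \<open>After the swap \<open>v\<close> lies on a cycle of type \<open>b\<close>. If
  \<open>f'\<close> differed from \<open>f\<close>, its cycle, of the same type, would be intact,
  and the edge from \<open>v\<close> to \<open>y'\<close> would link two unmatched cycles of one
  type.\<close>

lemma swap_same_target:
  assumes mx: "maxc c" and C: "cyc c e a X" and C': "cyc c f b Y" and ab: "a \<noteq> b"
    and x: "x \<in> X" and y: "y \<in> Y" and xw: "nb c a x w" and wy: "nb c b w y"
    and xq: "step c (-{a}) x q" and qv: "nb c a q v" and vX: "v \<notin> X"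
    and D: "cyc c f' b Y'" and vy: "nb c b v y'" and y': "y' \<in> Y'"
    and u: "unmatched c e" "unmatched c f" "unmatched c f'"
  shows "f = f'"
proof (rule ccontr)
  assume ff: "f \<noteq> f'"
  obtain g where g: "g \<in> E" "ends g = {x, q}" "c g \<noteq> a" using xq unfolding step_def by blast
  obtain c' Z where Z: "cyc c' g b Z"
    "\<And>h. h \<in> E \<Longrightarrow> c' h \<noteq> c h \<Longrightarrow> ends h \<subseteq> X \<or> ends h \<subseteq> Y \<or> ends h = {x, w} \<or> ends h = {w, y}"
    "\<And>h k W. cyc c h k W \<Longrightarrow> h \<noteq> e \<Longrightarrow> h \<noteq> f \<Longrightarrow> cyc c' h k W \<and> W \<inter> Z = {} \<and> w \<notin> W"
    "joins c \<subseteq> joins c'" "\<And>v. nb c a q v \<Longrightarrow> v \<notin> X \<Longrightarrow> v \<in> Z \<and> v \<noteq> w"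
    by (rule short_swap[OF C C' ab x y xw wy g]) (use u in blast)
  have o': "opt c'" by (rule cycD(1)[OF Z(1)])
  have "card (joins c') \<le> card (joins c)" using mx o' unfolding maxc_def by blast
  \<comment> \<open>The swap loses no joining edge and \<open>c\<close> already has the most, so
    both sets agree; thus \<open>maxc\<close> and \<open>unmatched\<close> carry over to
    \<open>c'\<close>.\<close>
  then have jj: "joins c' = joins c" using Z(4) card_seteq[OF finite_joins] by metis
  have mx': "maxc c'" using mx o' unfolding maxc_def jj by blast
  have ef': "f' \<noteq> e" using cyc_unique(1)[OF C, of b Y'] D ab by blast
  have D': "cyc c' f' b Y'" using Z(3)[OF D ef'] ff by blast
  have u': "unmatched c' f'" using u(3) unfolding unmatched_def jj .
  have xg: "ends g \<subseteq> X" using cyc_closed[OF C g(1,3), of x] x g(2) by simp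
  have ug: "unmatched c' g"
    unfolding unmatched_def jj using unmatched_cyc[OF C u(1)] xg by blast
  have vZ: "v \<in> Z" using Z(5)[OF qv vX] by blast
  have dY: "Y' \<inter> Y = {}" "Y' \<inter> X = {}"
    using cyc_disjoint[OF D C'] cyc_disjoint[OF D C ef'] ff by auto
  have wY': "w \<notin> Y'" using Z(3)[OF D ef'] ff by blast
  have "nb c' b v y'"
  proof -
    obtain h where h: "h \<in> E" "ends h = {v, y'}" "c h = b" using vy unfolding nb_def by blast
    have "\<not> (ends h \<subseteq> X \<or> ends h \<subseteq> Y \<or> ends h = {x, w} \<or> ends h = {w, y})"
      using h(2) y' dY wY' x y by (auto simp: doubleton_eq_iff)
    then have "c' h = b" using Z(2)[OF h(1)] h(3) by metis
    then show ?thesis unfolding nb_def using h by blast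
  qed
  moreover have "g \<noteq> f'"
  proof
    assume "g = f'"
    then have "x \<in> Y'" using cyc_ends[OF D] g(2) by simp
    then show False using dY x by blast
  qed
  ultimately show False using unmatched_not_linked[OF mx' Z(1) D' _ ug u' vZ y'] by blast
qed

end

section \<open>Discharging\<close>

text \<open>The condition \<open>irreducible\<close> excludes at once a triangle, where
  \<open>e3\<close> joins \<open>y\<close> and \<open>z\<close>, and a double edge with a further
  edge beside it, where \<open>e3\<close> is parallel to \<open>e1\<close> or \<open>e2\<close>. The
  same configuration is what \<open>contraction\<close> removes.\<close>

locale max_coloring = cubic_multigraph +
  fixes c :: "'b \<Rightarrow> nat"
  assumes mx: "maxc c"
    and irreducible: "\<And>x y z e1 e2 e3. \<lbrakk>x \<noteq> y; x \<noteq> z; y \<noteq> z; e1 \<in> E; e2 \<in> E; e3 \<in> E; e1 \<noteq> e2; e1 \<noteq> e3; e2 \<noteq> e3;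
      ends e1 = {x, y}; ends e2 = {x, z}; ends e3 \<subseteq> {x, y, z}\<rbrakk> \<Longrightarrow> False"
begin

lemma opt_c: "opt c"
  using mx unfolding maxc_def by blast

lemma proper_c: "proper c"
  by (rule opt_proper[OF opt_c])

section \<open>The cycles that meet no joining edge, and their lengths\<close>

definition ctype :: "'b \<Rightarrow> nat" where
  "ctype e = (THE k. \<exists>X. cyc c e k X)"

definition cverts :: "'b \<Rightarrow> 'a set" where
  "cverts e = (THE X. \<exists>k. cyc c e k X)"

definition Free :: "'b set" where
  "Free = {e\<in>unc c. unmatched c e}"

lemma cyc_cverts:
  assumes "e \<in> E" "c e = 0"
  shows "cyc c e (ctype e) (cverts e)"
proof -
  obtain k X where C: "cyc c e k X" using cyc_exists[OF opt_c assms] by blast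
  have "ctype e = k" unfolding ctype_def by (rule the_equality) (use C cyc_unique[OF _ C] in blast)+
  moreover have "cverts e = X" unfolding cverts_def by (rule the_equality) (use C cyc_unique[OF _ C] in blast)+
  ultimately show ?thesis using C by simp
qed

lemma Free_cyc: "e \<in> Free \<Longrightarrow> cyc c e (ctype e) (cverts e)"
  unfolding Free_def unc_def using cyc_cverts by blast

lemma Free_unmatched: "e \<in> Free \<Longrightarrow> unmatched c e"
  unfolding Free_def by blast

lemma finite_Free: "finite Free"
  unfolding Free_def using finite_unc by simp

lemma cverts_disjoint: "e \<in> Free \<Longrightarrow> f \<in> Free \<Longrightarrow> e \<noteq> f \<Longrightarrow> cverts e \<inter> cverts f = {}"
  using cyc_disjoint[OF Free_cyc Free_cyc] by blast

lemma cyc_not_3: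
  assumes C: "cyc c e k X" shows "card X \<noteq> 3"
proof
  assume X3: "card X = 3"
  obtain p where p: "p \<in> X" using X3 by fastforce
  obtain q1 q2 where Q: "q1 \<noteq> q2" "p \<noteq> q1" "p \<noteq> q2" "q1 \<in> X" "q2 \<in> X"
    "step c (-{k}) p q1" "step c (-{k}) p q2"
    using cyc_two_nbrs[OF C p] by metis
  obtain r1 r2 where R: "r1 \<noteq> r2" "q1 \<noteq> r1" "q1 \<noteq> r2" "r1 \<in> X" "r2 \<in> X"
    "step c (-{k}) q1 r1" "step c (-{k}) q1 r2"
    using cyc_two_nbrs[OF C Q(4)] by metis
  have "card {p, q1, q2} = 3" using Q by simp
  then have "X = {p, q1, q2}"
    using card_subset_eq[of X "{p, q1, q2}"] X3 p Q(4,5) cyc_finite[OF C] by simp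
  then have "r1 = q2 \<or> r2 = q2" using R by auto
  then have "step c (-{k}) q1 q2" using R by blast
  then obtain e1 e2 e3 where E: "e1 \<in> E" "ends e1 = {p, q1}" "e2 \<in> E" "ends e2 = {p, q2}"
    "e3 \<in> E" "ends e3 = {q1, q2}" using Q unfolding step_def by blast
  have "e1 \<noteq> e2" "e1 \<noteq> e3" "e2 \<noteq> e3" using E Q(1-3) by (auto simp: doubleton_eq_iff)
  then show False using irreducible[of p q1 q2 e1 e2 e3] E Q(1-3) by auto
qed

lemma cyc_ge_5:
  assumes C: "cyc c e k X" shows "card X = 5 \<or> card X = 7 \<or> 9 \<le> card X"
proof -
  obtain p where p: "p \<in> X" using cyc_odd[OF C] by fastforce
  obtain q1 q2 where Q: "q1 \<noteq> q2" "p \<noteq> q1" "p \<noteq> q2" "q1 \<in> X" "q2 \<in> X"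
    using cyc_two_nbrs[OF C p] by metis
  have "card {p, q1, q2} \<le> card X"
    by (rule card_mono) (use p Q cyc_finite[OF C] in auto)
  then have "3 \<le> card X" using Q by simp
  then show ?thesis using cyc_not_3[OF C] cyc_odd[OF C] by presburger
qed

text \<open>Two vertices of a pentagon are adjacent on it or have a common neighbour, because two
  pairs of neighbours do not fit disjointly into the three remaining vertices. So a chord would
  create a double edge or a triangle.\<close>

lemma cyc_5_no_chord:
  assumes C: "cyc c e k X" and X5: "card X = 5" and x: "x \<in> X" "x' \<in> X"
  shows "\<not> nb c k x x'"
proof
  assume "nb c k x x'"
  then obtain h where h: "h \<in> E" "ends h = {x, x'}" "c h = k" unfolding nb_def by blast
  have xx: "x \<noteq> x'" by (rule ends_neq[OF h(1,2)])
  obtain q1 q2 where Q: "q1 \<noteq> q2" "x \<noteq> q1" "x \<noteq> q2" "q1 \<in> X" "q2 \<in> X"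
    "step c (-{k}) x q1" "step c (-{k}) x q2"
    using cyc_two_nbrs[OF C x(1)] by metis
  obtain r1 r2 where R: "r1 \<noteq> r2" "x' \<noteq> r1" "x' \<noteq> r2" "r1 \<in> X" "r2 \<in> X"
    "step c (-{k}) x' r1" "step c (-{k}) x' r2"
    using cyc_two_nbrs[OF C x(2)] by metis
  have two: False if m: "step c (-{k}) m x" "step c (-{k}) m z" "z = x' \<or> m = x'" "z \<noteq> x" "z \<noteq> m" for m z
  proof -
    obtain e1 e2 where E: "e1 \<in> E" "ends e1 = {m, x}" "c e1 \<noteq> k" "e2 \<in> E" "ends e2 = {m, z}" "c e2 \<noteq> k"
      using m unfolding step_def by blast
    have "m \<noteq> x" using ends_neq[OF E(1,2)] .
    moreover have "e1 \<noteq> e2" using E m(4,5) \<open>m \<noteq> x\<close> by (auto simp: doubleton_eq_iff)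
    moreover have "e1 \<noteq> h" "e2 \<noteq> h" using E h by auto
    ultimately show False using irreducible[of m x z e1 e2 h] m(3-5) E h by auto
  qed
  show False
  proof (cases "step c (-{k}) x x'")
    case True
    then have "step c (-{k}) x' x" by (rule step_sym)
    moreover obtain z where "step c (-{k}) x' z" "z \<noteq> x" "z \<noteq> x'" using R by metis
    ultimately show False using two by blast
  next
    case False
    then have "x' \<notin> {q1, q2}" using Q by blast
    moreover have "x \<notin> {r1, r2}" using False R step_sym by blast
    ultimately have sub: "{q1, q2} \<union> {r1, r2} \<subseteq> X - {x, x'}" using Q R by auto
    have "card (X - {x, x'}) = 3" using X5 x xx cyc_finite[OF C] by (simp add: card_Diff_subset)
    then have "card ({q1, q2} \<union> {r1, r2}) \<le> 3"
      using card_mono[OF _ sub] cyc_finite[OF C] by simp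
    moreover have "card ({q1, q2} \<union> {r1, r2}) = card {q1, q2} + card {r1, r2}" if "{q1, q2} \<inter> {r1, r2} = {}"
      by (rule card_Un_disjoint[OF _ _ that]) auto
    moreover have "card {q1, q2} = 2" "card {r1, r2} = 2" using Q(1) R(1) by auto
    ultimately have "{q1, q2} \<inter> {r1, r2} \<noteq> {}" by linarith
    then obtain m where "m \<in> {q1, q2}" "m \<in> {r1, r2}" by blast
    then have "step c (-{k}) m x" "step c (-{k}) m x'" "x' \<noteq> m" using Q R step_sym by auto
    then show False using two[of m x'] xx by blast
  qed
qed

section \<open>Spokes and the outer vertices they reach\<close>

definition Outside :: "'a set" where
  "Outside = V - (\<Union>e\<in>Free. cverts e) - (\<Union>g\<in>joins c. ends g)"

text \<open>The cycles that compete for what \<open>w\<close> has to give. Their types differ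
  because \<open>w\<close> has at most one edge of each colour, so there are at most three.\<close>

definition labels :: "'a \<Rightarrow> 'b set" where
  "labels w = {e\<in>Free. \<exists>x\<in>cverts e. nb c (ctype e) w x}"

definition spoke :: "'b \<Rightarrow> 'a \<Rightarrow> 'a" where
  "spoke e x = (THE w. nb c (ctype e) x w)"

lemma ctype_col: "e \<in> Free \<Longrightarrow> ctype e \<in> {1..3}"
  using cycD(5)[OF Free_cyc] .

lemma ctype_nz: "e \<in> Free \<Longrightarrow> ctype e \<noteq> 0"
  using ctype_col by fastforce

lemma spoke_nb:
  assumes "e \<in> Free" "x \<in> cverts e" shows "nb c (ctype e) x (spoke e x)"
proof -
  obtain w where w: "nb c (ctype e) x w"
    using cyc_spoke[OF Free_cyc[OF assms(1)] assms(2)] not_miss_nb by blast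
  have "spoke e x = w" unfolding spoke_def
    by (rule the_equality[of "nb c (ctype e) x", OF w])
       (rule nb_unique[OF proper_c ctype_nz[OF assms(1)] _ w])
  then show ?thesis using w by simp
qed

lemma spoke_eq: "e \<in> Free \<Longrightarrow> x \<in> cverts e \<Longrightarrow> nb c (ctype e) x w \<Longrightarrow> w = spoke e x"
  using nb_unique[OF proper_c ctype_nz _ spoke_nb] by blast

lemma spoke_inj: "e \<in> Free \<Longrightarrow> inj_on (spoke e) (cverts e)"
  by (rule inj_onI) (metis nb_sym nb_unique[OF proper_c ctype_nz] spoke_nb)

lemma spoke_labels: "e \<in> Free \<Longrightarrow> x \<in> cverts e \<Longrightarrow> e \<in> labels (spoke e x)"
  unfolding labels_def using spoke_nb nb_sym by blast

lemma labels_sub: "labels w \<subseteq> Free"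
  unfolding labels_def by blast

lemma labels_ctype_inj:
  assumes "e \<in> labels w" "f \<in> labels w" "ctype e = ctype f" shows "e = f"
proof (rule ccontr)
  assume "e \<noteq> f"
  then have dis: "cverts e \<inter> cverts f = {}" using cverts_disjoint assms labels_sub by blast
  obtain x where x: "x \<in> cverts e" "nb c (ctype e) w x" using assms unfolding labels_def by blast
  obtain y where y: "y \<in> cverts f" "nb c (ctype f) w y" using assms unfolding labels_def by blast
  have "x = y" using nb_unique[OF proper_c ctype_nz x(2)] y(2) assms labels_sub by auto
  then show False using dis x y by blast
qed

lemma finite_labels: "finite (labels w)"
  using finite_subset[OF labels_sub finite_Free] .

lemma card_labels_le: "card (labels w) \<le> 3"
proof -
  have "inj_on ctype (labels w)" using labels_ctype_inj by (auto intro: inj_onI)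
  moreover have "ctype ` labels w \<subseteq> {1..3}" using ctype_col labels_sub by blast
  ultimately have "card (labels w) \<le> card {1..3::nat}" by (rule card_inj_on_le) simp
  then show ?thesis by simp
qed

text \<open>A cycle of another type through the outer end of the spoke would contain the spoke and
  hence \<open>x\<close>, against disjointness. An unmatched cycle of the same type is excluded by
  \<open>unmatched_not_linked\<close>.\<close>

lemma spoke_Outside:
  assumes e: "e \<in> Free" and x: "x \<in> cverts e" and w: "spoke e x \<notin> cverts e"
  shows "spoke e x \<in> Outside"
proof -
  let ?w = "spoke e x" and ?k = "ctype e" and ?X = "cverts e"
  note C = Free_cyc[OF e]
  have n: "nb c ?k x ?w" by (rule spoke_nb[OF e x])
  obtain hx where hx: "hx \<in> E" "ends hx = {x, ?w}" "c hx = ?k" using n unfolding nb_def by blast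
  have wV: "?w \<in> V" using nb_in_V[OF n] by blast
  have notin: "?w \<notin> Y" if D: "cyc c f l Y" "f \<noteq> e" "l \<noteq> ?k" for f l Y
  proof
    assume "?w \<in> Y"
    then have "ends hx \<subseteq> Y" using cyc_closed[OF D(1) hx(1), of ?w] hx D(3) by simp
    then show False using hx(2) x cyc_disjoint[OF D(1) C D(2)] by blast
  qed
  have "?w \<notin> cverts f" if f: "f \<in> Free" for f
  proof (cases "f = e")
    case False
    show ?thesis
    proof (cases "ctype f = ?k")
      case True
      show ?thesis
        using unmatched_not_linked[OF mx C Free_cyc[OF f, unfolded True] False[symmetric]
            Free_unmatched[OF e] Free_unmatched[OF f] x _ n] by blast
    next
      case F: False
      then show ?thesis using notin[OF Free_cyc[OF f] False] by blast
    qed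
  qed (use w in simp)
  \<comment> \<open>A joining edge \<open>g\<close> at \<open>?w\<close> makes \<open>?w\<close> an
    end of some hole \<open>h\<close>, whose cycle again has type \<open>?k\<close>. If
    \<open>g\<close> has colour \<open>?k\<close>, it is the spoke itself, but no joining edge meets
    an unmatched cycle. Otherwise \<open>g\<close> runs inside the cycle of \<open>h\<close>; its
    ends, which miss a common colour, are then the ends of \<open>h\<close>, against
    optimality.\<close>
  moreover have "?w \<notin> ends g" if g: "g \<in> joins c" for g
  proof
    assume wg: "?w \<in> ends g"
    obtain j where j: "j \<in> {1..3}" "\<forall>v\<in>ends g. miss c v j" "g \<in> E" "c g \<noteq> 0"
      using g unfolding joins_def by blast
    obtain h where h: "h \<in> E" "c h = 0" "?w \<in> ends h"
      by (rule miss_unc[OF proper_c wV _ j(1)]) (use j(2) wg in blast)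
    note D = cyc_cverts[OF h(1,2)]
    have wD: "?w \<in> cverts h" using cyc_ends[OF D] h(3) by blast
    then have he: "h \<noteq> e" using w by blast
    then have th: "ctype h = ?k" using notin[OF D he] wD by blast
    show False
    proof (cases "c g = ?k")
      case True
      have "g = hx" by (rule properD[OF proper_c j(3) hx(1) wg]) (use hx True ctype_nz[OF e] in auto)
      then show False using unmatched_cyc[OF C Free_unmatched[OF e] g] hx(2) x by blast
    next
      case False
      obtain v where v: "ends g = {?w, v}" using ends_pair_at[OF j(3) wg] by blast
      have "ends g \<subseteq> cverts h" using cyc_closed[OF D j(3) _ wg wD] False th by simp
      then have "v \<in> ends h" using cyc_miss[OF D, of v j] j(1,2) v by simp
      moreover have "v \<noteq> ?w" using ends_neq[OF j(3) v] by blast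
      ultimately have "ends h = {?w, v}" using ends_pair_at[OF h(1,3)] by auto
      then show False using opt_no_common_miss[OF opt_c h(1,2) _ j(1)] j(2) v by auto
    qed
  qed
  ultimately show ?thesis unfolding Outside_def using wV by blast
qed

lemma spoke_out_5: "e \<in> Free \<Longrightarrow> card (cverts e) = 5 \<Longrightarrow> x \<in> cverts e \<Longrightarrow> spoke e x \<notin> cverts e"
  using cyc_5_no_chord[OF Free_cyc] spoke_nb by blast

text \<open>An odd set has an odd cut, and its size is not one. The map \<open>\<phi>\<close>
  transfers the count to the vertices from which the cut edges start.\<close>

lemma cut_ge_3:
  assumes "T \<subseteq> V" "odd (card T)" "finite P" "{h\<in>E. ends h \<inter> T \<noteq> {} \<and> \<not> ends h \<subseteq> T} \<subseteq> \<phi> ` P"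
  shows "3 \<le> card P"
proof -
  let ?C = "{h\<in>E. ends h \<inter> T \<noteq> {} \<and> \<not> ends h \<subseteq> T}"
  have "odd (card ?C)" using card_cut[OF assms(1)] assms(2) by presburger
  moreover have "card ?C \<noteq> 1" by (rule no_single_cut[OF assms(1)])
  ultimately have "3 \<le> card ?C" by presburger
  also have "card ?C \<le> card (\<phi> ` P)" by (rule card_mono) (use assms in auto)
  also have "\<dots> \<le> card P" by (rule card_image_le[OF assms(3)])
  finally show ?thesis .
qed

lemma three_out_spokes:
  assumes e: "e \<in> Free" shows "3 \<le> card {x\<in>cverts e. spoke e x \<notin> cverts e}"
proof (rule cut_ge_3[where T = "cverts e" and \<phi> = "\<lambda>x. THE h. h \<in> E \<and> x \<in> ends h \<and> c h = ctype e"])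
  note C = Free_cyc[OF e]
  show "cverts e \<subseteq> V" by (rule cyc_in_V[OF C])
  show "odd (card (cverts e))" by (rule cyc_odd[OF C])
  show "finite {x\<in>cverts e. spoke e x \<notin> cverts e}" using cyc_finite[OF C] by simp
  show "{h\<in>E. ends h \<inter> cverts e \<noteq> {} \<and> \<not> ends h \<subseteq> cverts e} \<subseteq>
      (\<lambda>x. THE h. h \<in> E \<and> x \<in> ends h \<and> c h = ctype e) ` {x\<in>cverts e. spoke e x \<notin> cverts e}"
  proof
    fix h assume "h \<in> {h\<in>E. ends h \<inter> cverts e \<noteq> {} \<and> \<not> ends h \<subseteq> cverts e}"
    then obtain x where h: "h \<in> E" "x \<in> ends h" "x \<in> cverts e" "\<not> ends h \<subseteq> cverts e" by blast
    then have ch: "c h = ctype e" using cyc_closed[OF C h(1)] by blast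
    obtain w where w: "ends h = {x, w}" using ends_pair_at[OF h(1,2)] by blast
    have "nb c (ctype e) x w" unfolding nb_def using h w ch by blast
    then have "w = spoke e x" by (rule spoke_eq[OF e h(3)])
    then have "spoke e x \<notin> cverts e" using h w by auto
    moreover have "(THE h. h \<in> E \<and> x \<in> ends h \<and> c h = ctype e) = h"
      by (rule the_equality) (use h ch properD[OF proper_c] ctype_nz[OF e] in auto)
    ultimately show "h \<in> (\<lambda>x. THE h. h \<in> E \<and> x \<in> ends h \<and> c h = ctype e) ` {x\<in>cverts e. spoke e x \<notin> cverts e}"
      using h(3) by (intro image_eqI[of _ _ x]) auto
  qed
qed

text \<open>The spoke at \<open>x\<close> and the edge leading on to the cycle of \<open>f\<close>
  form a short chain that can be swapped. If \<open>f'\<close> has the type of \<open>f\<close>,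
  \<open>swap_same_target\<close> applies. If not, \<open>swap_separates\<close> says that the edge
  of that type at the end of the next spoke avoids every other cycle, yet it ends on the cycle of
  \<open>f'\<close>.\<close>

lemma adjacent_labels:
  assumes e: "e \<in> Free" "card (cverts e) = 5" and x: "x \<in> cverts e" and xq: "step c (-{ctype e}) x q"
    and f: "f \<in> labels (spoke e x)" "f \<noteq> e" and f': "f' \<in> labels (spoke e q)" "f' \<noteq> e"
  shows "f = f'"
proof (rule ccontr)
  assume ff: "f \<noteq> f'"
  note C = Free_cyc[OF e(1)]
  have qX: "q \<in> cverts e" by (rule cyc_step[OF C x xq])
  have fU: "f \<in> Free" "f' \<in> Free" using f f' labels_sub by auto
  have tf: "ctype e \<noteq> ctype f" using labels_ctype_inj[OF spoke_labels[OF e(1) x] f(1)] f(2) by blast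
  have tf': "ctype e \<noteq> ctype f'" using labels_ctype_inj[OF spoke_labels[OF e(1) qX] f'(1)] f'(2) by blast
  obtain y where y: "y \<in> cverts f" "nb c (ctype f) (spoke e x) y" using f unfolding labels_def by blast
  obtain y' where y': "y' \<in> cverts f'" "nb c (ctype f') (spoke e q) y'" using f' unfolding labels_def by blast
  note n = spoke_nb[OF e(1) x] spoke_nb[OF e(1) qX]
  have vX: "spoke e q \<notin> cverts e" by (rule spoke_out_5[OF e qX])
  show False
  proof (cases "ctype f' = ctype f")
    case True
    show False
      using swap_same_target[OF mx C Free_cyc[OF fU(1)] tf x y(1) n(1) y(2) xq n(2) vX
          Free_cyc[OF fU(2), unfolded True] y'(2)[unfolded True] y'(1)
          Free_unmatched[OF e(1)] Free_unmatched[OF fU(1)] Free_unmatched[OF fU(2)]] ff by blast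
  next
    case False
    obtain t where t: "nb c (ctype f') (spoke e q) t"
      "\<And>h k W. cyc c h k W \<Longrightarrow> h \<noteq> e \<Longrightarrow> h \<noteq> f \<Longrightarrow> spoke e q \<notin> W \<and> t \<notin> W"
      using swap_separates[OF C Free_cyc[OF fU(1)] tf ctype_col[OF fU(2)] tf'[symmetric] False
          x y(1) n(1) y(2) xq n(2) vX] by metis
    have "t = y'" using nb_unique[OF proper_c ctype_nz[OF fU(2)] t(1) y'(2)] .
    then show False using t(2)[OF Free_cyc[OF fU(2)] f'(2) ff[symmetric]] y'(1) by blast
  qed
qed

text \<open>Made for the one case in which spokes do not suffice: a 5-cycle sharing all its outer
  neighbours with another 5-cycle. A vertex just behind a shared one helps, provided that it owes
  nothing to spokes of its own.\<close>

definition helper :: "'b \<Rightarrow> 'a \<Rightarrow> bool" where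
  "helper e t \<longleftrightarrow> labels t = {} \<and> (\<exists>v. (\<exists>j\<in>{1..3}. nb c j t v) \<and> e \<in> labels v \<and> card (labels v) = 2)"

text \<open>Discharging, in units of one sixth: how much a vertex \<open>w\<close> outside the unmatched cycles
  gives to the cycle of \<open>e\<close>.\<close>

definition give :: "'b \<Rightarrow> 'a \<Rightarrow> nat" where
  "give e w = (if e \<in> labels w then
       if card (cverts e) \<noteq> 5 then 2 else if card (labels w) = 1 then 6 else if card (labels w) = 3 then 2
       else if \<exists>f\<in>labels w. card (cverts f) \<noteq> 5 then 4 else 3
     else if helper e w then 1 else 0)"

text \<open>A single label receives at most 6, two labels receive 3 and 3, 4 and 2, or 2 and 2, and
  three receive 2 each. A vertex without labels has at most three neighbours along coloured edges;
  those that count have two labels each, which makes at most six payments of 1.\<close>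

lemma give_total: "(\<Sum>e\<in>Free. give e w) \<le> 6"
proof (cases "labels w = {}")
  case False
  have "give e w = 0" if "e \<notin> labels w" for e
    using that False unfolding give_def helper_def by simp
  then have sum: "(\<Sum>e\<in>Free. give e w) = (\<Sum>e\<in>labels w. give e w)"
    by (intro sum.mono_neutral_right[OF finite_Free labels_sub]) blast
  have "card (labels w) \<noteq> 0" using False finite_labels by simp
  then consider "card (labels w) = 1" | "card (labels w) = 2" | "card (labels w) = 3" using card_labels_le[of w] by linarith
  then show ?thesis
  proof cases
    case 1
    then obtain e where "labels w = {e}" by (rule card_1_singletonE)
    then show ?thesis unfolding sum by (simp add: give_def)
  next
    case 2
    then obtain e f where ef: "labels w = {e, f}" "e \<noteq> f" unfolding card_2_iff by blast
    show ?thesis unfolding sum using 2 ef(2) by (simp add: ef(1) give_def)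
  next
    case 3
    have "(\<Sum>e\<in>labels w. give e w) \<le> of_nat (card (labels w)) * 2"
      by (rule sum_bounded_above) (simp add: give_def 3)
    then show ?thesis unfolding sum 3 by simp
  qed
next
  case True
  define B where "B = {v. (\<exists>j\<in>{1..3}. nb c j w v) \<and> card (labels v) = 2}"
  have "B \<subseteq> (\<lambda>j. THE v. nb c j w v) ` {1..3}"
  proof
    fix v assume "v \<in> B"
    then obtain j where j: "j \<in> {1..3}" "nb c j w v" unfolding B_def by blast
    have "(THE v. nb c j w v) = v"
      by (rule the_equality, rule j(2), rule nb_unique[OF proper_c _ _ j(2)]) (use j(1) in auto)
    then show "v \<in> (\<lambda>j. THE v. nb c j w v) ` {1..3}" using j(1) by force
  qed
  then have fB: "finite B" and "card B \<le> card ((\<lambda>j. THE v. nb c j w v) ` {1..3::nat})"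
    by (auto intro: finite_subset card_mono)
  then have cB: "card B \<le> 3" using card_image_le[of "{1..3::nat}" "\<lambda>j. THE v. nb c j w v"] by simp
  have "(\<Sum>e\<in>Free. give e w) = (\<Sum>e\<in>Free. if helper e w then 1 else 0)"
    by (rule sum.cong[OF refl]) (simp add: give_def True)
  also have "\<dots> = card {e\<in>Free. helper e w}" using finite_Free by (simp add: sum.If_cases Int_def)
  also have "\<dots> \<le> card (\<Union>v\<in>B. labels v)"
    by (rule card_mono) (use fB finite_labels in \<open>auto simp: B_def helper_def\<close>)
  also have "\<dots> \<le> (\<Sum>v\<in>B. card (labels v))" by (rule card_UN_le[OF fB])
  also have "\<dots> = (\<Sum>v\<in>B. 2)" by (rule sum.cong) (auto simp: B_def)
  also have "\<dots> \<le> 6" using cB by simp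
  finally show ?thesis .
qed

text \<open>The two cycles and the five shared vertices form an odd set of 15 vertices, so at least
  three edges leave it. These can start only at shared vertices and have the third colour
  \<open>d\<close>. Swaps starting from either cycle show that their outer ends carry no
  label.\<close>

lemma block_helpers:
  assumes e: "e \<in> Free" "card (cverts e) = 5" and f: "f \<noteq> e" "card (cverts f) = 5"
    and Sx: "\<And>x. x \<in> cverts e \<Longrightarrow> labels (spoke e x) = {e, f}"
  shows "3 \<le> card {t\<in>Outside. helper e t}"
proof -
  let ?X = "cverts e" and ?Y = "cverts f" and ?a = "ctype e" and ?b = "ctype f"
  note C = Free_cyc[OF e(1)]
  obtain x1 where "x1 \<in> ?X" using e(2) by fastforce
  then have fU: "f \<in> Free" using Sx labels_sub by blast
  note C' = Free_cyc[OF fU]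
  have fX: "finite ?X" "finite ?Y" using cyc_finite C C' by auto
  have ab: "?a \<noteq> ?b" using labels_ctype_inj[of e "spoke e x1" f] Sx[OF \<open>x1 \<in> ?X\<close>] f(1) by auto
  have a: "?a \<in> {1..3}" and b: "?b \<in> {1..3}" using ctype_col e(1) fU by auto
  have "\<exists>d\<in>{1..3}. d \<noteq> ?a \<and> d \<noteq> ?b"
  proof -
    have "card ({1..3} - {?a, ?b}) = 1" using a b ab by (simp add: card_Diff_subset)
    then have "{1..3} - {?a, ?b} \<noteq> {}" by (metis card.empty zero_neq_one)
    then show ?thesis by blast
  qed
  then obtain d where d: "d \<in> {1..3}" "d \<noteq> ?a" "d \<noteq> ?b" by blast
  have d0: "d \<noteq> 0" using d(1) by auto
  have dis: "?X \<inter> ?Y = {}" using cverts_disjoint[OF e(1) fU] f(1) by blast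
  have NN: "spoke e x \<in> Outside" if "x \<in> ?X" for x using spoke_Outside[OF e(1) that spoke_out_5[OF e that]] .
  have notcyc: "w \<notin> cverts r" if "w \<in> Outside" "r \<in> Free" for w r using that unfolding Outside_def by blast
  have "\<exists>y\<in>?Y. nb c ?b (spoke e x) y" if "x \<in> ?X" for x
  proof -
    have "f \<in> labels (spoke e x)" using Sx[OF that] by simp
    then show ?thesis unfolding labels_def by blast
  qed
  \<comment> \<open>\<open>\<eta>\<close> leads from the first cycle over the shared vertices to the
    second. Being injective between sets of five elements, it reaches every vertex of the second
    cycle, so that swaps can start there too.\<close>
  then obtain \<eta> where eta: "\<And>x. x \<in> ?X \<Longrightarrow> \<eta> x \<in> ?Y" "\<And>x. x \<in> ?X \<Longrightarrow> nb c ?b (spoke e x) (\<eta> x)" by metis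
  have eta_inj: "inj_on \<eta> ?X"
  proof (rule inj_onI)
    fix x y assume xy: "x \<in> ?X" "y \<in> ?X" "\<eta> x = \<eta> y"
    have "spoke e x = spoke e y"
      using nb_unique[OF proper_c ctype_nz[OF fU] nb_sym[OF eta(2)[OF xy(1)]]] nb_sym[OF eta(2)[OF xy(2)]] xy(3)
      by simp
    then show "x = y" using spoke_inj[OF e(1)] xy by (simp add: inj_on_def)
  qed
  have "\<eta> ` ?X \<subseteq> ?Y" using eta(1) by blast
  moreover have "card (\<eta> ` ?X) = card ?Y" using card_image[OF eta_inj] e(2) f(2) by simp
  ultimately have surj: "\<eta> ` ?X = ?Y" using card_subset_eq[OF fX(2)] by blast
  \<comment> \<open>What two swaps say about the neighbour \<open>t\<close> behind a shared vertex:
    the swap starting on \<open>?X\<close> keeps its \<open>?a\<close>-neighbour off all further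
    cycles, the one starting on \<open>?Y\<close> its \<open>?b\<close>-neighbour.\<close>
  define third where "third x t \<longleftrightarrow> nb c d (spoke e x) t \<and> t \<notin> ?X \<and> t \<notin> ?Y \<and>
      (\<forall>h k W. cyc c h k W \<longrightarrow> h \<noteq> e \<longrightarrow> h \<noteq> f \<longrightarrow> t \<notin> W) \<and>
      (\<forall>h k W u. cyc c h k W \<longrightarrow> h \<noteq> e \<longrightarrow> h \<noteq> f \<longrightarrow> nb c ?a t u \<or> nb c ?b t u \<longrightarrow> u \<notin> W)" for x t
  have "\<exists>t. third x t"
    if x: "x \<in> ?X" for x
  proof -
    obtain x0 where x0: "x0 \<in> ?X" "step c (-{?a}) x x0" using cyc_two_nbrs[OF C x] by metis
    have vX: "spoke e x \<notin> ?X" "spoke e x \<notin> ?Y" using notcyc[OF NN[OF x]] e(1) fU by auto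
    obtain t where t: "nb c d (spoke e x) t" "t \<notin> ?X" "t \<notin> ?Y"
      "\<And>h k W. cyc c h k W \<Longrightarrow> h \<noteq> e \<Longrightarrow> h \<noteq> f \<Longrightarrow> spoke e x \<notin> W \<and> t \<notin> W"
      "\<And>h k W u. cyc c h k W \<Longrightarrow> h \<noteq> e \<Longrightarrow> h \<noteq> f \<Longrightarrow> nb c ?a t u \<Longrightarrow> u \<notin> W"
      by (rule swap_separates[OF C C' ab d x0(1) eta(1)[OF x0(1)] spoke_nb[OF e(1) x0(1)]
            eta(2)[OF x0(1)] step_sym[OF x0(2)] spoke_nb[OF e(1) x] vX(1)]) blast
    have yx: "\<eta> x \<in> ?Y" by (rule eta(1)[OF x])
    obtain y0 where y0: "y0 \<in> ?Y" "step c (-{?b}) (\<eta> x) y0" using cyc_two_nbrs[OF C' yx] by metis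
    then obtain x2 where x2: "x2 \<in> ?X" "y0 = \<eta> x2" using surj by blast
    have n2: "nb c ?b y0 (spoke e x2)" "nb c ?a (spoke e x2) x2"
      using nb_sym eta(2)[OF x2(1)] x2(2) spoke_nb[OF e(1) x2(1)] by auto
    obtain t' where t': "nb c d (spoke e x) t'"
      "\<And>h k W u. cyc c h k W \<Longrightarrow> h \<noteq> f \<Longrightarrow> h \<noteq> e \<Longrightarrow> nb c ?b t' u \<Longrightarrow> u \<notin> W"
      by (rule swap_separates[OF C' C ab[symmetric] d(1,3,2) y0(1) x2(1) n2
            step_sym[OF y0(2)] nb_sym[OF eta(2)[OF x]] vX(2)]) blast
    have "t' = t" using nb_unique[OF proper_c d0 t'(1) t(1)] .
    then show ?thesis unfolding third_def using t t'(2) by blast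
  qed
  then have "\<forall>x\<in>?X. \<exists>t. third x t" by (rule ballI)
  from bchoice[OF this] obtain \<tau> where T: "\<forall>x\<in>?X. third x (\<tau> x)" ..
  have tau: "\<And>x. x \<in> ?X \<Longrightarrow> nb c d (spoke e x) (\<tau> x)"
    "\<And>x. x \<in> ?X \<Longrightarrow> \<tau> x \<notin> ?X" "\<And>x. x \<in> ?X \<Longrightarrow> \<tau> x \<notin> ?Y"
    "\<And>x h k W. x \<in> ?X \<Longrightarrow> cyc c h k W \<Longrightarrow> h \<noteq> e \<Longrightarrow> h \<noteq> f \<Longrightarrow> \<tau> x \<notin> W"
    "\<And>x h k W u. x \<in> ?X \<Longrightarrow> cyc c h k W \<Longrightarrow> h \<noteq> e \<Longrightarrow> h \<noteq> f \<Longrightarrow>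
       nb c ?a (\<tau> x) u \<or> nb c ?b (\<tau> x) u \<Longrightarrow> u \<notin> W"
    using T unfolding third_def by meson+
  have tau_inj: "inj_on \<tau> ?X"
  proof (rule inj_onI)
    fix x y assume xy: "x \<in> ?X" "y \<in> ?X" "\<tau> x = \<tau> y"
    have "spoke e x = spoke e y"
      using nb_unique[OF proper_c d0 nb_sym[OF tau(1)[OF xy(1)]]] nb_sym[OF tau(1)[OF xy(2)]] xy(3) by simp
    then show "x = y" using spoke_inj[OF e(1)] xy by (simp add: inj_on_def)
  qed
  let ?T = "?X \<union> ?Y \<union> spoke e ` ?X"
  let ?O = "{x\<in>?X. \<tau> x \<notin> ?T}"
  have good: "\<tau> x \<in> Outside \<and> helper e (\<tau> x)" if x: "x \<in> ?O" for x
  proof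
    have xX: "x \<in> ?X" and xT: "\<tau> x \<notin> spoke e ` ?X" using x by auto
    note nt = tau(1)[OF xX]
    have tV: "\<tau> x \<in> V" using nb_in_V[OF nt] by blast
    have all: "\<tau> x \<notin> W" if W: "cyc c h k W" for h k W
    proof (cases "h = e \<or> h = f")
      case True
      then have "W = ?X \<or> W = ?Y" using cyc_unique(2)[OF W] C C' by blast
      then show ?thesis using tau(2,3)[OF xX] by blast
    next
      case False
      then show ?thesis using tau(4)[OF xX W] by blast
    qed
    have "\<tau> x \<notin> ends g" if g: "g \<in> joins c" for g
    proof
      assume "\<tau> x \<in> ends g"
      then obtain j where j: "j \<in> {1..3}" "miss c (\<tau> x) j" by (rule join_end_miss[OF g])
      obtain h where h: "h \<in> E" "c h = 0" "\<tau> x \<in> ends h" by (rule miss_unc[OF proper_c tV j(2,1)])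
      then show False using all[OF cyc_cverts[OF h(1,2)]] cyc_ends[OF cyc_cverts[OF h(1,2)]] by blast
    qed
    then show N: "\<tau> x \<in> Outside" unfolding Outside_def using tV all[OF Free_cyc] by blast
    \<comment> \<open>A label of type \<open>?a\<close> or \<open>?b\<close> could only be
      \<open>e\<close> or \<open>f\<close>, whose spokes end inside the block. A label of type
      \<open>d\<close> would put the shared vertex itself on a cycle of \<open>Free\<close>.\<close>
    have "r \<notin> labels (\<tau> x)" for r
    proof
      assume "r \<in> labels (\<tau> x)"
      then obtain z where r: "r \<in> Free" "z \<in> cverts r" "nb c (ctype r) (\<tau> x) z" unfolding labels_def by blast
      note D = Free_cyc[OF r(1)]
      consider "ctype r = ?a" | "ctype r = ?b" | "ctype r = d"
        using third_color[OF a b ab d ctype_col[OF r(1)]] by blast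
      then show False
      proof cases
        case 1
        have "r = e"
          using tau(5)[OF xX D, of z] r(2,3) 1 ab by metis
        then have "\<tau> x = spoke e z" using spoke_eq[OF e(1), of z "\<tau> x"] r(2,3) nb_sym by blast
        then show False using xT r(2) \<open>r = e\<close> by blast
      next
        case 2
        have "r = f"
          using tau(5)[OF xX D, of z] r(2,3) 2 ab by metis
        then obtain x3 where x3: "x3 \<in> ?X" "z = \<eta> x3" using surj r(2) by blast
        have "\<tau> x = spoke e x3"
          using nb_unique[OF proper_c ctype_nz[OF fU], of z "\<tau> x" "spoke e x3"] nb_sym[OF eta(2)[OF x3(1)]] x3(2)
            nb_sym[OF r(3)] 2 by simp
        then show False using xT x3(1) by blast
      next
        case 3
        have "z = spoke e x" using nb_unique[OF proper_c d0, of "\<tau> x" z "spoke e x"] r(3) 3 nb_sym[OF nt] by simp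
        then show False using notcyc[OF NN[OF xX] r(1)] r(2) by blast
      qed
    qed
    then have "labels (\<tau> x) = {}" by blast
    moreover have "e \<in> labels (spoke e x)" "card (labels (spoke e x)) = 2" using Sx[OF xX] f(1) by auto
    ultimately show "helper e (\<tau> x)" unfolding helper_def using nb_sym[OF nt] d(1) by blast
  qed
  have nosp: "spoke e ` ?X \<inter> (?X \<union> ?Y) = {}" using notcyc NN e(1) fU by blast
  have "3 \<le> card ?O"
  proof (rule cut_ge_3[where T = ?T and \<phi> = "\<lambda>x. THE h. h \<in> E \<and> spoke e x \<in> ends h \<and> c h = d"])
    show "?T \<subseteq> V" using cyc_in_V[OF C] cyc_in_V[OF C'] NN unfolding Outside_def by blast
    have "card ?T = card (?X \<union> ?Y) + card (spoke e ` ?X)"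
      by (rule card_Un_disjoint) (use fX nosp in auto)
    also have "card (?X \<union> ?Y) = card ?X + card ?Y" by (rule card_Un_disjoint) (use fX dis in auto)
    also have "card (spoke e ` ?X) = card ?X" by (rule card_image[OF spoke_inj[OF e(1)]])
    finally show "odd (card ?T)" using e(2) f(2) by simp
    show "finite ?O" using fX by simp
    show "{h\<in>E. ends h \<inter> ?T \<noteq> {} \<and> \<not> ends h \<subseteq> ?T} \<subseteq>
      (\<lambda>x. THE h. h \<in> E \<and> spoke e x \<in> ends h \<and> c h = d) ` ?O"
    proof
      fix h assume "h \<in> {h\<in>E. ends h \<inter> ?T \<noteq> {} \<and> \<not> ends h \<subseteq> ?T}"
      then obtain p where h: "h \<in> E" "p \<in> ends h" "p \<in> ?T" "\<not> ends h \<subseteq> ?T" by blast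
      obtain z where z: "ends h = {p, z}" using ends_pair_at[OF h(1,2)] by blast
      have zT: "z \<notin> ?T" using h(3,4) unfolding z by blast
      have npz: "nb c (c h) p z" unfolding nb_def using h z by blast
      have "p \<notin> ?X"
      proof
        assume p: "p \<in> ?X"
        have "c h = ?a" using cyc_closed[OF C h(1) _ h(2) p] h(4) by blast
        then have "z = spoke e p" using spoke_eq[OF e(1) p] npz by simp
        then show False using zT p by blast
      qed
      moreover have "p \<notin> ?Y"
      proof
        assume p: "p \<in> ?Y"
        have ch: "c h = ?b" using cyc_closed[OF C' h(1) _ h(2) p] h(4) by blast
        obtain x where x: "x \<in> ?X" "p = \<eta> x" using p surj by blast
        have "z = spoke e x"
          using nb_unique[OF proper_c ctype_nz[OF fU], of p z "spoke e x"] npz ch nb_sym[OF eta(2)[OF x(1)]] x(2) by simp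
        then show False using zT x(1) by blast
      qed
      ultimately obtain x where x: "x \<in> ?X" "p = spoke e x" using h(3) by blast
      have n: "nb c ?a p x" "nb c ?b p (\<eta> x)" "nb c d p (\<tau> x)"
        using nb_sym[OF spoke_nb[OF e(1) x(1)]] eta(2)[OF x(1)] tau(1)[OF x(1)] x(2) by auto
      have pV: "p \<in> V" using nb_in_V[OF npz] by blast
      have "c h \<noteq> 0"
      proof (rule no_miss_no_unc[OF proper_c pV _ h(1,2)])
        fix k :: nat assume "k \<in> {1..3}"
        then have "k = ?a \<or> k = ?b \<or> k = d" using third_color[OF a b ab d] by blast
        then show "\<not> miss c p k" using n nb_not_miss by blast
      qed
      then have "c h \<in> {1..3}" using proper_le[OF proper_c h(1)] by simp
      then have "c h = ?a \<or> c h = ?b \<or> c h = d" using third_color[OF a b ab d] by blast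
      moreover have "c h \<noteq> ?a"
      proof
        assume "c h = ?a"
        then have "z = x" using nb_unique[OF proper_c ctype_nz[OF e(1)] _ n(1)] npz by simp
        then show False using zT x(1) by blast
      qed
      moreover have "c h \<noteq> ?b"
      proof
        assume "c h = ?b"
        then have "z = \<eta> x" using nb_unique[OF proper_c ctype_nz[OF fU] _ n(2)] npz by simp
        then show False using zT eta(1)[OF x(1)] by blast
      qed
      ultimately have ch: "c h = d" by blast
      then have "z = \<tau> x" using nb_unique[OF proper_c d0 _ n(3)] npz by simp
      then have xO: "x \<in> ?O" using x(1) zT by blast
      have "(THE h. h \<in> E \<and> spoke e x \<in> ends h \<and> c h = d) = h"
        by (rule the_equality) (use h(1,2) x(2) ch d0 properD[OF proper_c] in auto)
      then show "h \<in> (\<lambda>x. THE h. h \<in> E \<and> spoke e x \<in> ends h \<and> c h = d) ` ?O"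
        using xO by (intro image_eqI[of _ _ x]) auto
    qed
  qed
  also have "card ?O = card (\<tau> ` ?O)"
    by (rule card_image[symmetric], rule inj_on_subset[OF tau_inj]) blast
  also have "\<dots> \<le> card {t\<in>Outside. helper e t}"
  proof (rule card_mono)
    show "finite {t\<in>Outside. helper e t}" using finite_V unfolding Outside_def by simp
    show "\<tau> ` ?O \<subseteq> {t\<in>Outside. helper e t}" using good by blast
  qed
  finally show ?thesis .
qed

lemma finite_Outside: "finite Outside"
  unfolding Outside_def using finite_V by simp

text \<open>A cycle of length 7 needs 6 and has at least three outgoing spokes worth 2 each. A cycle
  of length 5 needs 18 and has five outgoing spokes, since it has no chords; what they bring depends
  on the other labels at their ends, and \<open>adjacent_labels\<close> compares these along the
  cycle.\<close>

lemma need_le: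
  assumes e: "e \<in> Free"
  shows "6 * (8 - card (cverts e)) \<le> (\<Sum>w\<in>Outside. give e w)"
proof -
  let ?X = "cverts e" and ?g = "\<lambda>x. give e (spoke e x)"
  note C = Free_cyc[OF e]
  have fX: "finite ?X" by (rule cyc_finite[OF C])
  have img: "(\<Sum>x\<in>A. ?g x) = (\<Sum>w\<in>spoke e ` A. give e w)" if "A \<subseteq> ?X" for A
    using sum.reindex[OF inj_on_subset[OF spoke_inj[OF e] that], of "give e"] by (simp add: o_def)
  consider "card ?X = 5" | "card ?X = 7" | "9 \<le> card ?X" using cyc_ge_5[OF C] by blast
  then show ?thesis
  proof cases
    \<comment> \<open>Truncated subtraction: a long cycle needs nothing.\<close>
    case 3
    then show ?thesis by simp
  next
    case 2
    let ?O = "{x\<in>?X. spoke e x \<notin> ?X}"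
    have "6 \<le> (\<Sum>x\<in>?O. 2::nat)" using three_out_spokes[OF e] by simp
    also have "\<dots> = (\<Sum>x\<in>?O. ?g x)"
      by (rule sum.cong[OF refl]) (use 2 spoke_labels[OF e] in \<open>simp add: give_def\<close>)
    also have "\<dots> = (\<Sum>w\<in>spoke e ` ?O. give e w)" by (rule img) blast
    also have "\<dots> \<le> (\<Sum>w\<in>Outside. give e w)"
      by (rule sum_mono2[OF finite_Outside]) (use spoke_Outside[OF e] in auto)
    finally show ?thesis using 2 by simp
  next
    case 1
    have spN: "spoke e ` ?X \<subseteq> Outside" using spoke_Outside[OF e _ spoke_out_5[OF e 1]] by blast
    define s where "s x = labels (spoke e x) - {e}" for x
    have fs: "finite (s x)" for x unfolding s_def using finite_labels by simp
    have eS: "e \<in> labels (spoke e x)" if "x \<in> ?X" for x using spoke_labels[OF e that] .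
    have cs: "card (labels (spoke e x)) = Suc (card (s x))" if "x \<in> ?X" for x
      unfolding s_def using card.remove[OF finite_labels eS[OF that]] .
    have s2: "card (s x) \<le> 2" if "x \<in> ?X" for x using cs[OF that] card_labels_le[of "spoke e x"] by simp
    have g2: "2 \<le> ?g x" if "x \<in> ?X" for x unfolding give_def using eS[OF that] by simp
    have g6: "?g x = 6" if "x \<in> ?X" "s x = {}" for x
      unfolding give_def using eS[OF that(1)] cs[OF that(1)] that(2) 1 by simp
    have g3: "3 \<le> ?g x" if "x \<in> ?X" "card (s x) \<noteq> 2" for x
      unfolding give_def using eS[OF that(1)] cs[OF that(1)] that(2) s2[OF that(1)] 1 by simp
    have adj: "f = f'" if "x \<in> ?X" "step c (-{ctype e}) x q" "f \<in> s x" "f' \<in> s q" for x q f f'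
      using adjacent_labels[OF e 1 that(1,2), of f f'] that(3,4) unfolding s_def by blast
    have base: "(\<Sum>x\<in>?X. ?g x) = (\<Sum>w\<in>spoke e ` ?X. give e w)" by (rule img) blast
    have le: "(\<Sum>w\<in>spoke e ` ?X. give e w) \<le> (\<Sum>w\<in>Outside. give e w)"
      by (rule sum_mono2[OF finite_Outside spN]) simp
    have "18 \<le> (\<Sum>w\<in>Outside. give e w)"
    proof (cases "\<exists>x\<in>?X. card (s x) = 2")
      case True
      then obtain x where x: "x \<in> ?X" "card (s x) = 2" by blast
      then obtain f1 f2 where f: "f1 \<in> s x" "f2 \<in> s x" "f1 \<noteq> f2" unfolding card_2_iff by blast
      obtain q1 q2 where Q: "q1 \<noteq> q2" "q1 \<in> ?X" "q2 \<in> ?X"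
        "step c (-{ctype e}) x q1" "step c (-{ctype e}) x q2" using cyc_two_nbrs[OF C x(1)] by metis
      \<comment> \<open>Two different labels at \<open>x\<close> leave none for its two neighbours:
        \<open>6 + 6 + 3 * 2 = 18\<close>.\<close>
      have s0: "s q1 = {}" "s q2 = {}"
        using adj[OF x(1) Q(4)] adj[OF x(1) Q(5)] f by blast+
      have "18 = (\<Sum>x\<in>?X. 2) + (\<Sum>x\<in>{q1, q2}. 4::nat)" using 1 Q(1) by simp
      also have "(\<Sum>x\<in>{q1, q2}. 4::nat) = (\<Sum>x\<in>?X. if x \<in> {q1, q2} then 4 else 0)"
      proof -
        have "?X \<inter> {q1, q2} = {q1, q2}" using Q by blast
        then show ?thesis using sum.inter_restrict[OF fX, of "\<lambda>_. 4::nat" "{q1, q2}"] by (simp only:)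
      qed
      also have "(\<Sum>x\<in>?X. 2) + (\<Sum>x\<in>?X. if x \<in> {q1, q2} then 4 else 0::nat) =
          (\<Sum>x\<in>?X. 2 + (if x \<in> {q1, q2} then 4 else 0))" by (rule sum.distrib[symmetric])
      also have "\<dots> \<le> (\<Sum>x\<in>?X. ?g x)"
      proof (rule sum_mono)
        fix z assume z: "z \<in> ?X"
        show "2 + (if z \<in> {q1, q2} then 4 else 0) \<le> ?g z"
          using g2[OF z] g6[OF Q(2) s0(1)] g6[OF Q(3) s0(2)] by (cases "z = q1"; cases "z = q2") simp_all
      qed
      finally show ?thesis using base le by linarith
    next
      case no2: False
      show ?thesis
      proof (cases "\<exists>x\<in>?X. s x = {}")
        case True
        \<comment> \<open>One spoke brings 6, the other four at least 3 each:
          \<open>6 + 4 * 3 = 18\<close>.\<close>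
        then obtain x where x: "x \<in> ?X" "s x = {}" by blast
        have "(\<Sum>x\<in>?X. ?g x) = ?g x + (\<Sum>x\<in>?X - {x}. ?g x)" by (rule sum.remove[OF fX x(1)])
        moreover have "(\<Sum>x\<in>?X - {x}. 3) \<le> (\<Sum>x\<in>?X - {x}. ?g x)"
          by (rule sum_mono) (use g3 no2 in blast)
        moreover have "card (?X - {x}) = 4" using 1 x(1) fX by simp
        ultimately show ?thesis using g6[OF x] base le by simp
      next
        case False
        have one: "card (s x) = 1" if "x \<in> ?X" for x
        proof -
          have "card (s x) \<noteq> 0" using False that fs by simp
          then show ?thesis using s2[OF that] no2 that by fastforce
        qed
        obtain x0 where x0: "x0 \<in> ?X" using 1 by fastforce
        obtain f where f: "s x0 = {f}" using one[OF x0] by (rule card_1_singletonE)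
        \<comment> \<open>Neighbouring vertices have the same single label, so connectedness spreads
          it over the whole cycle.\<close>
        have "{x\<in>?X. s x = {f}} = ?X"
        proof (rule cyc_connected[OF C])
          fix h p assume h: "h \<in> E" "c h \<noteq> ctype e" "p \<in> ends h" "p \<in> {x\<in>?X. s x = {f}}"
          obtain q where q: "ends h = {p, q}" using ends_pair_at[OF h(1,3)] by blast
          have st: "step c (-{ctype e}) p q" unfolding step_def using h q by blast
          have qX: "q \<in> ?X" using cyc_step[OF C _ st] h(4) by blast
          obtain f' where f': "s q = {f'}" using one[OF qX] by (rule card_1_singletonE)
          have "f = f'" using adj[OF _ st, of f f'] h(4) f' by auto
          then show "ends h \<subseteq> {x\<in>?X. s x = {f}}" using q qX f' h(4) by simp
        qed (use x0 f in auto)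
        then have sf: "s x = {f}" if "x \<in> ?X" for x using that by blast
        have fe: "f \<noteq> e" using f unfolding s_def by blast
        have Sx: "labels (spoke e x) = {e, f}" if "x \<in> ?X" for x
          using sf[OF that] eS[OF that] unfolding s_def by blast
        show ?thesis
        proof (cases "card (cverts f) = 5")
          case False
          have "?g x = 4" if "x \<in> ?X" for x
            unfolding give_def using Sx[OF that] fe 1 False by simp
          then have "(\<Sum>x\<in>?X. ?g x) = 20" using 1 by simp
          then show ?thesis using base le by linarith
        next
          case True
          \<comment> \<open>The spokes bring only \<open>5 * 3 = 15\<close>. The missing 3 comes
            from helpers, which are not spoke ends because they carry no label.\<close>
          let ?H = "{t\<in>Outside. helper e t}"
          have "?g x = 3" if "x \<in> ?X" for x
            unfolding give_def using Sx[OF that] fe 1 True by simp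
          then have 15: "(\<Sum>w\<in>spoke e ` ?X. give e w) = 15" using 1 base by simp
          have disj: "spoke e ` ?X \<inter> ?H = {}" using Sx unfolding helper_def by auto
          have "3 \<le> card ?H" by (rule block_helpers[OF e 1 fe True Sx])
          moreover have "(\<Sum>w\<in>?H. give e w) = (\<Sum>w\<in>?H. 1)"
            by (rule sum.cong[OF refl]) (simp add: give_def helper_def)
          ultimately have "18 \<le> (\<Sum>w\<in>spoke e ` ?X. give e w) + (\<Sum>w\<in>?H. give e w)" using 15 by simp
          also have "\<dots> = (\<Sum>w\<in>spoke e ` ?X \<union> ?H. give e w)"
            by (rule sum.union_disjoint[symmetric]) (use fX finite_Outside disj in auto)
          also have "\<dots> \<le> (\<Sum>w\<in>Outside. give e w)"
            by (rule sum_mono2[OF finite_Outside]) (use spN in auto)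
          finally show ?thesis .
        qed
      qed
    qed
    then show ?thesis using 1 by simp
  qed
qed

text \<open>The holes form a matching, so at most \<open>card ?J\<close> of them touch a joining
  edge, and a joining edge has two ends. Each vertex of \<open>?J\<close> is itself one of the eight
  vertices wanted for its hole, so a joining edge is charged at most \<open>2 * 7\<close>, which is
  below 15.\<close>

lemma unc_bound: "8 * card (unc c) \<le> card V + 15 * card (joins c)"
proof -
  let ?J = "\<Union>g\<in>joins c. ends g" and ?W = "\<Union>e\<in>Free. cverts e"
  have JV: "?J \<subseteq> V" using ends_subset unfolding joins_def by blast
  have WV: "?W \<subseteq> V" using cyc_in_V[OF Free_cyc] by blast
  have fJ: "finite ?J" "finite ?W" using JV WV finite_V finite_subset by blast+
  have "(\<Sum>e\<in>Free. 6 * (8 - card (cverts e))) \<le> (\<Sum>e\<in>Free. \<Sum>w\<in>Outside. give e w)"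
    by (rule sum_mono) (rule need_le)
  also have "\<dots> = (\<Sum>w\<in>Outside. \<Sum>e\<in>Free. give e w)" by (rule sum.swap)
  also have "\<dots> \<le> (\<Sum>w\<in>Outside. 6)" by (rule sum_mono) (rule give_total)
  finally have N: "(\<Sum>e\<in>Free. 8 - card (cverts e)) \<le> card Outside" by (simp add: sum_distrib_left[symmetric])
  have "(\<Sum>e\<in>Free. 8) \<le> (\<Sum>e\<in>Free. card (cverts e) + (8 - card (cverts e)))"
    by (rule sum_mono) simp
  then have "8 * card Free \<le> (\<Sum>e\<in>Free. card (cverts e) + (8 - card (cverts e)))" by simp
  then have U: "8 * card Free \<le> (\<Sum>e\<in>Free. card (cverts e)) + card Outside"
    using N by (simp only: sum.distrib)
  have W: "card ?W = (\<Sum>e\<in>Free. card (cverts e))"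
    by (rule card_UN_disjoint[OF finite_Free]) (use cyc_finite[OF Free_cyc] cverts_disjoint in blast)+
  have "?W \<inter> ?J = {}" using unmatched_cyc[OF Free_cyc Free_unmatched] by blast
  then have "card (?W \<union> ?J) = card ?W + card ?J" by (intro card_Un_disjoint fJ)
  moreover have "Outside = V - (?W \<union> ?J)" unfolding Outside_def by blast
  moreover have "card (V - (?W \<union> ?J)) = card V - card (?W \<union> ?J)"
    by (rule card_Diff_subset) (use fJ JV WV in auto)
  moreover have "card (?W \<union> ?J) \<le> card V" by (rule card_mono[OF finite_V]) (use JV WV in auto)
  ultimately have n: "card V = card ?W + card ?J + card Outside" by simp
  let ?M = "unc c - Free"
  have "\<forall>e\<in>?M. \<exists>v. v \<in> ends e \<and> v \<in> ?J" unfolding Free_def unmatched_def by blast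
  from bchoice[OF this] obtain \<phi> where phi: "\<forall>e\<in>?M. \<phi> e \<in> ends e \<and> \<phi> e \<in> ?J" ..
  have "inj_on \<phi> ?M"
  proof (rule inj_onI)
    fix e f assume ef: "e \<in> ?M" "f \<in> ?M" "\<phi> e = \<phi> f"
    have "\<phi> e \<in> ends e" using phi ef(1) by blast
    moreover have "\<phi> e \<in> ends f" unfolding ef(3) using phi ef(2) by blast
    ultimately show "e = f" using opt_unc_unique[OF opt_c] ef(1,2) unfolding unc_def by blast
  qed
  moreover have "\<phi> ` ?M \<subseteq> ?J" using phi by blast
  ultimately have M: "card ?M \<le> card ?J" using card_inj_on_le fJ(1) by blast
  have UUs: "Free \<subseteq> unc c" unfolding Free_def by blast
  have "card ?M = card (unc c) - card Free" by (rule card_Diff_subset[OF finite_Free UUs])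
  then have r: "card (unc c) \<le> card Free + card ?J" using M by linarith
  have "card ?J \<le> (\<Sum>g\<in>joins c. card (ends g))" by (rule card_UN_le[OF finite_joins])
  also have "\<dots> = (\<Sum>g\<in>joins c. 2)"
    by (rule sum.cong[OF refl]) (use card_ends in \<open>auto simp: joins_def\<close>)
  finally have "card ?J \<le> 2 * card (joins c)" by simp
  then show ?thesis using r n U W by linarith
qed

end

section \<open>From the inequality to a large 2-edge-colourable subgraph\<close>

context cubic_multigraph begin

lemma card_E: "2 * card E = 3 * card V"
proof -
  have "{e\<in>E. ends e \<inter> V \<noteq> {} \<and> \<not> ends e \<subseteq> V} = {}" "{e\<in>E. ends e \<subseteq> V} = E"
    using ends_subset by auto
  from card_cut[OF subset_refl, unfolded this] show ?thesis by simp
qed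

text \<open>Drop one colour, and put its joining edges back in a colour both of their ends miss.\<close>

lemma two_colorable_subgraph:
  assumes pr: "proper c"
  shows "\<exists>F\<subseteq>E. k_edge_colorable 2 F ends \<and> 2 * card (E - unc c) + card (joins c) \<le> 3 * card F"
proof -
  define F where "F k = {e\<in>E. c e \<noteq> 0 \<and> c e \<noteq> k} \<union> {g\<in>joins c. c g = k}" for k
  have FE: "F k \<subseteq> E" for k unfolding F_def joins_def by blast
  have col: "k_edge_colorable 2 (F k) ends" if k: "k \<in> {1..3}" for k
  proof -
    have "\<forall>g\<in>joins c. \<exists>j\<in>{1..3}. \<forall>v\<in>ends g. miss c v j" unfolding joins_def by blast
    then have "\<forall>g\<in>joins c. \<exists>j. j \<in> {1..3} \<and> (\<forall>v\<in>ends g. miss c v j)" by blast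
    from bchoice[OF this] obtain j where j: "\<forall>g\<in>joins c. j g \<in> {1..3} \<and> (\<forall>v\<in>ends g. miss c v (j g))" ..
    \<comment> \<open>A colour missing at both ends of a joining edge clashes with no old colour
      there, and two joining edges of the same colour \<open>k\<close> do not meet.\<close>
    define q where "q e = (if c e = k then j e else c e)" for e
    have q13: "q e \<in> {1..3} \<and> q e \<noteq> k" if e: "e \<in> F k" for e
    proof (cases "c e = k")
      case True
      then have "e \<in> joins c" using e unfolding F_def by blast
      then have "e \<in> E" "j e \<in> {1..3}" "\<forall>v\<in>ends e. miss c v (j e)" using j unfolding joins_def by auto
      moreover obtain v where "v \<in> ends e" using ends_nonempty \<open>e \<in> E\<close> by blast
      ultimately have "c e \<noteq> j e" using missD by blast
      then show ?thesis using True \<open>j e \<in> {1..3}\<close> unfolding q_def by simp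
    next
      case False
      then have "e \<in> E" "c e \<noteq> 0" using e unfolding F_def by auto
      then show ?thesis using proper_le[OF pr \<open>e \<in> E\<close>] False unfolding q_def by simp
    qed
    have qdiff: "q e \<noteq> q f" if ef: "e \<in> F k" "f \<in> F k" "e \<noteq> f" "v \<in> ends e" "v \<in> ends f" for e f v
    proof -
      have E: "e \<in> E" "f \<in> E" using ef FE by auto
      have nz: "c e \<noteq> 0" using ef(1) k unfolding F_def by auto
      have ne: "c e \<noteq> c f" using properD[OF pr E ef(4,5)] nz ef(3) by blast
      have J: "g \<in> joins c" if "g \<in> F k" "c g = k" for g using that unfolding F_def by blast
      have M: "miss c v (j g)" if "g \<in> F k" "c g = k" "v \<in> ends g" for g
        using J[OF that(1,2)] that(3) j by blast
      show ?thesis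
        using ne missD[OF M[OF ef(1) _ ef(4)] E(2) ef(5)] missD[OF M[OF ef(2) _ ef(5)] E(1) ef(4)]
        unfolding q_def by (auto split: if_splits)
    qed
    \<comment> \<open>\<open>k_edge_colorable 2\<close> wants the colours 0 and 1, so the two
      colours other than \<open>k\<close> are renamed.\<close>
    obtain \<rho> :: "nat \<Rightarrow> nat" where rho: "inj_on \<rho> ({1..3} - {k})" "\<rho> ` ({1..3} - {k}) \<subseteq> {..<2}"
    proof -
      have "card ({1..3} - {k}) = 2" using k by simp
      then show ?thesis
        using that inj_on_iff_card_le[of "{1..3} - {k}" "{..<2::nat}"] by force
    qed
    show ?thesis
      unfolding k_edge_colorable_def
    proof (intro exI[of _ "\<lambda>e. \<rho> (q e)"] conjI ballI impI)
      fix e assume "e \<in> F k"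
      then show "\<rho> (q e) < 2" using q13 rho(2) by blast
    next
      fix e f assume e: "e \<in> F k" and f: "f \<in> F k" and h: "e \<noteq> f \<and> ends e \<inter> ends f \<noteq> {}"
      then obtain v where "v \<in> ends e" "v \<in> ends f" by blast
      then have "q e \<noteq> q f" using qdiff[OF e f] h by blast
      then show "\<rho> (q e) \<noteq> \<rho> (q f)"
        using inj_onD[OF rho(1), of "q e" "q f"] q13[OF e] q13[OF f] by blast
    qed
  qed
  define n where "n k = card {e\<in>E. c e = k}" for k
  define j where "j k = card {g\<in>joins c. c g = k}" for k
  \<comment> \<open>Summed over the three colours: the three subgraphs have
    \<open>2 * card (E - unc c) + card (joins c)\<close> edges in total, and the largest has at
    least a third of them.\<close>
  have Fcard: "card (F k) + n k = card (E - unc c) + j k" if k: "k \<in> {1..3}" for k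
  proof -
    have "card (F k) = card {e\<in>E. c e \<noteq> 0 \<and> c e \<noteq> k} + card {g\<in>joins c. c g = k}"
      unfolding F_def by (rule card_Un_disjoint) (use finite_E finite_joins in auto)
    moreover have "card ({e\<in>E. c e \<noteq> 0 \<and> c e \<noteq> k} \<union> {e\<in>E. c e = k}) =
        card {e\<in>E. c e \<noteq> 0 \<and> c e \<noteq> k} + card {e\<in>E. c e = k}"
      by (rule card_Un_disjoint) (use finite_E in auto)
    moreover have "{e\<in>E. c e \<noteq> 0 \<and> c e \<noteq> k} \<union> {e\<in>E. c e = k} = E - unc c"
      using k unfolding unc_def by auto
    ultimately show ?thesis unfolding n_def j_def by simp
  qed
  have part: "card A = (\<Sum>k\<in>{1..3}. card {e\<in>A. c e = k})" if A: "finite A" "\<And>e. e \<in> A \<Longrightarrow> e \<in> E \<and> c e \<noteq> 0" for A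
  proof -
    have "c ` A \<subseteq> {1..3}" using A(2) proper_le[OF pr] by (fastforce simp: Suc_le_eq)
    then have "(\<Sum>k\<in>{1..3}. \<Sum>e\<in>{e\<in>A. c e = k}. 1) = (\<Sum>e\<in>A. 1::nat)"
      by (intro sum.group A(1)) simp_all
    then show ?thesis by simp
  qed
  have "card (E - unc c) = (\<Sum>k\<in>{1..3}. card {e\<in>E - unc c. c e = k})"
    by (rule part) (use finite_E in \<open>auto simp: unc_def\<close>)
  also have "\<dots> = (\<Sum>k\<in>{1..3}. n k)" unfolding n_def
    by (rule sum.cong[OF refl], rule arg_cong[of _ _ card]) (auto simp: unc_def)
  finally have sn: "card (E - unc c) = n 1 + n 2 + n 3" by (simp add: numeral_3_eq_3 numeral_2_eq_2)
  have "card (joins c) = (\<Sum>k\<in>{1..3}. j k)" unfolding j_def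
    by (rule part[OF finite_joins]) (auto simp: joins_def)
  then have sj: "card (joins c) = j 1 + j 2 + j 3" by (simp add: numeral_3_eq_3 numeral_2_eq_2)
  have "\<exists>k\<in>{1..3}. 2 * card (E - unc c) + card (joins c) \<le> 3 * card (F k)"
  proof (rule ccontr)
    assume neg: "\<not> ?thesis"
    have lt: "3 * card (F k) < 2 * card (E - unc c) + card (joins c)" if "k \<in> {1..3}" for k
      using neg that not_le by blast
    show False using lt[of 1] lt[of 2] lt[of 3] Fcard[of 1] Fcard[of 2] Fcard[of 3] sn sj by simp
  qed
  then show ?thesis using col FE by blast
qed

lemma colorable_proper:
  assumes F: "F \<subseteq> E" and k: "k_edge_colorable 3 F ends"
  obtains c where "proper c" "unc c = E - F"
proof -
  obtain q where q: "\<forall>e\<in>F. q e < (3::nat)"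
    "\<forall>e\<in>F. \<forall>f\<in>F. e \<noteq> f \<and> ends e \<inter> ends f \<noteq> {} \<longrightarrow> q e \<noteq> q f"
    using k unfolding k_edge_colorable_def by blast
  let ?c = "\<lambda>e. if e \<in> F then Suc (q e) else 0"
  have "proper ?c" unfolding proper_def using q by auto
  moreover have "unc ?c = E - F" unfolding unc_def by auto
  ultimately show ?thesis using that by blast
qed

lemma max_coloring_exists: "\<exists>c. maxc c"
proof -
  have "proper (\<lambda>_. 0)" unfolding proper_def by simp
  from ex_has_least_nat[of proper, OF this, of "\<lambda>c. card (unc c)"]
  obtain c0 where c0: "opt c0" unfolding opt_def by blast
  have "\<forall>c. opt c \<longrightarrow> card (joins c) \<le> card E"
    using card_mono[OF finite_E] unfolding joins_def by (simp add: card_mono finite_E)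
  then have "\<forall>c. opt c \<longrightarrow> card (joins c) < Suc (card E)" by (simp add: less_Suc_eq_le)
  from ex_has_greatest_nat[of opt, OF c0 this]
  show ?thesis unfolding maxc_def .
qed

lemma irreducible_bound:
  assumes irr: "\<And>x y z e1 e2 e3. \<lbrakk>x \<noteq> y; x \<noteq> z; y \<noteq> z; e1 \<in> E; e2 \<in> E; e3 \<in> E; e1 \<noteq> e2; e1 \<noteq> e3; e2 \<noteq> e3;
      ends e1 = {x, y}; ends e2 = {x, z}; ends e3 \<subseteq> {x, y, z}\<rbrakk> \<Longrightarrow> False"
    and F: "F \<subseteq> E" "k_edge_colorable 3 F ends"
  shows "\<exists>F2\<subseteq>E. k_edge_colorable 2 F2 ends \<and> 11 * card V + 22 * card F \<le> 45 * card F2"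
proof -
  obtain c where c: "maxc c" using max_coloring_exists by blast
  interpret max_coloring V E ends c by unfold_locales (rule c, rule irr)
  obtain q where q: "proper q" "unc q = E - F" by (rule colorable_proper[OF F])
  have le: "card (unc c) \<le> card (E - F)" using optD[OF opt_c q(1)] q(2) by simp
  have cF: "card (E - F) = card E - card F" "card F \<le> card E"
    using F(1) finite_E by (auto simp: card_Diff_subset finite_subset card_mono)
  have cU: "card (E - unc c) = card E - card (unc c)" "card (unc c) \<le> card E"
    using finite_E by (auto simp: unc_def card_Diff_subset card_mono)
  obtain F2 where F2: "F2 \<subseteq> E" "k_edge_colorable 2 F2 ends"
    "2 * card (E - unc c) + card (joins c) \<le> 3 * card F2"
    using two_colorable_subgraph[OF proper_c] by blast
  \<comment> \<open>Multiply the bound on \<open>3 * card F2\<close> by 15 and use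
    \<open>unc_bound\<close>; minimality of \<open>card (unc c)\<close> bounds
    \<open>card F\<close>.\<close>
  have "11 * card V + 22 * card F \<le> 45 * card F2"
    using F2(3) unc_bound card_E le cF cU by linarith
  then show ?thesis using F2 by blast
qed

end

section \<open>Contracting a triangle or a double edge\<close>

locale contraction = cubic_multigraph +
  fixes x y z :: 'a and e1 e2 e3 :: 'b
  assumes xyz: "x \<noteq> y" "x \<noteq> z" "y \<noteq> z"
    and e123: "e1 \<in> E" "e2 \<in> E" "e3 \<in> E" "e1 \<noteq> e2" "e1 \<noteq> e3" "e2 \<noteq> e3"
    and ends_e: "ends e1 = {x, y}" "ends e2 = {x, z}" "ends e3 \<subseteq> {x, y, z}"
begin

abbreviation tri :: "'a set" where
  "tri \<equiv> {x, y, z}"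

definition inner :: "'b set" where
  "inner = {e\<in>E. ends e \<subseteq> tri}"

definition outer :: "'b set" where
  "outer = {e\<in>E. ends e \<inter> tri \<noteq> {} \<and> \<not> ends e \<subseteq> tri}"

text \<open>The three vertices collapse to one of them instead of to a new point, so the contracted
  graph lives on the same types and the induction hypothesis applies to it.\<close>

definition pr :: "'a \<Rightarrow> 'a" where
  "pr v = (if v \<in> tri then x else v)"

definition ends' :: "'b \<Rightarrow> 'a set" where
  "ends' e = pr ` ends e"

lemma X_V: "tri \<subseteq> V"
  using ends_in_V[OF e123(1)] ends_in_V[OF e123(2)] ends_e by auto

text \<open>Counting edge ends at three vertices gives
  \<open>card outer + 2 * card inner = 9\<close>. A fourth inner edge would leave a single outer
  edge, which is a bridge.\<close>

lemma inner_outer: "inner = {e1, e2, e3}" "card outer = 3"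
proof -
  have sub: "{e1, e2, e3} \<subseteq> inner" unfolding inner_def using e123 ends_e by auto
  have fin: "finite inner" unfolding inner_def using finite_E by simp
  have c3: "card {e1, e2, e3} = 3" using e123 by simp
  have "card tri = 3" using xyz by simp
  then have "card outer + 2 * card inner = 9" using card_cut[OF X_V] unfolding inner_def outer_def by simp
  moreover have "3 \<le> card inner" using card_mono[OF fin sub] c3 by simp
  moreover have "card outer \<noteq> 1" unfolding outer_def by (rule no_single_cut[OF X_V])
  ultimately have "card inner = 3" "card outer = 3" by presburger+
  then show "card outer = 3" "inner = {e1, e2, e3}" using card_subset_eq[OF fin sub] c3 by auto
qed

lemma outerE:
  assumes "e \<in> outer" obtains p where "e \<in> E" "p \<in> tri" "ends e \<inter> tri = {p}" "p \<in> ends e"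
proof -
  obtain p where p: "e \<in> E" "p \<in> ends e" "p \<in> tri" "\<not> ends e \<subseteq> tri"
    using assms unfolding outer_def by blast
  obtain q where q: "ends e = {p, q}" using ends_pair_at[OF p(1,2)] by blast
  then have "q \<notin> tri" using p by blast
  then have "ends e \<inter> tri = {p}" unfolding q using p(3) by blast
  then show ?thesis using that p by blast
qed

lemma pr_cases: "(v \<in> tri \<and> pr v = x) \<or> (v \<notin> tri \<and> pr v = v)"
  unfolding pr_def by simp

lemma x_in_ends': "e \<in> E \<Longrightarrow> x \<in> ends' e \<longleftrightarrow> ends e \<inter> tri \<noteq> {}"
  unfolding ends'_def pr_def by auto

lemma in_ends': "v \<notin> tri \<Longrightarrow> v \<in> ends' e \<longleftrightarrow> v \<in> ends e"
  unfolding ends'_def pr_def by auto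

lemma contracted: "cubic_multigraph (V - {y, z}) (E - inner) ends'"
proof
  show "finite (V - {y, z})" "finite (E - inner)" using finite_V finite_E by auto
next
  fix e assume e: "e \<in> E - inner"
  have xV: "x \<in> V" using X_V by blast
  have pV: "pr v \<in> V - {y, z}" if "v \<in> V" for v using that xV xyz by (simp add: pr_def)
  have eE: "e \<in> E" using e by blast
  show "ends' e \<subseteq> V - {y, z}"
    unfolding ends'_def by (rule image_subsetI, rule pV, rule ends_in_V[OF eE])
  obtain u v where uv: "ends e = {u, v}" "u \<noteq> v" using ends_pair e by blast
  have "\<not> ends e \<subseteq> tri" using e unfolding inner_def by blast
  then have "\<not> (u \<in> tri \<and> v \<in> tri)" unfolding uv(1) by blast
  then have "pr u \<noteq> pr v" using pr_cases[of u] pr_cases[of v] uv(2) by auto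
  then show "card (ends' e) = 2" unfolding ends'_def uv(1) by simp
next
  fix v assume v: "v \<in> V - {y, z}"
  show "card {e\<in>E - inner. v \<in> ends' e} = 3"
  proof (cases "v = x")
    case True
    have "{e\<in>E - inner. v \<in> ends' e} = outer"
      using x_in_ends' unfolding True inner_def outer_def by auto
    then show ?thesis using inner_outer by simp
  next
    case False
    then have "{e\<in>E - inner. v \<in> ends' e} = {e\<in>E. v \<in> ends e}"
      using in_ends'[of v] v unfolding inner_def by auto
    then show ?thesis using degree_3 v by simp
  qed
next
  fix T assume T: "T \<subseteq> V - {y, z}"
  \<comment> \<open>A cut of the contracted graph is the cut of the preimage of its vertex set,
    since no inner edge crosses the latter.\<close>
  let ?T = "{v\<in>V. pr v \<in> T}"
  have meet: "ends' e \<inter> T \<noteq> {} \<longleftrightarrow> ends e \<inter> ?T \<noteq> {}" if "e \<in> E" for e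
    unfolding ends'_def using ends_subset[OF that] by auto
  have sub: "ends' e \<subseteq> T \<longleftrightarrow> ends e \<subseteq> ?T" if "e \<in> E" for e
    unfolding ends'_def using ends_subset[OF that] by auto
  have inn: "ends e \<subseteq> ?T" if "e \<in> inner" "ends e \<inter> ?T \<noteq> {}" for e
  proof -
    have "e \<in> E" and X: "\<And>v. v \<in> ends e \<Longrightarrow> pr v = x" using that(1) unfolding inner_def pr_def by auto
    then have "x \<in> T" using that(2) by force
    then show ?thesis using X ends_subset[OF \<open>e \<in> E\<close>] by auto
  qed
  have "{e\<in>E - inner. ends' e \<inter> T \<noteq> {} \<and> \<not> ends' e \<subseteq> T} =
      {e\<in>E. ends e \<inter> ?T \<noteq> {} \<and> \<not> ends e \<subseteq> ?T}"
  proof (intro set_eqI iffI)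
    fix e assume "e \<in> {e\<in>E - inner. ends' e \<inter> T \<noteq> {} \<and> \<not> ends' e \<subseteq> T}"
    then show "e \<in> {e\<in>E. ends e \<inter> ?T \<noteq> {} \<and> \<not> ends e \<subseteq> ?T}" using meet[of e] sub[of e] by simp
  next
    fix e assume "e \<in> {e\<in>E. ends e \<inter> ?T \<noteq> {} \<and> \<not> ends e \<subseteq> ?T}"
    then have e: "e \<in> E" "ends e \<inter> ?T \<noteq> {}" "\<not> ends e \<subseteq> ?T" by simp_all
    then have "e \<notin> inner" using inn by blast
    then show "e \<in> {e\<in>E - inner. ends' e \<inter> T \<noteq> {} \<and> \<not> ends' e \<subseteq> T}"
      using e meet[OF e(1)] sub[OF e(1)] by simp
  qed
  moreover have "?T \<subseteq> V" by blast
  ultimately show "card {e\<in>E - inner. ends' e \<inter> T \<noteq> {} \<and> \<not> ends' e \<subseteq> T} \<noteq> 1"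
    using no_single_cut by simp
qed

lemma conflict':
  assumes "e \<in> E" "f \<in> E"
  shows "ends' e \<inter> ends' f \<noteq> {} \<longleftrightarrow>
    ends e \<inter> ends f \<noteq> {} \<or> (ends e \<inter> tri \<noteq> {} \<and> ends f \<inter> tri \<noteq> {})"
proof
  assume "ends' e \<inter> ends' f \<noteq> {}"
  then obtain u v where uv: "u \<in> ends e" "v \<in> ends f" "pr u = pr v" unfolding ends'_def by blast
  show "ends e \<inter> ends f \<noteq> {} \<or> (ends e \<inter> tri \<noteq> {} \<and> ends f \<inter> tri \<noteq> {})"
  proof (cases "u \<in> tri \<and> v \<in> tri")
    case True
    then show ?thesis using uv by blast
  next
    case False
    then have "u = v" using pr_cases[of u] pr_cases[of v] uv(3) by auto
    then show ?thesis using uv by blast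
  qed
next
  assume "ends e \<inter> ends f \<noteq> {} \<or> (ends e \<inter> tri \<noteq> {} \<and> ends f \<inter> tri \<noteq> {})"
  then show "ends' e \<inter> ends' f \<noteq> {}"
    using x_in_ends'[OF assms(1)] x_in_ends'[OF assms(2)] unfolding ends'_def by blast
qed

lemma outer_iff: "e \<in> outer \<longleftrightarrow> e \<in> E - inner \<and> ends e \<inter> tri \<noteq> {}"
  unfolding outer_def inner_def by blast

text \<open>The two added edges have different colours, so they may share one vertex, as on a path,
  or both, as in a double edge.\<close>

lemma extend_coloring:
  assumes F: "F \<subseteq> E - inner" and q: "\<forall>e\<in>F. q e < (2::nat)"
      "\<forall>e\<in>F. \<forall>f\<in>F. e \<noteq> f \<and> ends' e \<inter> ends' f \<noteq> {} \<longrightarrow> q e \<noteq> q f"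
    and ab: "a \<in> inner" "b \<in> inner" "a \<noteq> b"
    and \<alpha>: "\<alpha> < 2" "\<beta> < 2" "\<alpha> \<noteq> \<beta>"
    and fa: "\<And>f. f \<in> F \<Longrightarrow> ends f \<inter> ends a \<noteq> {} \<Longrightarrow> q f \<noteq> \<alpha>"
    and fb: "\<And>f. f \<in> F \<Longrightarrow> ends f \<inter> ends b \<noteq> {} \<Longrightarrow> q f \<noteq> \<beta>"
  shows "\<exists>F2\<subseteq>E. k_edge_colorable 2 F2 ends \<and> card F2 = card F + 2"
proof (intro exI conjI)
  let ?F = "insert a (insert b F)" and ?q = "q(a := \<alpha>, b := \<beta>)"
  have nF: "a \<notin> F" "b \<notin> F" using F ab by auto
  have FE: "f \<in> E" if "f \<in> F" for f using that F by blast
  show "?F \<subseteq> E" using F ab unfolding inner_def by blast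
  show "card ?F = card F + 2" using nF ab(3) finite_subset[OF F] finite_E by simp
  have qq: "q e \<noteq> q f" if "e \<in> F" "f \<in> F" "e \<noteq> f" "ends e \<inter> ends f \<noteq> {}" for e f
    using q(2) conflict'[OF FE[OF that(1)] FE[OF that(2)]] that by blast
  have F2: "?q e \<noteq> ?q f" if ef: "e \<in> ?F" "f \<in> ?F" "e \<noteq> f" "ends e \<inter> ends f \<noteq> {}" for e f
  proof -
    have i: "ends f \<inter> ends e \<noteq> {}" using ef(4) by blast
    consider "e \<in> F" "f \<in> F" | "e \<in> F" "f = a" | "e \<in> F" "f = b" | "f \<in> F" "e = a" | "f \<in> F" "e = b"
      | "e = a" "f = b" | "e = b" "f = a" using ef(1-3) by blast
    then show ?thesis
    proof cases
      case 1 then show ?thesis using qq[OF 1 ef(3,4)] nF by auto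
    next
      case 2 then show ?thesis using fa[of e] ef(4) nF ab(3) by auto
    next
      case 3 then show ?thesis using fb[of e] ef(4) nF ab(3) by auto
    next
      case 4 then show ?thesis using fa[of f] i nF ab(3) by auto
    next
      case 5 then show ?thesis using fb[of f] i nF ab(3) by auto
    qed (use \<alpha> ab(3) in auto)
  qed
  show "k_edge_colorable 2 ?F ends"
    unfolding k_edge_colorable_def
  proof (intro exI[of _ ?q] conjI ballI impI)
    fix e assume "e \<in> ?F" then show "?q e < 2" using q(1) \<alpha> by auto
  next
    fix e f assume "e \<in> ?F" "f \<in> ?F" "e \<noteq> f \<and> ends e \<inter> ends f \<noteq> {}"
    then show "?q e \<noteq> ?q f" using F2 by blast
  qed
qed

lemma card_incident_le_3:
  assumes v: "v \<in> V" and A: "A \<subseteq> E" "\<And>e. e \<in> A \<Longrightarrow> v \<in> ends e" "finite A" shows "card A \<le> 3"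
proof -
  have "A \<subseteq> inc v" using A(1,2) by (auto simp: inc_iff)
  then have "card A \<le> card (inc v)" by (rule card_mono[OF finite_inc])
  then show ?thesis using card_inc[OF v] by simp
qed

text \<open>The three contracted vertices span a triangle, or a double edge with a pendant edge.  In both
  cases two edges are added: a path of length two, or the double edge.\<close>

lemma lift_2_colorable:
  assumes F: "F \<subseteq> E - inner" and k: "k_edge_colorable 2 F ends'"
  shows "\<exists>F2\<subseteq>E. k_edge_colorable 2 F2 ends \<and> card F2 = card F + 2"
proof -
  obtain q where q: "\<forall>e\<in>F. q e < (2::nat)"
    "\<forall>e\<in>F. \<forall>f\<in>F. e \<noteq> f \<and> ends' e \<inter> ends' f \<noteq> {} \<longrightarrow> q e \<noteq> q f"
    using k unfolding k_edge_colorable_def by blast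
  \<comment> \<open>The colours present at \<open>v\<close>. In the contracted graph all outer edges
    meet at \<open>x\<close>, so for the three vertices these are disjoint subsets of
    \<open>{0, 1}\<close>.\<close>
  define U where "U v = {i. \<exists>f\<in>F. v \<in> ends f \<and> q f = i}" for v
  have U2: "i = 0 \<or> i = 1" if "i \<in> U v" for i v using that q(1) unfolding U_def by fastforce
  have Udis: "U u \<inter> U v = {}" if uv: "u \<in> tri" "v \<in> tri" "u \<noteq> v" for u v
  proof (rule ccontr)
    assume "U u \<inter> U v \<noteq> {}"
    then obtain i where "i \<in> U u" "i \<in> U v" by blast
    then obtain e f where ef: "e \<in> F" "f \<in> F" "u \<in> ends e" "v \<in> ends f" "q e = q f"
      unfolding U_def by force
    have E: "e \<in> E" "f \<in> E" using ef F by auto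
    have "e = f" using q(2) ef(1,2,5) conflict'[OF E] ef(3,4) uv by blast
    then have "ends e = {u, v}" using ends_pair_at[OF E(1) ef(3)] ef(4) uv(3) by auto
    then have "e \<in> inner" unfolding inner_def using E uv by simp
    then show False using F ef(1) by blast
  qed
  have Usub: "q f \<in> U v" if "f \<in> F" "v \<in> ends f" for f v using that unfolding U_def by blast
  \<comment> \<open>The middle vertex \<open>m\<close> carries no edge of \<open>F\<close>, so only
    the far ends restrict the new colours. As \<open>U p\<close> and \<open>U r\<close> are disjoint
    and neither is full, two different colours are available.\<close>
  have path: ?thesis
    if m: "a \<in> inner" "b \<in> inner" "a \<noteq> b" "ends a = {m, p}" "ends b = {m, r}" "U m = {}"
      and d: "U p \<inter> U r = {}" and n: "U p \<noteq> {0, 1}" "U r \<noteq> {0, 1}" for a b m p r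
  proof -
    have "\<exists>\<alpha> \<beta>. \<alpha> < 2 \<and> \<beta> < 2 \<and> \<alpha> \<noteq> \<beta> \<and> \<alpha> \<notin> U p \<and> \<beta> \<notin> U r"
    proof (cases "0 \<in> U p \<or> 1 \<in> U r")
      case True
      then have "1 \<notin> U p \<and> 0 \<notin> U r" using d n U2 by blast
      then show ?thesis by (intro exI[of _ 1] exI[of _ 0]) simp
    next
      case False
      then show ?thesis by (intro exI[of _ 0] exI[of _ 1]) simp
    qed
    then obtain \<alpha> \<beta> where ab: "\<alpha> < 2" "\<beta> < 2" "\<alpha> \<noteq> \<beta>" "\<alpha> \<notin> U p" "\<beta> \<notin> U r" by blast
    show ?thesis
    proof (rule extend_coloring[OF F q m(1-3) ab(1-3)])
      fix f assume f: "f \<in> F"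
      have fm: "m \<notin> ends f" using m(6) Usub[OF f] by blast
      show "q f \<noteq> \<alpha>" if "ends f \<inter> ends a \<noteq> {}"
      proof -
        have "p \<in> ends f" using that m(4) fm by auto
        then show ?thesis using Usub[OF f] ab(4) by blast
      qed
      show "q f \<noteq> \<beta>" if "ends f \<inter> ends b \<noteq> {}"
      proof -
        have "r \<in> ends f" using that m(5) fm by auto
        then show ?thesis using Usub[OF f] ab(5) by blast
      qed
    qed
  qed
  have inn: "e1 \<in> inner" "e2 \<in> inner" "e3 \<in> inner" using inner_outer by auto
  have nin: "f \<notin> {e1, e2, e3}" "f \<in> E" if "f \<in> F" for f using that F inner_outer by auto
  have one: "U v \<noteq> {0, 1}" if v: "v \<in> V" "a \<in> inner" "b \<in> inner" "a \<noteq> b" "v \<in> ends a" "v \<in> ends b" for v a b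
  proof
    assume "U v = {0, 1}"
    then obtain f g where fg: "f \<in> F" "g \<in> F" "v \<in> ends f" "v \<in> ends g" "q f = 0" "q g = 1"
      unfolding U_def by blast
    have "card {a, b, f, g} \<le> 3"
      by (rule card_incident_le_3[OF v(1)]) (use v(2-) fg F in \<open>auto simp: inner_def\<close>)
    moreover have "f \<notin> {a, b}" "g \<notin> {a, b}" "f \<noteq> g" using fg F v by auto
    ultimately show False using v(4) by auto
  qed
  have none: "U v = {}" if v: "v \<in> V" "v \<in> ends e1" "v \<in> ends e2" "v \<in> ends e3" for v
  proof (rule ccontr)
    assume "U v \<noteq> {}"
    then obtain f where f: "f \<in> F" "v \<in> ends f" unfolding U_def by blast
    have "card {e1, e2, e3, f} \<le> 3"
      by (rule card_incident_le_3[OF v(1)]) (use v f nin e123 in auto)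
    then show False using nin[OF f(1)] e123 by auto
  qed
  have V3: "x \<in> V" "y \<in> V" "z \<in> V" using X_V by auto
  \<comment> \<open>Here \<open>x\<close> and \<open>p\<close> are joined by the double edge. If no
    edge of \<open>F\<close> is at \<open>p\<close>, both parallel edges are added. Otherwise the
    path from \<open>p\<close> over \<open>x\<close> to \<open>r\<close> is used, and
    \<open>U r\<close> is not full because the disjoint set \<open>U p\<close> is nonempty.\<close>
  have dig: ?thesis if D: "a \<in> inner" "b \<in> inner" "d \<in> inner" "a \<noteq> b" "a \<noteq> d" "ends a = {x, p}" "ends d = {x, p}"
      "ends b = {x, r}" "U x = {}" "p \<in> tri" "r \<in> tri" "p \<noteq> r" for a b d p r
  proof (cases "U p = {}")
    case True
    show ?thesis
    proof (rule extend_coloring[OF F q D(1,3,5), of 0 1])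
      fix f assume f: "f \<in> F"
      have "x \<notin> ends f" "p \<notin> ends f" using D(9) True Usub[OF f] by auto
      then show "ends f \<inter> ends a \<noteq> {} \<Longrightarrow> q f \<noteq> 0" "ends f \<inter> ends d \<noteq> {} \<Longrightarrow> q f \<noteq> 1"
        using D(6,7) by auto
    qed simp_all
  next
    case False
    have "p \<in> V" using D(10) V3 by blast
    then have "U p \<noteq> {0, 1}" using one[of p a d] D by auto
    moreover have "U r \<noteq> {0, 1}" using False Udis[OF D(10-12)] U2 by blast
    ultimately show ?thesis using path[OF D(1,2,4,6,8,9) Udis[OF D(10-12)]] by blast
  qed
  obtain u v where uv: "ends e3 = {u, v}" "u \<noteq> v" using ends_pair[OF e123(3)] by blast
  then consider "ends e3 = {y, z}" | "ends e3 = {x, y}" | "ends e3 = {x, z}" using ends_e(3) by auto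
  then show ?thesis
  proof cases
    case 1
    have n: "U x \<noteq> {0, 1}" "U y \<noteq> {0, 1}" "U z \<noteq> {0, 1}"
      using one[of x e1 e2] one[of y e1 e3] one[of z e2 e3] V3 inn e123 ends_e 1 by auto
    note d = Udis[of x y] Udis[of x z] Udis[of y z]
    \<comment> \<open>One of three disjoint subsets of \<open>{0, 1}\<close> is empty; its vertex
      becomes the middle of the path.\<close>
    have "U x = {} \<or> U y = {} \<or> U z = {}" using d xyz U2 by (metis (full_types) disjoint_iff insertCI ex_in_conv)
    then consider "U x = {}" | "U y = {}" | "U z = {}" by blast
    then show ?thesis
    proof cases
      case 1
      then show ?thesis using path[OF inn(1,2) e123(4) ends_e(1,2) _ _ n(2,3)] d xyz by blast
    next
      case y: 2
      have "ends e1 = {y, x}" using ends_e by blast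
      then show ?thesis using path[OF inn(1,3) e123(5) _ 1 y _ n(1,3)] d xyz by blast
    next
      case z: 3
      have "ends e2 = {z, x}" "ends e3 = {z, y}" using ends_e 1 by auto
      then show ?thesis using path[OF inn(2,3) e123(6) _ _ z _ n(1,2)] d xyz by blast
    qed
  next
    case 2
    then have "U x = {}" using none[OF V3(1)] ends_e by auto
    then show ?thesis using dig[OF inn(1,2,3) e123(4,5) ends_e(1) 2 ends_e(2)] xyz by blast
  next
    case 3
    then have "U x = {}" using none[OF V3(1)] ends_e by auto
    then show ?thesis
      using dig[OF inn(2,1,3) e123(4)[symmetric] e123(6) ends_e(2) 3 ends_e(1)] xyz by blast
  qed
qed

text \<open>Any two inner edges meet, so if all three were coloured, they would use all three
  colours, among them the colour of \<open>e\<close> and \<open>f\<close>. But \<open>e\<close> and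
  \<open>f\<close> end at different vertices of \<open>tri\<close>, and every inner edge touches one
  of the two.\<close>

lemma inner_uncolored:
  assumes p: "proper c" and e: "e \<in> outer" "f \<in> outer" "e \<noteq> f" "c e = c f" "c e \<noteq> 0"
  shows "\<exists>g\<in>inner. c g = 0"
proof (rule ccontr)
  assume "\<not> ?thesis"
  then have nz: "c g \<noteq> 0" if "g \<in> inner" for g using that by metis
  obtain u where u: "e \<in> E" "u \<in> tri" "u \<in> ends e" using outerE[OF e(1)] by metis
  obtain v where v: "f \<in> E" "v \<in> tri" "v \<in> ends f" using outerE[OF e(2)] by metis
  have uv: "u \<noteq> v" using properD[OF p u(1) v(1) u(3), of] v(3) e(3-5) by blast
  have two: "\<exists>s t. ends g = {s, t} \<and> s \<noteq> t \<and> s \<in> tri \<and> t \<in> tri \<and> g \<in> E" if "g \<in> inner" for g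
    using that ends_pair[of g] unfolding inner_def by auto
  have meet: "\<exists>w. w \<in> ends g \<and> w \<in> ends h" if g: "g \<in> inner" "h \<in> inner" for g h
    using two[OF g(1)] two[OF g(2)] by auto
  have touch: "u \<in> ends g \<or> v \<in> ends g" if "g \<in> inner" for g
    using two[OF that] u(2) v(2) uv by auto
  have inj: "inj_on c inner"
  proof (rule inj_onI)
    fix g h assume g: "g \<in> inner" "h \<in> inner" "c g = c h"
    obtain w where "w \<in> ends g" "w \<in> ends h" using meet[OF g(1,2)] by blast
    then show "g = h" using properD[OF p _ _ _ _ g(3) nz[OF g(1)]] two[OF g(1)] two[OF g(2)] by blast
  qed
  have "c ` inner \<subseteq> {1..3}"
  proof
    fix i assume "i \<in> c ` inner"
    then obtain g where g: "g \<in> inner" "i = c g" by blast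
    then have "g \<in> E" unfolding inner_def by blast
    then show "i \<in> {1..3}" using proper_le[OF p, of g] nz[OF g(1)] g(2) by simp
  qed
  moreover have "card (c ` inner) = 3" using card_image[OF inj] inner_outer e123 by simp
  ultimately have im: "c ` inner = {1..3}" using card_subset_eq[of "{1..3::nat}" "c ` inner"] by simp
  have "c e \<in> {1..3}" using proper_le[OF p u(1)] e(5) by simp
  then obtain g where g: "g \<in> inner" "c g = c e" using im by (metis imageE)
  have gE: "g \<in> E" using g(1) unfolding inner_def by blast
  have "g \<noteq> e" "g \<noteq> f" using g(1) e(1,2) outer_iff by auto
  then show False
    using touch[OF g(1)] properD[OF p gE u(1) _ u(3)] properD[OF p gE v(1) _ v(3)] g(2) e(4,5) by metis
qed

lemma descend_aux:
  assumes p: "proper c" and s: "\<And>e f. e \<in> outer \<Longrightarrow> f \<in> outer \<Longrightarrow> e \<noteq> f \<Longrightarrow> c e = c f \<Longrightarrow> c e = 0"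
  shows "k_edge_colorable 3 (E - inner - unc c) ends'"
  unfolding k_edge_colorable_def
proof (intro exI[of _ "\<lambda>e. c e - 1"] conjI ballI impI)
  fix e assume "e \<in> E - inner - unc c"
  then show "c e - 1 < 3" using proper_le[OF p, of e] by simp
next
  fix e f assume e: "e \<in> E - inner - unc c" and f: "f \<in> E - inner - unc c"
    and h: "e \<noteq> f \<and> ends' e \<inter> ends' f \<noteq> {}"
  have E: "e \<in> E" "f \<in> E" "e \<in> E - inner" "f \<in> E - inner" and nz: "c e \<noteq> 0" "c f \<noteq> 0"
    using e f unfolding unc_def by auto
  consider "ends e \<inter> ends f \<noteq> {}" | "ends e \<inter> tri \<noteq> {}" "ends f \<inter> tri \<noteq> {}"
    using conflict'[OF E(1,2)] h by blast
  then have "c e \<noteq> c f"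
  proof cases
    case 1
    then obtain v where "v \<in> ends e" "v \<in> ends f" by blast
    then show ?thesis using properD[OF p E(1,2)] h nz by blast
  next
    case 2
    then show ?thesis using s[of e f] outer_iff E(3,4) h nz by blast
  qed
  then show "c e - 1 \<noteq> c f - 1" using nz by linarith
qed

lemma proper_uncolor: "proper c \<Longrightarrow> proper (\<lambda>e. if e \<in> A then 0 else c e)"
  unfolding proper_def by auto

text \<open>In the contracted graph the outer edges meet and need different colours. If two of them
  clash, some inner edge is uncoloured by \<open>inner_uncolored\<close>; it disappears in the
  contraction, so one outer edge may lose its colour instead. If all three have the same colour, a
  Kempe swap gives one of them another colour beforehand.\<close>

lemma descend_3_colorable:
  assumes F: "F \<subseteq> E" and k: "k_edge_colorable 3 F ends"
  shows "\<exists>F'\<subseteq>E - inner. k_edge_colorable 3 F' ends' \<and> card F \<le> card F' + 3"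
proof -
  obtain c where c: "proper c" "unc c = E - F" by (rule colorable_proper[OF F k])
  have inE: "inner \<subseteq> E" unfolding inner_def by blast
  have cardF: "card F + card (unc c) = card E"
    using c(2) F finite_E by (simp add: card_Diff_subset finite_subset card_mono)
  have cardI: "card (E - inner) + 3 = card E"
  proof -
    have "card inner = 3" using inner_outer e123 by simp
    moreover have "card inner \<le> card E" by (rule card_mono[OF finite_E inE])
    ultimately show ?thesis using card_Diff_subset[of inner E] inE finite_E finite_subset[OF inE] by simp
  qed
  have fin: "finite (unc c \<inter> A)" "finite (unc c' \<inter> A)" for A c' using finite_unc by auto
  \<comment> \<open>The three inner edges are given up, which is the 3 in the claim; outside them
    there may be as many holes as \<open>c\<close> has altogether.\<close>
  have main: ?thesis if c': "proper c'" "card (unc c' - inner) \<le> card (unc c)"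
    "\<And>e f. e \<in> outer \<Longrightarrow> f \<in> outer \<Longrightarrow> e \<noteq> f \<Longrightarrow> c' e = c' f \<Longrightarrow> c' e = 0" for c'
  proof (intro exI[of _ "E - inner - unc c'"] conjI)
    show "E - inner - unc c' \<subseteq> E - inner" by blast
    show "k_edge_colorable 3 (E - inner - unc c') ends'" by (rule descend_aux[OF c'(1,3)])
    have "E - inner - unc c' = (E - inner) - (unc c' - inner)" by blast
    then have "card (E - inner - unc c') = card (E - inner) - card (unc c' - inner)"
      using card_Diff_subset[of "unc c' - inner" "E - inner"] finite_unc[of c'] unfolding unc_def by auto
    then show "card F \<le> card (E - inner - unc c') + 3" using cardF cardI c'(2) by linarith
  qed
  show ?thesis
  proof (cases "\<exists>e f. e \<in> outer \<and> f \<in> outer \<and> e \<noteq> f \<and> c e = c f \<and> c e \<noteq> 0")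
    case False
    show ?thesis
      by (rule main[OF c(1)]) (use False finite_unc card_mono[OF finite_unc, of "unc c - inner" c] in auto)
  next
    case True
    then obtain s1 s2 where s: "s1 \<in> outer" "s2 \<in> outer" "s1 \<noteq> s2" "c s1 = c s2" "c s1 \<noteq> 0" by blast
    obtain g where g: "g \<in> inner" "c g = 0" using inner_uncolored[OF c(1) s] by blast
    have less: "Suc (card (unc c - inner)) \<le> card (unc c)"
    proof -
      have "g \<in> unc c" using g inE unfolding unc_def by blast
      then have "unc c - inner \<subset> unc c" using g(1) by blast
      then show ?thesis using psubset_card_mono[OF finite_unc] Suc_le_eq by blast
    qed
    \<comment> \<open>The uncoloured inner edge leaves room for one more hole, and this will be
      \<open>t\<close>.\<close>
    have main2: ?thesis if d: "proper d" "unc d - inner \<subseteq> unc c - inner" "t \<in> outer"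
      "\<And>e f. e \<in> outer - {t} \<Longrightarrow> f \<in> outer - {t} \<Longrightarrow> e \<noteq> f \<Longrightarrow> d e = d f \<Longrightarrow> d e = 0" for d t
    proof (rule main[of "\<lambda>e. if e \<in> {t} then 0 else d e"])
      show "proper (\<lambda>e. if e \<in> {t} then 0 else d e)" by (rule proper_uncolor[OF d(1)])
      have "unc (\<lambda>e. if e \<in> {t} then 0 else d e) - inner \<subseteq> insert t (unc c - inner)"
        using d(2) unfolding unc_def by (auto split: if_splits)
      then have "card (unc (\<lambda>e. if e \<in> {t} then 0 else d e) - inner) \<le> card (insert t (unc c - inner))"
        using finite_unc by (intro card_mono) auto
      also have "\<dots> \<le> Suc (card (unc c - inner))" by (simp add: card_insert_if finite_unc)
      finally show "card (unc (\<lambda>e. if e \<in> {t} then 0 else d e) - inner) \<le> card (unc c)" using less by linarith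
    next
      fix e f assume "e \<in> outer" "f \<in> outer" "e \<noteq> f"
        "(if e \<in> {t} then 0 else d e) = (if f \<in> {t} then 0 else d f)"
      then show "(if e \<in> {t} then 0 else d e) = 0" using d(4)[of e f] by (auto split: if_splits)
    qed
    have "card (outer - {s1, s2}) = 1"
      using inner_outer(2) s(1-3) by (simp add: card_Diff_subset)
    then obtain s3 where "outer - {s1, s2} = {s3}" by (rule card_1_singletonE)
    then have s3: "outer = {s1, s2, s3}" "s3 \<noteq> s1" "s3 \<noteq> s2" using s(1,2) by auto
    show ?thesis
    proof (cases "c s3 = c s1")
      case False
      show ?thesis
        by (rule main2[OF c(1) subset_refl s(1)]) (use s3 s(4) False in auto)
    next
      case True
      define a where "a = c s1"
      have oa: "c e = a" if "e \<in> outer" for e using that s3 s(4) True unfolding a_def by auto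
      have a0: "a \<noteq> 0" using s(5) unfolding a_def .
      have s1E: "s1 \<in> E" using s(1) unfolding outer_def by blast
      have a3: "a \<in> {1..3}" using proper_le[OF c(1) s1E] a0 unfolding a_def by simp
      have "\<exists>b\<in>{1..3::nat}. b \<noteq> a" by (cases "a = 1") (auto intro: bexI[of _ 1] bexI[of _ 2])
      then obtain b where b: "b \<in> {1..3}" "b \<noteq> a" by blast
      have b0: "b \<noteq> 0" using b by auto
      \<comment> \<open>With the inner edges uncoloured, only \<open>a\<close> can occur at a vertex
        of \<open>tri\<close>. So each of the three is an end of its chain of colours
        \<open>a\<close> and \<open>b\<close>.\<close>
      define c0 where "c0 e = (if e \<in> inner then 0 else c e)" for e
      have p0: "proper c0" unfolding c0_def by (rule proper_uncolor[OF c(1)])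
      have miss: "miss c0 v b" if v: "v \<in> tri" for v
      proof (rule missI)
        fix e assume e: "e \<in> E" "v \<in> ends e"
        show "c0 e \<noteq> b"
        proof (cases "e \<in> inner")
          case False
          then have "e \<in> outer" using outer_iff e v by blast
          then show ?thesis using oa False b(2) unfolding c0_def by auto
        qed (use b0 in \<open>simp add: c0_def\<close>)
      qed
      let ?K = "\<lambda>v. kcomp c0 {a, b} v"
      have V3: "x \<in> V" "y \<in> V" "z \<in> V" using X_V by auto
      \<comment> \<open>At most two of the three ends share a chain. So one vertex \<open>v\<close>
        of \<open>tri\<close> is alone on its chain, and swapping this chain recolours no outer edge
        but the one at \<open>v\<close>.\<close>
      have not3: "\<not> (y \<in> ?K x \<and> z \<in> ?K x)"
        using kcomp_three_endsE[OF p0 a0 b0 b(2)[symmetric] kcomp_self, of y x z] V3 miss xyz by blast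
      have sym: "u \<in> ?K w \<Longrightarrow> w \<in> ?K u" for u w by (rule kcomp_sym)
      have trans: "u \<in> ?K w \<Longrightarrow> t \<in> ?K u \<Longrightarrow> t \<in> ?K w" for t u w by (rule kcomp_trans)
      have self: "u \<in> ?K u" for u by (rule kcomp_self)
      have "(y \<notin> ?K x \<and> z \<notin> ?K x) \<or> (x \<notin> ?K y \<and> z \<notin> ?K y) \<or> (x \<notin> ?K z \<and> y \<notin> ?K z)"
        using not3 sym trans by blast
      then have "\<exists>v\<in>tri. ?K v \<inter> tri = {v}" using self by blast
      then obtain v where v: "v \<in> tri" "?K v \<inter> tri = {v}" by blast
      let ?d = "swap c0 a b (?K v)"
      have pd: "proper ?d" by (rule swap_proper[OF p0 a3 b(1) kcomp_stable])
      have ud: "unc ?d - inner \<subseteq> unc c - inner"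
        unfolding unc_swap[OF a0 b0] unfolding unc_def c0_def by auto
      have dout: "?d e = (if v \<in> ends e then b else a)" if e: "e \<in> outer" for e
      proof -
        obtain w where w: "e \<in> E" "w \<in> tri" "ends e \<inter> tri = {w}" "w \<in> ends e"
          using outerE[OF e] by metis
        have "e \<notin> inner" using e outer_iff by blast
        then have c0e: "c0 e = a" using oa[OF e] unfolding c0_def by simp
        show ?thesis
        proof (cases "w = v")
          case True
          then show ?thesis using swap_in[OF w(1,4), of "?K v" c0 a b] kcomp_self w(4) c0e by simp
        next
          case False
          then have "w \<notin> ?K v" "v \<notin> ends e" using v w by auto
          then show ?thesis using swap_out[OF w(1,4) _ kcomp_stable] c0e by simp
        qed
      qed
      have atv: "e = f" if e: "e \<in> outer" "f \<in> outer" "v \<in> ends e" "v \<in> ends f" for e f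
        using properD[OF c(1) _ _ e(3,4)] oa[OF e(1)] oa[OF e(2)] a0 e(1,2) unfolding outer_def by auto
      have "\<exists>t\<in>outer. v \<notin> ends t" using atv[of s1 s2] s(1-3) by blast
      then obtain t where t: "t \<in> outer" "v \<notin> ends t" by blast
      \<comment> \<open>The three outer edges have a common colour in \<open>c\<close>, so they end
        at three different vertices and one of them is at \<open>v\<close>. It has colour
        \<open>b\<close> now, and \<open>t\<close> is one of the other two.\<close>
      have pair: "v \<in> ends e \<or> v \<in> ends f" if ef: "e \<in> outer - {t}" "f \<in> outer - {t}" "e \<noteq> f" for e f
      proof (rule ccontr)
        assume n: "\<not> ?thesis"
        have "outer = {t, e, f}"
        proof (rule card_seteq[symmetric])
          show "finite outer" unfolding outer_def using finite_E by simp
          show "{t, e, f} \<subseteq> outer" using ef t by blast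
          show "card outer \<le> card {t, e, f}" using inner_outer(2) ef by auto
        qed
        then have nv: "v \<notin> ends h" if "h \<in> outer" for h using that n t by auto
        obtain p1 p2 p3 where P: "s1 \<in> E" "s2 \<in> E" "s3 \<in> E" "p1 \<in> tri" "p1 \<in> ends s1" "p2 \<in> tri" "p2 \<in> ends s2"
          "p3 \<in> tri" "p3 \<in> ends s3"
          using outerE[OF s(1)] outerE[OF s(2)] outerE[of s3] s3(1) by (metis insertCI)
        have "p1 \<noteq> v" "p2 \<noteq> v" "p3 \<noteq> v" using nv P s3(1) by auto
        moreover have "p1 \<noteq> p2" using properD[OF c(1) P(1,2,5)] P(7) s(3-5) by blast
        moreover have "p1 \<noteq> p3" using properD[OF c(1) P(1,3,5)] P(9) s3 True s(5) by metis
        moreover have "p2 \<noteq> p3" using properD[OF c(1) P(2,3,7)] P(9) s3 True s(4,5) by metis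
        ultimately show False using P(4,6,8) v(1) xyz by auto
      qed
      show ?thesis
      proof (rule main2[OF pd ud t(1)])
        fix e f assume e: "e \<in> outer - {t}" "f \<in> outer - {t}" "e \<noteq> f" "?d e = ?d f"
        then have "v \<in> ends e \<longleftrightarrow> v \<in> ends f" using dout[of e] dout[of f] b(2) by (auto split: if_splits)
        then show "?d e = 0" using pair[OF e(1-3)] atv[of e f] e by blast
      qed
    qed
  qed
qed

end

text \<open>Contraction lowers \<open>card V\<close> by 2 and costs \<open>F\<close> at most three
  edges, while two edges are regained in \<open>F2\<close>:
  \<open>11 * 2 + 22 * 3 = 88 \<le> 90 = 45 * 2\<close>. Stating the bound for every
  3-edge-colourable \<open>F\<close> keeps maxima out of the induction.\<close>

lemma two_colorable_bound:
  assumes "cubic_multigraph V E ends" "F \<subseteq> E" "k_edge_colorable 3 F ends"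
  shows "\<exists>F2\<subseteq>E. k_edge_colorable 2 F2 ends \<and> 11 * card V + 22 * card F \<le> 45 * card F2"
  using assms
proof (induction "card V" arbitrary: V E ends F rule: less_induct)
  case less
  interpret cubic_multigraph V E ends by (rule less.prems(1))
  show ?case
  proof (cases "\<exists>x y z e1 e2 e3. x \<noteq> y \<and> x \<noteq> z \<and> y \<noteq> z \<and> e1 \<in> E \<and> e2 \<in> E \<and> e3 \<in> E \<and> e1 \<noteq> e2 \<and> e1 \<noteq> e3 \<and>
      e2 \<noteq> e3 \<and> ends e1 = {x, y} \<and> ends e2 = {x, z} \<and> ends e3 \<subseteq> {x, y, z}")
    case False
    show ?thesis by (rule irreducible_bound[OF _ less.prems(2,3)]) (use False in metis)
  next
    case True
    then obtain x y z e1 e2 e3 where R: "x \<noteq> y" "x \<noteq> z" "y \<noteq> z" "e1 \<in> E" "e2 \<in> E" "e3 \<in> E" "e1 \<noteq> e2"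
      "e1 \<noteq> e3" "e2 \<noteq> e3" "ends e1 = {x, y}" "ends e2 = {x, z}" "ends e3 \<subseteq> {x, y, z}" by auto
    interpret C: contraction V E ends x y z e1 e2 e3
      by (intro contraction.intro contraction_axioms.intro less.prems(1)) (use R in auto)
    have yz: "{y, z} \<subseteq> V" using C.X_V by blast
    have "card (V - {y, z}) = card V - card {y, z}" by (rule card_Diff_subset) (use yz in auto)
    moreover have "card {y, z} \<le> card V" by (rule card_mono[OF finite_V yz])
    ultimately have cV: "card V = card (V - {y, z}) + 2" using R(3) by simp
    obtain F' where F': "F' \<subseteq> E - C.inner" "k_edge_colorable 3 F' C.ends'" "card F \<le> card F' + 3"
      using C.descend_3_colorable[OF less.prems(2,3)] by blast
    obtain F2' where F2': "F2' \<subseteq> E - C.inner" "k_edge_colorable 2 F2' C.ends'"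
      "11 * card (V - {y, z}) + 22 * card F' \<le> 45 * card F2'"
      using less.hyps[OF _ C.contracted F'(1,2)] cV by auto
    obtain F2 where "F2 \<subseteq> E" "k_edge_colorable 2 F2 ends" "card F2 = card F2' + 2"
      using C.lift_2_colorable[OF F2'(1,2)] by blast
    then show ?thesis using F2'(3) F'(3) cV by (intro exI[of _ F2]) simp
  qed
qed

section \<open>Bridges and cuts with a single edge\<close>

lemma adj_sym: "adj F ends u v \<Longrightarrow> adj F ends v u"
  unfolding adj_def by (auto simp: insert_commute)

lemma equiv_connected: "equiv V {(u, v). u \<in> V \<and> v \<in> V \<and> (adj F ends)\<^sup>*\<^sup>* u v}"
proof -
  have "(adj F ends)\<^sup>*\<^sup>* v u" if "(adj F ends)\<^sup>*\<^sup>* u v" for u v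
    using that by (induction rule: rtranclp_induct)
      (auto intro: converse_rtranclp_into_rtranclp adj_sym)
  then show ?thesis
    by (auto intro!: equivI refl_onI symI transI intro: rtranclp_trans)
qed

text \<open>Each component without \<open>e\<close> lies in a component of the graph, and this map
  is onto. It is not injective: the ends of \<open>e\<close> lie in one component of the graph, but
  without \<open>e\<close> no walk from the end in \<open>S\<close> leaves \<open>S\<close>. So
  removing \<open>e\<close> increases the number of components.\<close>

lemma single_cut_is_bridge:
  assumes mg: "multigraph V E ends" and S: "S \<subseteq> V"
    and cut: "{h\<in>E. ends h \<inter> S \<noteq> {} \<and> \<not> ends h \<subseteq> S} = {e}"
  shows "is_bridge V E ends e"
proof -
  let ?R = "\<lambda>F. {(u, v). u \<in> V \<and> v \<in> V \<and> (adj F ends)\<^sup>*\<^sup>* u v}"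
  let ?A = "V // ?R (E - {e})" and ?B = "V // ?R E"
  have e: "e \<in> E" "ends e \<inter> S \<noteq> {}" "\<not> ends e \<subseteq> S" using cut by auto
  have "card (ends e) = 2" "ends e \<subseteq> V" using mg e(1) unfolding multigraph_def by auto
  then obtain p q where pq: "ends e = {p, q}" "p \<in> V" "q \<in> V" unfolding card_2_iff by auto
  have "\<exists>u v. ends e = {u, v} \<and> u \<in> S \<and> v \<notin> S \<and> u \<in> V \<and> v \<in> V"
  proof (cases "p \<in> S")
    case True
    then show ?thesis using pq e(3) by (intro exI[of _ p] exI[of _ q]) auto
  next
    case False
    then show ?thesis using pq e(2) by (intro exI[of _ q] exI[of _ p]) auto
  qed
  then obtain u v where uv: "ends e = {u, v}" "u \<in> S" "v \<notin> S" "u \<in> V" "v \<in> V" by blast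
  have stay: "w \<in> S" if "(adj (E - {e}) ends)\<^sup>*\<^sup>* u w" for w
    using that
  proof (induction rule: rtranclp_induct)
    case base
    show ?case by (rule uv(2))
  next
    case (step p q)
    then obtain h where h: "h \<in> E" "h \<noteq> e" "ends h = {p, q}" unfolding adj_def by blast
    then have "\<not> (ends h \<inter> S \<noteq> {} \<and> \<not> ends h \<subseteq> S)" using cut by blast
    then show ?case using step.IH h(3) by auto
  qed
  have sub: "(adj E ends)\<^sup>*\<^sup>* p q" if "(adj (E - {e}) ends)\<^sup>*\<^sup>* p q" for p q
    using that by (rule mono_rtranclp[rule_format, rotated]) (auto simp: adj_def)
  have fin: "finite V" using mg unfolding multigraph_def by blast
  have fA: "finite ?A" by (rule finite_quotient[OF fin]) auto
  define g where "g C = ?R E `` C" for C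
  have gR: "g (?R (E - {e}) `` {p}) = ?R E `` {p}" if "p \<in> V" for p
  proof
    show "g (?R (E - {e}) `` {p}) \<subseteq> ?R E `` {p}"
      unfolding g_def by (auto intro: rtranclp_trans dest: sub)
    show "?R E `` {p} \<subseteq> g (?R (E - {e}) `` {p})"
      unfolding g_def using that by auto
  qed
  have Bg: "?B = g ` ?A"
  proof (intro set_eqI iffI)
    fix C assume "C \<in> ?B"
    then obtain p where p: "p \<in> V" "C = ?R E `` {p}" by (rule quotientE)
    show "C \<in> g ` ?A"
      by (rule image_eqI[OF _ quotientI[OF p(1)]]) (simp only: gR[OF p(1)] p(2))
  next
    fix C assume "C \<in> g ` ?A"
    then obtain D where D: "D \<in> ?A" "C = g D" by blast
    from D(1) obtain p where p: "p \<in> V" "D = ?R (E - {e}) `` {p}" by (rule quotientE)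
    show "C \<in> ?B" unfolding D(2) p(2) gR[OF p(1)] by (rule quotientI[OF p(1)])
  qed
  have ninj: "\<not> inj_on g ?A"
  proof
    assume inj: "inj_on g ?A"
    have "adj E ends u v" unfolding adj_def using e(1) uv(1) by blast
    then have "(u, v) \<in> ?R E" using uv(4,5) by auto
    then have "?R E `` {u} = ?R E `` {v}" by (rule equiv_class_eq[OF equiv_connected])
    then have "g (?R (E - {e}) `` {u}) = g (?R (E - {e}) `` {v})"
      by (simp only: gR[OF uv(4)] gR[OF uv(5)])
    then have "?R (E - {e}) `` {u} = ?R (E - {e}) `` {v}"
      by (rule inj_onD[OF inj _ quotientI[OF uv(4)] quotientI[OF uv(5)]])
    then have "(u, v) \<in> ?R (E - {e})" using eq_equiv_class[OF _ equiv_connected uv(5)] by blast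
    then show False using stay uv(3) by blast
  qed
  have "card (g ` ?A) \<noteq> card ?A" using eq_card_imp_inj_on[OF fA] ninj by blast
  then have "card ?B < card ?A" unfolding Bg by (rule le_neq_implies_less[OF card_image_le[OF fA]])
  then show ?thesis unfolding is_bridge_def num_components_def using e(1) by blast
qed

lemma bridgeless_cubic_multigraph:
  assumes c: "cubic V E ends" and b: "bridgeless V E ends"
  shows "cubic_multigraph V E ends"
proof
  have mg: "multigraph V E ends" using c unfolding cubic_def by blast
  then show "finite V" "finite E" "\<And>e. e \<in> E \<Longrightarrow> ends e \<subseteq> V" "\<And>e. e \<in> E \<Longrightarrow> card (ends e) = 2"
    unfolding multigraph_def by auto
  show "card {e\<in>E. v \<in> ends e} = 3" if "v \<in> V" for v
    using c that unfolding cubic_def degree_def by blast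
  fix S assume S: "S \<subseteq> V"
  show "card {e\<in>E. ends e \<inter> S \<noteq> {} \<and> \<not> ends e \<subseteq> S} \<noteq> 1"
  proof
    assume "card {e\<in>E. ends e \<inter> S \<noteq> {} \<and> \<not> ends e \<subseteq> S} = 1"
    then obtain e where e: "{e\<in>E. ends e \<inter> S \<noteq> {} \<and> \<not> ends e \<subseteq> S} = {e}" by (rule card_1_singletonE)
    then have "e \<in> E" by blast
    then show False using single_cut_is_bridge[OF mg S e] b unfolding bridgeless_def by blast
  qed
qed

section \<open>The maxima in the theorem are attained\<close>

lemma nu_set_finite: "finite E \<Longrightarrow> finite {card F | F. F \<subseteq> E \<and> k_edge_colorable k F ends}"
  by (rule finite_subset[of _ "card ` Pow E"]) auto

lemma nu_attained:
  assumes "finite E"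
  obtains F where "F \<subseteq> E" "k_edge_colorable k F ends" "card F = nu k E ends"
proof -
  have "k_edge_colorable k {} ends" unfolding k_edge_colorable_def by simp
  then have "{card F | F. F \<subseteq> E \<and> k_edge_colorable k F ends} \<noteq> {}" by blast
  then have "nu k E ends \<in> {card F | F. F \<subseteq> E \<and> k_edge_colorable k F ends}"
    unfolding nu_def by (rule Max_in[OF nu_set_finite[OF assms]])
  then show ?thesis using that by auto
qed

lemma nu_ge:
  assumes "finite E" "F \<subseteq> E" "k_edge_colorable k F ends"
  shows "card F \<le> nu k E ends"
  unfolding nu_def by (rule Max_ge[OF nu_set_finite[OF assms(1)]]) (use assms in blast)

theorem theorem6:
  fixes V :: "'v set" and E :: "'e set" and ends :: "'e \<Rightarrow> 'v set"
  assumes "cubic V E ends" and "bridgeless V E ends"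
  shows "real (nu 2 E ends) \<ge> (44 / 45) * ((real (card V) + 2 * real (nu 3 E ends)) / 4)"
proof -
  note G = bridgeless_cubic_multigraph[OF assms]
  interpret cubic_multigraph V E ends by (rule G)
  obtain F where F: "F \<subseteq> E" "k_edge_colorable 3 F ends" "card F = nu 3 E ends"
    by (rule nu_attained[OF finite_E])
  obtain F2 where F2: "F2 \<subseteq> E" "k_edge_colorable 2 F2 ends" "11 * card V + 22 * card F \<le> 45 * card F2"
    using two_colorable_bound[OF G F(1,2)] by blast
  have "11 * card V + 22 * nu 3 E ends \<le> 45 * nu 2 E ends"
    using F2(3) nu_ge[OF finite_E F2(1,2)] F(3) by linarith
  then have "11 * real (card V) + 22 * real (nu 3 E ends) \<le> 45 * real (nu 2 E ends)" by linarith
  then show ?thesis by simp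
qed

end
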